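(* Let $(\Sigma_1,g_1)$ and $(\Sigma_2,g_2)$ be connected, complete, oriented Riemannian 2-manifolds and let $\epsilon\in\{1,-1\}$. Then $(\Sigma_1\times\Sigma_2,G^{\epsilon},J,\Omega^{\epsilon})$ is a 4-dimensional (pseudo-)Kähler structure; the metric $G^{+}$ is Riemannian while $G^{-}$ is of neutral signature $(2,2)$. Moreover, $G^{\epsilon}$ is (locally) conformally flat if and only if the Gauss curvatures $\kappa(g_1)$ and $\kappa(g_2)$ are both constant with $\kappa(g_1)=-\epsilon\,\kappa(g_2)$.
   Context: For $k=1,2$, $j_k$ is the rotation by $+\pi/2$ in $T\Sigma_k$ and $\omega_k(\cdot,\cdot)=g_k(j_k\cdot,\cdot)$. Let $\pi_i:\Sigma_1\times\Sigma_2\to\Sigma_i$ be the projections. Define $G^{\epsilon}=\pi_1^{*}g_1+\epsilon\,\pi_2^{*}g_2$, $\Omega^{\epsilon}=\pi_1^{*}\omega_1+\epsilon\,\pi_2^{*}\omega_2$, and $J(X_1,X_2)=(j_1X_1,j_2X_2)$ under the splitting $T(\Sigma_1\times\Sigma_2)=T\Sigma_1\oplus T\Sigma_2$. $G^{+},G^{-}$ denote $G^{\epsilon}$ for $\epsilon=1,-1$. A (pseudo-)Kähler structure is a quadruple $(M,G,J,\Omega)$ with $G$ a pseudo-Riemannian metric, $J$ an integrable almost complex structure, and $\Omega$ a symplectic form with $\Omega(J\cdot,J\cdot)=\Omega(\cdot,\cdot)$ and $\Omega(\cdot,\cdot)=G(J\cdot,\cdot)$. $\kappa(g_k)$ is the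 Gauss curvature of $g_k$. Conformally flat means that locally the metric is conformal to a flat metric. *)

theory Defs
  imports "HOL-Analysis.Analysis" "HOL-Library.Function_Algebras"
begin

section \<open>Pointwise real vector space structure on functions\<close>

instantiation "fun" :: (type, real_vector) real_vector
begin

definition scaleR_fun :: "real \<Rightarrow> ('a \<Rightarrow> 'b) \<Rightarrow> 'a \<Rightarrow> 'b"
  where "scaleR_fun c f = (\<lambda>x. c *\<^sub>R f x)"

instance
  by standard (simp_all add: scaleR_fun_def fun_eq_iff scaleR_add_right scaleR_add_left)

end


section \<open>Smooth maps between Euclidean spaces\<close>

text \<open>These are the usual notions only for open \<open>S\<close>, since full (not one-sided) derivatives
  are required.\<close>

primrec Ck_on :: "nat \<Rightarrow> 'a::euclidean_space set \<Rightarrow> ('a \<Rightarrow> 'b::real_normed_vector) \<Rightarrow> bool"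
  where
    "Ck_on 0 S f \<longleftrightarrow> continuous_on S f"
  | "Ck_on (Suc k) S f \<longleftrightarrow>
       (\<forall>x\<in>S. f differentiable (at x)) \<and> (\<forall>v. Ck_on k S (\<lambda>x. frechet_derivative f (at x) v))"

definition smooth_on :: "'a::euclidean_space set \<Rightarrow> ('a \<Rightarrow> 'b::real_normed_vector) \<Rightarrow> bool"
  where "smooth_on S f \<longleftrightarrow> (\<forall>k. Ck_on k S f)"


section \<open>Smooth manifolds\<close>

text \<open>A chart is a pair of a domain and a coordinate map; only the values of the coordinate map
  on the domain matter. The model space \<open>'e\<close> is an arbitrary Euclidean space (rather than
  \<open>real ^ 'n\<close>), so that a product manifold is modelled on the product of the model spaces.\<close>

type_synonym ('a, 'e) chart = "'a set \<times> ('a \<Rightarrow> 'e)"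

definition chart_inv :: "('a, 'e) chart \<Rightarrow> 'e \<Rightarrow> 'a"
  where "chart_inv \<phi> = inv_into (fst \<phi>) (snd \<phi>)"

definition smooth_atlas :: "'a topology \<Rightarrow> ('a, 'e::euclidean_space) chart set \<Rightarrow> bool"
  where "smooth_atlas X A \<longleftrightarrow>
    topspace X = (\<Union>\<phi>\<in>A. fst \<phi>) \<and>
    (\<forall>\<phi>\<in>A. openin X (fst \<phi>) \<and> open (snd \<phi> ` fst \<phi>) \<and>
      homeomorphic_map (subtopology X (fst \<phi>)) (top_of_set (snd \<phi> ` fst \<phi>)) (snd \<phi>)) \<and>
    (\<forall>\<phi>\<in>A. \<forall>\<psi>\<in>A. smooth_on (snd \<phi> ` (fst \<phi> \<inter> fst \<psi>)) (snd \<psi> \<circ> chart_inv \<phi>))"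

definition smooth_manifold :: "'a topology \<Rightarrow> ('a, 'e::euclidean_space) chart set \<Rightarrow> bool"
  where "smooth_manifold X A \<longleftrightarrow>
    Hausdorff_space X \<and> second_countable X \<and> topspace X \<noteq> {} \<and> smooth_atlas X A"

definition smooth_function :: "('a, 'e::euclidean_space) chart set \<Rightarrow> 'a set \<Rightarrow> ('a \<Rightarrow> real) \<Rightarrow> bool"
  where "smooth_function A W f \<longleftrightarrow>
    (\<forall>\<phi>\<in>A. smooth_on (snd \<phi> ` (fst \<phi> \<inter> W)) (f \<circ> chart_inv \<phi>))"


section \<open>Tangent spaces\<close>

text \<open>A tangent vector at \<open>p\<close> is the family of its components in all charts around \<open>p\<close>,
  related by the differentials of the transition maps; at other arguments it is \<open>0\<close>.
  The vector space operations are the pointwise ones.\<close>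

type_synonym ('a, 'e) tvec = "('a, 'e) chart \<Rightarrow> 'e"

definition charts_at :: "('a, 'e) chart set \<Rightarrow> 'a \<Rightarrow> ('a, 'e) chart set"
  where "charts_at A p = {\<phi>\<in>A. p \<in> fst \<phi>}"

definition some_chart :: "('a, 'e) chart set \<Rightarrow> 'a \<Rightarrow> ('a, 'e) chart"
  where "some_chart A p = (SOME \<phi>. \<phi> \<in> charts_at A p)"

definition transition_deriv ::
    "'a \<Rightarrow> ('a, 'e::euclidean_space) chart \<Rightarrow> ('a, 'e) chart \<Rightarrow> 'e \<Rightarrow> 'e"
  where "transition_deriv p \<phi> \<psi> = frechet_derivative (snd \<psi> \<circ> chart_inv \<phi>) (at (snd \<phi> p))"

definition tangent_space :: "('a, 'e::euclidean_space) chart set \<Rightarrow> 'a \<Rightarrow> ('a, 'e) tvec set"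
  where "tangent_space A p =
    {v. (\<forall>\<phi>. \<phi> \<notin> charts_at A p \<longrightarrow> v \<phi> = 0) \<and>
        (\<forall>\<phi>\<in>charts_at A p. \<forall>\<psi>\<in>charts_at A p. v \<psi> = transition_deriv p \<phi> \<psi> (v \<phi>))}"

text \<open>The tangent vector at \<open>p\<close> whose component in the chart \<open>\<phi>\<close> is \<open>u\<close>.\<close>

definition coord_vec ::
    "('a, 'e::euclidean_space) chart set \<Rightarrow> ('a, 'e) chart \<Rightarrow> 'a \<Rightarrow> 'e \<Rightarrow> ('a, 'e) tvec"
  where "coord_vec A \<phi> p u =
    (\<lambda>\<psi>. if \<psi> \<in> charts_at A p then transition_deriv p \<phi> \<psi> u else 0)"

definition tangent_map ::
    "('a, 'e::euclidean_space) chart set \<Rightarrow> ('b, 'f::euclidean_space) chart set \<Rightarrow>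
     ('a \<Rightarrow> 'b) \<Rightarrow> 'a \<Rightarrow> ('a, 'e) tvec \<Rightarrow> ('b, 'f) tvec"
  where "tangent_map A B f p v =
    (let \<phi> = some_chart A p in
      (\<lambda>\<psi>. if \<psi> \<in> charts_at B (f p)
        then frechet_derivative (snd \<psi> \<circ> f \<circ> chart_inv \<phi>) (at (snd \<phi> p)) (v \<phi>) else 0))"

definition directional_deriv ::
    "('a, 'e::euclidean_space) chart set \<Rightarrow> 'a \<Rightarrow> ('a, 'e) tvec \<Rightarrow> ('a \<Rightarrow> real) \<Rightarrow> real"
  where "directional_deriv A p v f =
    (let \<phi> = some_chart A p in
      frechet_derivative (f \<circ> chart_inv \<phi>) (at (snd \<phi> p)) (v \<phi>))"


section \<open>Vector fields and tensor fields\<close>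

definition smooth_vector_field ::
    "('a, 'e::euclidean_space) chart set \<Rightarrow> 'a set \<Rightarrow> ('a \<Rightarrow> ('a, 'e) tvec) \<Rightarrow> bool"
  where "smooth_vector_field A W V \<longleftrightarrow>
    (\<forall>p\<in>W. V p \<in> tangent_space A p) \<and>
    (\<forall>\<phi>\<in>A. smooth_on (snd \<phi> ` (fst \<phi> \<inter> W)) (\<lambda>x. V (chart_inv \<phi> x) \<phi>))"

definition lie_bracket ::
    "('a, 'e::euclidean_space) chart set \<Rightarrow> ('a \<Rightarrow> ('a, 'e) tvec) \<Rightarrow> ('a \<Rightarrow> ('a, 'e) tvec) \<Rightarrow>
     'a \<Rightarrow> ('a, 'e) tvec"
  where "lie_bracket A V W p =
    (\<lambda>\<phi>. if \<phi> \<in> charts_at A p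
      then frechet_derivative (\<lambda>x. W (chart_inv \<phi> x) \<phi>) (at (snd \<phi> p)) (V p \<phi>)
         - frechet_derivative (\<lambda>x. V (chart_inv \<phi> x) \<phi>) (at (snd \<phi> p)) (W p \<phi>)
      else 0)"

type_synonym ('a, 'e) form = "'a \<Rightarrow> ('a, 'e) tvec \<Rightarrow> ('a, 'e) tvec \<Rightarrow> real"

type_synonym ('a, 'e) endo = "'a \<Rightarrow> ('a, 'e) tvec \<Rightarrow> ('a, 'e) tvec"

definition linear_endo_on :: "'v::real_vector set \<Rightarrow> ('v \<Rightarrow> 'v) \<Rightarrow> bool"
  where "linear_endo_on T f \<longleftrightarrow>
    f ` T \<subseteq> T \<and>
    (\<forall>x\<in>T. \<forall>y\<in>T. \<forall>a b. f (a *\<^sub>R x + b *\<^sub>R y) = a *\<^sub>R f x + b *\<^sub>R f y)"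

definition bilinear_form_on :: "'v::real_vector set \<Rightarrow> ('v \<Rightarrow> 'v \<Rightarrow> real) \<Rightarrow> bool"
  where "bilinear_form_on T b \<longleftrightarrow>
    (\<forall>x\<in>T. \<forall>y\<in>T. \<forall>z\<in>T. \<forall>r s.
      b (r *\<^sub>R x + s *\<^sub>R y) z = r * b x z + s * b y z \<and>
      b z (r *\<^sub>R x + s *\<^sub>R y) = r * b z x + s * b z y)"

definition nondegenerate_on :: "'v::real_vector set \<Rightarrow> ('v \<Rightarrow> 'v \<Rightarrow> real) \<Rightarrow> bool"
  where "nondegenerate_on T b \<longleftrightarrow> (\<forall>x\<in>T. (\<forall>y\<in>T. b x y = 0) \<longrightarrow> x = 0)"

definition has_signature :: "'v::real_vector set \<Rightarrow> ('v \<Rightarrow> 'v \<Rightarrow> real) \<Rightarrow> nat \<Rightarrow> nat \<Rightarrow> bool"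
  where "has_signature T b r s \<longleftrightarrow>
    (\<exists>P N. finite P \<and> card P = r \<and> finite N \<and> card N = s \<and> P \<inter> N = {} \<and>
      independent (P \<union> N) \<and> span (P \<union> N) = T \<and>
      (\<forall>x\<in>P \<union> N. \<forall>y\<in>P \<union> N. x \<noteq> y \<longrightarrow> b x y = 0) \<and>
      (\<forall>x\<in>P. b x x > 0) \<and> (\<forall>x\<in>N. b x x < 0))"

text \<open>The components of a bilinear form field in a chart: the value at the point with
  coordinates \<open>x\<close> on the constant coordinate vector fields \<open>u\<close> and \<open>v\<close>.\<close>

definition coord_form ::
    "('a, 'e::euclidean_space) chart set \<Rightarrow> ('a, 'e) form \<Rightarrow> ('a, 'e) chart \<Rightarrow> 'e \<Rightarrow> 'e \<Rightarrow> 'e \<Rightarrow> real"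
  where "coord_form A b \<phi> x u v =
    b (chart_inv \<phi> x) (coord_vec A \<phi> (chart_inv \<phi> x) u) (coord_vec A \<phi> (chart_inv \<phi> x) v)"

definition smooth_form ::
    "'a topology \<Rightarrow> ('a, 'e::euclidean_space) chart set \<Rightarrow> ('a, 'e) form \<Rightarrow> bool"
  where "smooth_form X A b \<longleftrightarrow>
    (\<forall>p\<in>topspace X. bilinear_form_on (tangent_space A p) (b p)) \<and>
    (\<forall>\<phi>\<in>A. \<forall>u v. smooth_on (snd \<phi> ` fst \<phi>) (\<lambda>x. coord_form A b \<phi> x u v))"

definition smooth_endo ::
    "'a topology \<Rightarrow> ('a, 'e::euclidean_space) chart set \<Rightarrow> ('a, 'e) endo \<Rightarrow> bool"
  where "smooth_endo X A J \<longleftrightarrow>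
    (\<forall>p\<in>topspace X. linear_endo_on (tangent_space A p) (J p)) \<and>
    (\<forall>\<phi>\<in>A. \<forall>u. smooth_on (snd \<phi> ` fst \<phi>)
      (\<lambda>x. J (chart_inv \<phi> x) (coord_vec A \<phi> (chart_inv \<phi> x) u) \<phi>))"

definition symmetric_form ::
    "'a topology \<Rightarrow> ('a, 'e::euclidean_space) chart set \<Rightarrow> ('a, 'e) form \<Rightarrow> bool"
  where "symmetric_form X A b \<longleftrightarrow>
    (\<forall>p\<in>topspace X. \<forall>v\<in>tangent_space A p. \<forall>w\<in>tangent_space A p. b p v w = b p w v)"


section \<open>Metrics\<close>

definition riemannian_metric ::
    "'a topology \<Rightarrow> ('a, 'e::euclidean_space) chart set \<Rightarrow> ('a, 'e) form \<Rightarrow> bool"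
  where "riemannian_metric X A g \<longleftrightarrow>
    smooth_form X A g \<and> symmetric_form X A g \<and>
    (\<forall>p\<in>topspace X. \<forall>v\<in>tangent_space A p. v \<noteq> 0 \<longrightarrow> g p v v > 0)"

definition metric_signature ::
    "'a topology \<Rightarrow> ('a, 'e::euclidean_space) chart set \<Rightarrow> ('a, 'e) form \<Rightarrow> nat \<Rightarrow> nat \<Rightarrow> bool"
  where "metric_signature X A g r s \<longleftrightarrow>
    (\<forall>p\<in>topspace X. has_signature (tangent_space A p) (g p) r s)"

definition pseudo_riemannian_metric ::
    "'a topology \<Rightarrow> ('a, 'e::euclidean_space) chart set \<Rightarrow> ('a, 'e) form \<Rightarrow> bool"
  where "pseudo_riemannian_metric X A g \<longleftrightarrow>
    smooth_form X A g \<and> symmetric_form X A g \<and>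
    (\<forall>p\<in>topspace X. nondegenerate_on (tangent_space A p) (g p)) \<and>
    (\<exists>r s. metric_signature X A g r s)"


section \<open>Riemannian distance and completeness\<close>

definition C1_segment ::
    "('a, 'e::euclidean_space) chart set \<Rightarrow> (real \<Rightarrow> 'a) \<Rightarrow> real \<Rightarrow> real \<Rightarrow> bool"
  where "C1_segment A \<gamma> a b \<longleftrightarrow>
    (\<forall>\<phi>\<in>A.
      (\<forall>t\<in>{a..b}. \<gamma> t \<in> fst \<phi> \<longrightarrow> (snd \<phi> \<circ> \<gamma>) differentiable (at t within {a..b})) \<and>
      continuous_on {t\<in>{a..b}. \<gamma> t \<in> fst \<phi>}
        (\<lambda>t. vector_derivative (snd \<phi> \<circ> \<gamma>) (at t within {a..b})))"

definition piecewise_C1_curve ::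
    "'a topology \<Rightarrow> ('a, 'e::euclidean_space) chart set \<Rightarrow> (real \<Rightarrow> 'a) \<Rightarrow> bool"
  where "piecewise_C1_curve X A \<gamma> \<longleftrightarrow>
    pathin X \<gamma> \<and>
    (\<exists>D. finite D \<and> {0, 1} \<subseteq> D \<and> D \<subseteq> {0..1} \<and>
      (\<forall>a\<in>D. \<forall>b\<in>D. a < b \<and> {a<..<b} \<inter> D = {} \<longrightarrow> C1_segment A \<gamma> a b))"

definition velocity ::
    "('a, 'e::euclidean_space) chart set \<Rightarrow> (real \<Rightarrow> 'a) \<Rightarrow> real \<Rightarrow> ('a, 'e) tvec"
  where "velocity A \<gamma> t =
    (\<lambda>\<phi>. if \<phi> \<in> charts_at A (\<gamma> t) then vector_derivative (snd \<phi> \<circ> \<gamma>) (at t) else 0)"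

definition curve_length ::
    "('a, 'e::euclidean_space) chart set \<Rightarrow> ('a, 'e) form \<Rightarrow> (real \<Rightarrow> 'a) \<Rightarrow> real"
  where "curve_length A g \<gamma> =
    integral {0..1} (\<lambda>t. sqrt (g (\<gamma> t) (velocity A \<gamma> t) (velocity A \<gamma> t)))"

definition riemannian_dist ::
    "'a topology \<Rightarrow> ('a, 'e::euclidean_space) chart set \<Rightarrow> ('a, 'e) form \<Rightarrow> 'a \<Rightarrow> 'a \<Rightarrow> real"
  where "riemannian_dist X A g p q =
    Inf {curve_length A g \<gamma> | \<gamma>. piecewise_C1_curve X A \<gamma> \<and> \<gamma> 0 = p \<and> \<gamma> 1 = q}"

text \<open>Meant for connected manifolds, on which the Riemannian distance is a metric. By the
  Hopf-Rinow theorem this is also geodesic completeness.\<close>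

definition complete_riemannian ::
    "'a topology \<Rightarrow> ('a, 'e::euclidean_space) chart set \<Rightarrow> ('a, 'e) form \<Rightarrow> bool"
  where "complete_riemannian X A g \<longleftrightarrow>
    Metric_space.mcomplete (topspace X) (riemannian_dist X A g)"


section \<open>Curvature\<close>

text \<open>The Christoffel symbols in a chart, as the bilinear map \<open>\<Gamma>\<close> with
  \<open>\<nabla>\<^sub>u v = \<Gamma>(u, v)\<close> for constant coordinate vector fields \<open>u\<close>, \<open>v\<close> (Koszul formula).\<close>

definition christoffel ::
    "('a, 'e::euclidean_space) chart set \<Rightarrow> ('a, 'e) form \<Rightarrow> ('a, 'e) chart \<Rightarrow> 'e \<Rightarrow> 'e \<Rightarrow> 'e \<Rightarrow> 'e"
  where "christoffel A g \<phi> x u v =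
    (THE z. \<forall>w. 2 * coord_form A g \<phi> x z w =
        frechet_derivative (\<lambda>y. coord_form A g \<phi> y v w) (at x) u
      + frechet_derivative (\<lambda>y. coord_form A g \<phi> y u w) (at x) v
      - frechet_derivative (\<lambda>y. coord_form A g \<phi> y u v) (at x) w)"

text \<open>The sign convention is \<open>R(u, v)w = \<nabla>\<^sub>u \<nabla>\<^sub>v w - \<nabla>\<^sub>v \<nabla>\<^sub>u w - \<nabla>\<^bsub>[u, v]\<^esub> w\<close>.\<close>

definition coord_curvature ::
    "('a, 'e::euclidean_space) chart set \<Rightarrow> ('a, 'e) form \<Rightarrow> ('a, 'e) chart \<Rightarrow>
     'e \<Rightarrow> 'e \<Rightarrow> 'e \<Rightarrow> 'e \<Rightarrow> 'e"
  where "coord_curvature A g \<phi> x u v w =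
      frechet_derivative (\<lambda>y. christoffel A g \<phi> y v w) (at x) u
    - frechet_derivative (\<lambda>y. christoffel A g \<phi> y u w) (at x) v
    + christoffel A g \<phi> x u (christoffel A g \<phi> x v w)
    - christoffel A g \<phi> x v (christoffel A g \<phi> x u w)"

definition riemann_tensor ::
    "('a, 'e::euclidean_space) chart set \<Rightarrow> ('a, 'e) form \<Rightarrow> 'a \<Rightarrow>
     ('a, 'e) tvec \<Rightarrow> ('a, 'e) tvec \<Rightarrow> ('a, 'e) tvec \<Rightarrow> ('a, 'e) tvec"
  where "riemann_tensor A g p u v w =
    (\<lambda>\<phi>. if \<phi> \<in> charts_at A p
      then coord_curvature A g \<phi> (snd \<phi> p) (u \<phi>) (v \<phi>) (w \<phi>) else 0)"

definition gauss_curvature ::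
    "('a, real^2) chart set \<Rightarrow> ('a, real^2) form \<Rightarrow> 'a \<Rightarrow> real"
  where "gauss_curvature A g p =
    (THE k. \<forall>u\<in>tangent_space A p. \<forall>v\<in>tangent_space A p.
      g p (riemann_tensor A g p u v v) u = k * (g p u u * g p v v - (g p u v)\<^sup>2))"

definition flat_on ::
    "('a, 'e::euclidean_space) chart set \<Rightarrow> 'a set \<Rightarrow> ('a, 'e) form \<Rightarrow> bool"
  where "flat_on A W g \<longleftrightarrow>
    (\<forall>p\<in>W. \<forall>u\<in>tangent_space A p. \<forall>v\<in>tangent_space A p. \<forall>w\<in>tangent_space A p.
      riemann_tensor A g p u v w = 0)"

definition locally_conformally_flat ::
    "'a topology \<Rightarrow> ('a, 'e::euclidean_space) chart set \<Rightarrow> ('a, 'e) form \<Rightarrow> bool"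
  where "locally_conformally_flat X A g \<longleftrightarrow>
    (\<forall>p\<in>topspace X. \<exists>W l. openin X W \<and> p \<in> W \<and> smooth_function A W l \<and> (\<forall>q\<in>W. l q > 0) \<and>
      flat_on A W (\<lambda>q u v. l q * g q u v))"


section \<open>Almost complex, symplectic and pseudo-Kaehler structures\<close>

definition almost_complex ::
    "'a topology \<Rightarrow> ('a, 'e::euclidean_space) chart set \<Rightarrow> ('a, 'e) endo \<Rightarrow> bool"
  where "almost_complex X A J \<longleftrightarrow>
    smooth_endo X A J \<and> (\<forall>p\<in>topspace X. \<forall>v\<in>tangent_space A p. J p (J p v) = - v)"

definition nijenhuis ::
    "('a, 'e::euclidean_space) chart set \<Rightarrow> ('a, 'e) endo \<Rightarrow>
     ('a \<Rightarrow> ('a, 'e) tvec) \<Rightarrow> ('a \<Rightarrow> ('a, 'e) tvec) \<Rightarrow> 'a \<Rightarrow> ('a, 'e) tvec"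
  where "nijenhuis A J V W p =
      lie_bracket A (\<lambda>q. J q (V q)) (\<lambda>q. J q (W q)) p
    - J p (lie_bracket A (\<lambda>q. J q (V q)) W p)
    - J p (lie_bracket A V (\<lambda>q. J q (W q)) p)
    - lie_bracket A V W p"

text \<open>Integrable in the sense of Kobayashi and Nomizu: the torsion (Nijenhuis tensor) vanishes.\<close>

definition integrable_almost_complex ::
    "'a topology \<Rightarrow> ('a, 'e::euclidean_space) chart set \<Rightarrow> ('a, 'e) endo \<Rightarrow> bool"
  where "integrable_almost_complex X A J \<longleftrightarrow>
    almost_complex X A J \<and>
    (\<forall>U V W. openin X U \<and> smooth_vector_field A U V \<and> smooth_vector_field A U W \<longrightarrow>
      (\<forall>p\<in>U. nijenhuis A J V W p = 0))"

definition exterior_deriv ::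
    "('a, 'e::euclidean_space) chart set \<Rightarrow> ('a, 'e) form \<Rightarrow>
     ('a \<Rightarrow> ('a, 'e) tvec) \<Rightarrow> ('a \<Rightarrow> ('a, 'e) tvec) \<Rightarrow> ('a \<Rightarrow> ('a, 'e) tvec) \<Rightarrow> 'a \<Rightarrow> real"
  where "exterior_deriv A \<Omega> U V W p =
      directional_deriv A p (U p) (\<lambda>q. \<Omega> q (V q) (W q))
    - directional_deriv A p (V p) (\<lambda>q. \<Omega> q (U q) (W q))
    + directional_deriv A p (W p) (\<lambda>q. \<Omega> q (U q) (V q))
    - \<Omega> p (lie_bracket A U V p) (W p)
    + \<Omega> p (lie_bracket A U W p) (V p)
    - \<Omega> p (lie_bracket A V W p) (U p)"

definition symplectic_form ::
    "'a topology \<Rightarrow> ('a, 'e::euclidean_space) chart set \<Rightarrow> ('a, 'e) form \<Rightarrow> bool"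
  where "symplectic_form X A \<Omega> \<longleftrightarrow>
    smooth_form X A \<Omega> \<and>
    (\<forall>p\<in>topspace X. (\<forall>v\<in>tangent_space A p. \<Omega> p v v = 0) \<and>
      nondegenerate_on (tangent_space A p) (\<Omega> p)) \<and>
    (\<forall>S U V W. openin X S \<and> smooth_vector_field A S U \<and> smooth_vector_field A S V \<and>
        smooth_vector_field A S W \<longrightarrow> (\<forall>p\<in>S. exterior_deriv A \<Omega> U V W p = 0))"

definition pseudo_kahler ::
    "'a topology \<Rightarrow> ('a, 'e::euclidean_space) chart set \<Rightarrow>
     ('a, 'e) form \<Rightarrow> ('a, 'e) endo \<Rightarrow> ('a, 'e) form \<Rightarrow> bool"
  where "pseudo_kahler X A G J \<Omega> \<longleftrightarrow>
    smooth_manifold X A \<and> pseudo_riemannian_metric X A G \<and>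
    integrable_almost_complex X A J \<and> symplectic_form X A \<Omega> \<and>
    (\<forall>p\<in>topspace X. \<forall>v\<in>tangent_space A p. \<forall>w\<in>tangent_space A p.
      \<Omega> p (J p v) (J p w) = \<Omega> p v w \<and> \<Omega> p v w = G p (J p v) w)"


section \<open>Oriented surfaces\<close>

text \<open>An orientation is given by an atlas whose transition maps have positive Jacobian.\<close>

definition oriented_atlas :: "('a, real^2) chart set \<Rightarrow> bool"
  where "oriented_atlas A \<longleftrightarrow>
    (\<forall>\<phi>\<in>A. \<forall>\<psi>\<in>A. \<forall>p\<in>fst \<phi> \<inter> fst \<psi>. det (matrix (transition_deriv p \<phi> \<psi>)) > 0)"

definition positively_oriented ::
    "('a, real^2) chart set \<Rightarrow> 'a \<Rightarrow> ('a, real^2) tvec \<Rightarrow> ('a, real^2) tvec \<Rightarrow> bool"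
  where "positively_oriented A p v w \<longleftrightarrow>
    (\<forall>\<phi>\<in>charts_at A p. det (vector [v \<phi>, w \<phi>] :: real^2^2) > 0)"

text \<open>Rotation by \<open>+\<pi>/2\<close>.\<close>

definition rotation :: "('a, real^2) chart set \<Rightarrow> ('a, real^2) form \<Rightarrow> ('a, real^2) endo"
  where "rotation A g p v =
    (THE w. w \<in> tangent_space A p \<and> g p v w = 0 \<and> g p w w = g p v v \<and>
      (v \<noteq> 0 \<longrightarrow> positively_oriented A p v w))"

definition area_form :: "('a, real^2) chart set \<Rightarrow> ('a, real^2) form \<Rightarrow> ('a, real^2) form"
  where "area_form A g p v w = g p (rotation A g p v) w"


section \<open>Products\<close>

definition prod_atlas ::
    "('a, 'e) chart set \<Rightarrow> ('b, 'f) chart set \<Rightarrow> ('a \<times> 'b, 'e \<times> 'f) chart set"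
  where "prod_atlas A B =
    {(fst \<phi> \<times> fst \<psi>, map_prod (snd \<phi>) (snd \<psi>)) | \<phi> \<psi>. \<phi> \<in> A \<and> \<psi> \<in> B}"

definition pullback_form ::
    "('a, 'e::euclidean_space) chart set \<Rightarrow> ('b, 'f::euclidean_space) chart set \<Rightarrow>
     ('a \<Rightarrow> 'b) \<Rightarrow> ('b, 'f) form \<Rightarrow> ('a, 'e) form"
  where "pullback_form A B f b p v w = b (f p) (tangent_map A B f p v) (tangent_map A B f p w)"

definition prod_form ::
    "('a, 'e::euclidean_space) chart set \<Rightarrow> ('b, 'f::euclidean_space) chart set \<Rightarrow>
     real \<Rightarrow> ('a, 'e) form \<Rightarrow> ('b, 'f) form \<Rightarrow> ('a \<times> 'b, 'e \<times> 'f) form"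
  where "prod_form A B \<epsilon> b c p v w =
    pullback_form (prod_atlas A B) A fst b p v w + \<epsilon> * pullback_form (prod_atlas A B) B snd c p v w"

text \<open>The splitting of the tangent space of the product is \<open>v \<mapsto> (d\<pi>\<^sub>1 v, d\<pi>\<^sub>2 v)\<close>.\<close>

definition prod_endo ::
    "('a, 'e::euclidean_space) chart set \<Rightarrow> ('b, 'f::euclidean_space) chart set \<Rightarrow>
     ('a, 'e) endo \<Rightarrow> ('b, 'f) endo \<Rightarrow> ('a \<times> 'b, 'e \<times> 'f) endo"
  where "prod_endo A B j k p v =
    (THE w. w \<in> tangent_space (prod_atlas A B) p \<and>
      tangent_map (prod_atlas A B) A fst p w = j (fst p) (tangent_map (prod_atlas A B) A fst p v) \<and>
      tangent_map (prod_atlas A B) B snd p w = k (snd p) (tangent_map (prod_atlas A B) B snd p v))"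

end

theory Submission
  imports Defs
begin

text \<open>
  In a product chart the Levi-Civita connection and the curvature of \<open>G\<close> split, and every tensorial
  statement reduces to one on the two coordinate planes. There alternating forms of degree two are
  multiples of the determinant: this gives the existence of the Gauss curvature, the vanishing of the
  Nijenhuis tensor of the rotation, and the closedness of the area form.

  Writing a conformal factor as \<open>\<phi>\<^sup>-\<^sup>2\<close>, the curvature of \<open>\<phi>\<^sup>-\<^sup>2 G\<close> is affine in the Hessian of \<open>\<phi>\<close>.
  If it vanishes, then the sectional curvatures of \<open>G\<close> in an orthogonal frame satisfy
  \<open>K\<^sub>1\<^sub>2 + K\<^sub>3\<^sub>4 = K\<^sub>1\<^sub>3 + K\<^sub>2\<^sub>4\<close>; the mixed ones are zero, so \<open>\<kappa>\<^sub>1(p) + \<epsilon> \<kappa>\<^sub>2(q) = 0\<close> for all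
  \<open>p\<close> and \<open>q\<close>, and both curvatures are constant. Conversely, on a surface of constant curvature
  \<open>\<kappa>\<close> the system \<open>Hess f = - \<kappa> f g\<close> is completely integrable. With the solutions having value \<open>1\<close> and
  gradient \<open>0\<close> at a point of either factor, \<open>\<phi> = f\<^sub>1 + f\<^sub>2\<close> makes \<open>\<phi>\<^sup>-\<^sup>2 G\<close> flat.
\<close>

section \<open>Calculus of smooth maps\<close>

text \<open>All local geometry takes place on an open subset of the model space
  (\<open>local_metric\<close>); the atlas only moves statements between charts. Christoffel maps
  and gradients are known only as solutions of linear systems given by the metric, so their
  smoothness is derived from the system itself.

  The weight \<phi> to the power -2 makes the difference of the two Levi-Civita connections equal to
  1/\<phi> times an expression algebraic in the gradient. In the sectional curvature of the plane of
  two orthogonal vectors the Hessian enters through one diagonal entry for each of them; each frame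
  vector occurs once on either side of the four-term identity, so the unknown factor drops out.

  In the converse, |grad f|^2 + \<kappa> f^2 is constant for a solution, and the initial value (1,
  0) makes it equal to \<kappa>. With \<kappa>1 = - \<epsilon> \<kappa>2 the squared gradient of
  \<phi> becomes \<kappa>1 (f2^2 - f1^2), a multiple of \<phi> = f1 + f2; this divisibility makes
  the curvature cancel.\<close>

lemma linear_basis_expansion:
  fixes L :: "'a::euclidean_space \<Rightarrow> 'b::real_vector"
  assumes "linear L"
  shows "L u = (\<Sum>i\<in>Basis. (u \<bullet> i) *\<^sub>R L i)"
proof -
  have "L u = L (\<Sum>i\<in>Basis. (u \<bullet> i) *\<^sub>R i)"
    by (simp add: euclidean_representation)
  also have "\<dots> = (\<Sum>i\<in>Basis. (u \<bullet> i) *\<^sub>R L i)"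
    by (simp add: linear_sum[OF assms] linear_cmul[OF assms])
  finally show ?thesis .
qed

lemma differentiable_cong_open:
  assumes "open S" "x \<in> S" "\<And>y. y \<in> S \<Longrightarrow> f y = g y"
  shows "f differentiable (at x) \<longleftrightarrow> g differentiable (at x)"
  unfolding differentiable_def
  by (metis assms has_derivative_transform_within_open)

lemma frechet_derivative_cong_open:
  assumes "open S" "x \<in> S" "\<And>y. y \<in> S \<Longrightarrow> f y = g y"
  shows "frechet_derivative f (at x) = frechet_derivative g (at x)"
proof -
  have "(f has_derivative D) (at x) = (g has_derivative D) (at x)" for D
    by (metis assms has_derivative_transform_within_open)
  then show ?thesis
    by (simp add: frechet_derivative_def)
qed

lemma Ck_on_cong:
  assumes "open S" "\<And>y. y \<in> S \<Longrightarrow> f y = g y"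
  shows "Ck_on k S f \<longleftrightarrow> Ck_on k S g"
  using assms(2)
proof (induction k arbitrary: f g)
  case 0
  then show ?case by (simp cong: continuous_on_cong)
next
  case (Suc k)
  have *: "frechet_derivative f (at x) = frechet_derivative g (at x)" if "x \<in> S" for x
    using frechet_derivative_cong_open[OF assms(1) that Suc.prems] .
  then have "Ck_on k S (\<lambda>x. frechet_derivative f (at x) v) \<longleftrightarrow>
     Ck_on k S (\<lambda>x. frechet_derivative g (at x) v)" for v
    by (intro Suc.IH) auto
  moreover have "\<And>x. x \<in> S \<Longrightarrow> f differentiable (at x) \<longleftrightarrow> g differentiable (at x)"
    using differentiable_cong_open[OF assms(1) _ Suc.prems] .
  ultimately show ?case by simp
qed

lemma smooth_on_cong:
  assumes "open S" "\<And>y. y \<in> S \<Longrightarrow> f y = g y"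
  shows "smooth_on S f \<longleftrightarrow> smooth_on S g"
  using Ck_on_cong[OF assms] by (simp add: smooth_on_def)

lemma Ck_on_subset: "Ck_on k S f \<Longrightarrow> T \<subseteq> S \<Longrightarrow> Ck_on k T f"
  by (induction k arbitrary: f) (auto intro: continuous_on_subset)

lemma smooth_on_subset: "smooth_on S f \<Longrightarrow> T \<subseteq> S \<Longrightarrow> smooth_on T f"
  by (auto simp: smooth_on_def intro: Ck_on_subset)

lemma Ck_on_Suc_D: "Ck_on (Suc k) S f \<Longrightarrow> Ck_on k S f"
proof (induction k arbitrary: f)
  case 0
  then show ?case
    by (auto intro!: continuous_at_imp_continuous_on differentiable_imp_continuous_within)
next
  case (Suc k)
  then have "\<forall>x\<in>S. f differentiable (at x)" "\<And>v. Ck_on (Suc k) S (\<lambda>x. frechet_derivative f (at x) v)"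
    by (simp_all del: Ck_on.simps(2) add: Ck_on.simps(2)[of "Suc k" S f])
  then show ?case using Suc.IH by simp
qed

lemma smooth_on_imp_continuous_on: "smooth_on S f \<Longrightarrow> continuous_on S f"
  unfolding smooth_on_def by (metis Ck_on.simps(1))

lemma smooth_on_imp_differentiable: "smooth_on S f \<Longrightarrow> x \<in> S \<Longrightarrow> f differentiable (at x)"
  unfolding smooth_on_def by (metis Ck_on.simps(2))

lemma smooth_on_has_derivative:
  "smooth_on S f \<Longrightarrow> x \<in> S \<Longrightarrow> (f has_derivative frechet_derivative f (at x)) (at x)"
  using smooth_on_imp_differentiable frechet_derivative_works by blast

lemma smooth_on_derivative: "smooth_on S f \<Longrightarrow> smooth_on S (\<lambda>x. frechet_derivative f (at x) v)"
  unfolding smooth_on_def by (metis Ck_on.simps(2))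

lemma frechet_derivative_eqI: "(f has_derivative D) (at x) \<Longrightarrow> frechet_derivative f (at x) = D"
  using frechet_derivative_at by metis

text \<open>Lets an explicit family of derivatives replace \<open>frechet_derivative\<close> in the
  recursion; openness of \<open>S\<close> makes the exchange legitimate at all lower orders.\<close>

lemma Ck_on_SucI:
  assumes "open S" "\<And>x. x \<in> S \<Longrightarrow> (f has_derivative D x) (at x)" "\<And>v. Ck_on k S (\<lambda>x. D x v)"
  shows "Ck_on (Suc k) S f"
proof -
  have "Ck_on k S (\<lambda>x. frechet_derivative f (at x) v)" for v
    using assms(3)[of v] Ck_on_cong[OF assms(1), of "\<lambda>x. frechet_derivative f (at x) v" "\<lambda>x. D x v" k]
    by (simp add: frechet_derivative_eqI[OF assms(2)])
  then show ?thesis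
    using assms(2) by (auto simp: differentiable_def)
qed

lemma Ck_on_Suc_has_derivative:
  "Ck_on (Suc k) S f \<Longrightarrow> x \<in> S \<Longrightarrow> (f has_derivative frechet_derivative f (at x)) (at x)"
  using frechet_derivative_works by (auto simp del: frechet_derivative_works)

lemma Ck_on_Suc_derivative: "Ck_on (Suc k) S f \<Longrightarrow> Ck_on k S (\<lambda>x. frechet_derivative f (at x) v)"
  by simp

lemma Ck_on_const: "open S \<Longrightarrow> Ck_on k S (\<lambda>x. c)"
proof (induction k arbitrary: c)
  case (Suc k)
  then show ?case
    by (intro Ck_on_SucI[where D="\<lambda>x v. 0"]) auto
qed simp

lemma smooth_on_const: "open S \<Longrightarrow> smooth_on S (\<lambda>x. c)"
  by (simp add: smooth_on_def Ck_on_const)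

lemma smooth_on_bounded_linear:
  assumes "open S" "bounded_linear L"
  shows "smooth_on S L"
  unfolding smooth_on_def
proof
  fix k show "Ck_on k S L"
  proof (cases k)
    case 0
    then show ?thesis using assms(2) by (simp add: linear_continuous_on)
  next
    case (Suc m)
    then show ?thesis
      using Ck_on_SucI[OF assms(1), of L "\<lambda>x. L"] bounded_linear_imp_has_derivative[OF assms(2)]
        Ck_on_const[OF assms(1)]
      by auto
  qed
qed

lemma Ck_on_add:
  assumes "open S" "Ck_on k S f" "Ck_on k S g"
  shows "Ck_on k S (\<lambda>x. f x + g x)"
  using assms(2,3)
proof (induction k arbitrary: f g)
  case 0
  then show ?case by (auto intro: continuous_intros)
next
  case (Suc k)
  show ?case
    by (rule Ck_on_SucI[OF assms(1) has_derivative_add])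
       (use Suc Ck_on_Suc_has_derivative in \<open>blast intro: Ck_on_Suc_derivative\<close>)+
qed

lemma Ck_on_compose_bounded_linear:
  assumes "open S" "Ck_on k S f" "bounded_linear L"
  shows "Ck_on k S (\<lambda>x. L (f x))"
  using assms(2)
proof (induction k arbitrary: f)
  case 0
  then show ?case using assms(3) by (auto intro: bounded_linear.continuous_on)
next
  case (Suc k)
  show ?case
    by (rule Ck_on_SucI[OF assms(1) bounded_linear.has_derivative[OF assms(3)]])
       (use Suc Ck_on_Suc_has_derivative in \<open>blast intro: Ck_on_Suc_derivative\<close>)+
qed

text \<open>By the product rule the derivative is a sum of terms with one factor differentiated; the
  other factor is demoted by one order, and the induction applies to both terms.\<close>

lemma Ck_on_bounded_bilinear:
  assumes "open S" "bounded_bilinear B" "Ck_on k S f" "Ck_on k S g"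
  shows "Ck_on k S (\<lambda>x. B (f x) (g x))"
  using assms(3,4)
proof (induction k arbitrary: f g)
  case 0
  then show ?case using assms(2) by (auto intro: bounded_bilinear.continuous_on)
next
  case (Suc k)
  show ?case
  proof (rule Ck_on_SucI[OF assms(1) bounded_bilinear.FDERIV[OF assms(2) Ck_on_Suc_has_derivative[OF Suc.prems(1)] Ck_on_Suc_has_derivative[OF Suc.prems(2)]]])
    fix v show "Ck_on k S (\<lambda>x. B (f x) (frechet_derivative g (at x) v) + B (frechet_derivative f (at x) v) (g x))"
      by (intro Ck_on_add assms(1) Suc.IH Ck_on_Suc_D[OF Suc.prems(1)] Ck_on_Suc_D[OF Suc.prems(2)]
          Ck_on_Suc_derivative[OF Suc.prems(1)] Ck_on_Suc_derivative[OF Suc.prems(2)])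
  qed
qed

lemma Ck_on_sum:
  assumes "open S" "finite I" "\<And>i. i \<in> I \<Longrightarrow> Ck_on k S (f i)"
  shows "Ck_on k S (\<lambda>x. \<Sum>i\<in>I. f i x)"
  using assms(2,3)
  by (induction I rule: finite_induct) (auto intro: Ck_on_add[OF assms(1)] Ck_on_const[OF assms(1)])

text \<open>The derivative of \<open>g\<close> at \<open>f x\<close> is a linear map that varies
  with \<open>x\<close>. Expanding its argument in the basis turns the chain rule into a finite sum
  of products, each factor of which is covered by the induction or by a linear projection.\<close>

lemma Ck_on_compose:
  fixes f :: "'a::euclidean_space \<Rightarrow> 'b::euclidean_space" and g :: "'b \<Rightarrow> 'c::real_normed_vector"
  assumes "open S" "open T" "f ` S \<subseteq> T" "Ck_on k S f" "Ck_on k T g"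
  shows "Ck_on k S (\<lambda>x. g (f x))"
  using assms(4,5)
proof (induction k arbitrary: g)
  case 0
  then show ?case using assms(3) by (auto intro: continuous_on_compose2)
next
  case (Suc k)
  have L: "linear (frechet_derivative g (at (f x)))" if "x \<in> S" for x
    using Ck_on_Suc_has_derivative[OF Suc.prems(2), of "f x"] assms(3) that
    by (auto simp: has_derivative_def bounded_linear.linear)
  show ?case
  proof (rule Ck_on_SucI[OF assms(1)])
    fix x assume x: "x \<in> S"
    have "(g has_derivative frechet_derivative g (at (f x))) (at (f x))"
      using assms(3) x Ck_on_Suc_has_derivative[OF Suc.prems(2)] by blast
    from has_derivative_compose[OF Ck_on_Suc_has_derivative[OF Suc.prems(1) x] this]
    have "((\<lambda>x. g (f x)) has_derivative
      (\<lambda>v. frechet_derivative g (at (f x)) (frechet_derivative f (at x) v))) (at x)" .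
    then show "((\<lambda>x. g (f x)) has_derivative
      (\<lambda>v. (\<Sum>i\<in>Basis. (frechet_derivative f (at x) v \<bullet> i) *\<^sub>R frechet_derivative g (at (f x)) i))) (at x)"
      by (rule has_derivative_eq_rhs) (rule ext, rule linear_basis_expansion[OF L[OF x]])
  next
    fix v
    show "Ck_on k S (\<lambda>x. \<Sum>i\<in>Basis. (frechet_derivative f (at x) v \<bullet> i) *\<^sub>R frechet_derivative g (at (f x)) i)"
    proof (rule Ck_on_sum[OF assms(1) finite_Basis])
      fix i :: 'b
      have "Ck_on k S (\<lambda>x. frechet_derivative g (at (f x)) i)"
        by (rule Suc.IH[OF Ck_on_Suc_D[OF Suc.prems(1)] Ck_on_Suc_derivative[OF Suc.prems(2)]])
      moreover have "Ck_on k S (\<lambda>x. frechet_derivative f (at x) v \<bullet> i)"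
        by (rule Ck_on_compose_bounded_linear[OF assms(1) Ck_on_Suc_derivative[OF Suc.prems(1)] bounded_linear_inner_left])
      ultimately show "Ck_on k S (\<lambda>x. (frechet_derivative f (at x) v \<bullet> i) *\<^sub>R frechet_derivative g (at (f x)) i)"
        by (intro Ck_on_bounded_bilinear[OF assms(1) bounded_bilinear_scaleR])
    qed
  qed
qed

lemma smooth_on_add: "open S \<Longrightarrow> smooth_on S f \<Longrightarrow> smooth_on S g \<Longrightarrow> smooth_on S (\<lambda>x. f x + g x)"
  by (simp add: smooth_on_def Ck_on_add)

lemma smooth_on_compose_bounded_linear:
  "open S \<Longrightarrow> smooth_on S f \<Longrightarrow> bounded_linear L \<Longrightarrow> smooth_on S (\<lambda>x. L (f x))"
  by (simp add: smooth_on_def Ck_on_compose_bounded_linear)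

lemma smooth_on_bounded_bilinear:
  "open S \<Longrightarrow> bounded_bilinear B \<Longrightarrow> smooth_on S f \<Longrightarrow> smooth_on S g \<Longrightarrow> smooth_on S (\<lambda>x. B (f x) (g x))"
  by (simp add: smooth_on_def Ck_on_bounded_bilinear)

lemmas smooth_on_scaleR = smooth_on_bounded_bilinear[OF _ bounded_bilinear_scaleR]
lemmas smooth_on_mult = smooth_on_bounded_bilinear[OF _ bounded_bilinear_mult]
lemmas smooth_on_minus = smooth_on_compose_bounded_linear[OF _ _ bounded_linear_minus[OF bounded_linear_ident]]
lemmas smooth_on_inner_left = smooth_on_compose_bounded_linear[OF _ _ bounded_linear_inner_left]
lemmas smooth_on_fst = smooth_on_compose_bounded_linear[OF _ _ bounded_linear_fst]
lemmas smooth_on_snd = smooth_on_compose_bounded_linear[OF _ _ bounded_linear_snd]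

lemma smooth_on_diff: "open S \<Longrightarrow> smooth_on S f \<Longrightarrow> smooth_on S g \<Longrightarrow> smooth_on S (\<lambda>x. f x - g x)"
  using smooth_on_add[of S f "\<lambda>x. - g x"] by (simp add: smooth_on_minus)

lemma smooth_on_sum:
  "open S \<Longrightarrow> finite I \<Longrightarrow> (\<And>i. i \<in> I \<Longrightarrow> smooth_on S (f i)) \<Longrightarrow> smooth_on S (\<lambda>x. \<Sum>i\<in>I. f i x)"
  by (simp add: smooth_on_def Ck_on_sum)

lemma smooth_on_compose:
  fixes f :: "'a::euclidean_space \<Rightarrow> 'b::euclidean_space" and g :: "'b \<Rightarrow> 'c::real_normed_vector"
  assumes "open S" "open T" "f ` S \<subseteq> T" "smooth_on S f" "smooth_on T g"
  shows "smooth_on S (\<lambda>x. g (f x))"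
  using assms by (simp add: smooth_on_def Ck_on_compose)

lemma smooth_on_Pair:
  fixes f :: "'a::euclidean_space \<Rightarrow> 'b::real_normed_vector" and g :: "'a \<Rightarrow> 'c::real_normed_vector"
  assumes "open S" "smooth_on S f" "smooth_on S g"
  shows "smooth_on S (\<lambda>x. (f x, g x))"
proof -
  have l1: "bounded_linear (\<lambda>a::'b. (a, 0::'c))"
    by (rule bounded_linear_Pair[OF bounded_linear_ident bounded_linear_zero])
  have l2: "bounded_linear (\<lambda>b::'c. (0::'b, b))"
    by (rule bounded_linear_Pair[OF bounded_linear_zero bounded_linear_ident])
  have "smooth_on S (\<lambda>x. (f x, 0) + (0, g x))"
    by (intro smooth_on_add assms(1) smooth_on_compose_bounded_linear[OF _ _ l1]
        smooth_on_compose_bounded_linear[OF _ _ l2] assms)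
  then show ?thesis by simp
qed

text \<open>The derivative is a polynomial in the function itself, so the induction on the order
  closes.\<close>

lemma smooth_on_inverse_real: "smooth_on {0<..} (inverse :: real \<Rightarrow> real)"
  unfolding smooth_on_def
proof
  fix k show "Ck_on k {0<..} (inverse :: real \<Rightarrow> real)"
  proof (induction k)
    case 0
    then show ?case by (auto intro!: continuous_intros)
  next
    case (Suc k)
    show ?case
    proof (rule Ck_on_SucI[where D="\<lambda>x v. - (inverse x * v * inverse x)"])
      fix v :: real
      have "Ck_on k {0<..} (\<lambda>x. inverse x * (inverse x * (- v)) :: real)"
        by (intro Ck_on_bounded_bilinear[OF _ bounded_bilinear_mult] Suc Ck_on_const) auto
      then show "Ck_on k {0<..} (\<lambda>x. - (inverse x * v * inverse x) :: real)"
        by (simp add: mult_ac)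
    qed (simp_all add: has_derivative_inverse')
  qed
qed

lemma smooth_on_sqrt_real: "smooth_on {0<..} sqrt"
  unfolding smooth_on_def
proof
  fix k show "Ck_on k {0<..} sqrt"
  proof (induction k)
    case 0
    then show ?case by (auto intro!: continuous_intros)
  next
    case (Suc k)
    show ?case
    proof (rule Ck_on_SucI[where D="\<lambda>x v. (inverse (sqrt x) / 2) *\<^sub>R v"])
      fix v :: real
      have "Ck_on k {0<..} (\<lambda>x. inverse (sqrt x))"
        by (rule Ck_on_compose[where T="{0<..}" and g=inverse])
           (use Suc smooth_on_inverse_real in \<open>auto simp: smooth_on_def\<close>)
      then have "Ck_on k {0<..} (\<lambda>x. inverse (sqrt x) * (v / 2) :: real)"
        by (intro Ck_on_bounded_bilinear[OF _ bounded_bilinear_mult] Ck_on_const) auto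
      then show "Ck_on k {0<..} (\<lambda>x. (inverse (sqrt x) / 2) *\<^sub>R v)"
        by (simp add: mult_ac)
    next
      fix x :: real assume "x \<in> {0<..}"
      then have "(sqrt has_real_derivative inverse (sqrt x) / 2) (at x)"
        using DERIV_real_sqrt by simp
      then show "(sqrt has_derivative (\<lambda>v. (inverse (sqrt x) / 2) *\<^sub>R v)) (at x)" unfolding real_scaleR_def
        by (simp only: has_field_derivative_def)
    qed auto
  qed
qed

lemma smooth_on_inverse:
  fixes f :: "'a::euclidean_space \<Rightarrow> real"
  assumes "open S" "smooth_on S f" "\<And>x. x \<in> S \<Longrightarrow> f x > 0"
  shows "smooth_on S (\<lambda>x. inverse (f x))"
  by (rule smooth_on_compose[OF assms(1) _ _ assms(2) smooth_on_inverse_real]) (use assms(3) in auto)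

lemma smooth_on_sqrt:
  fixes f :: "'a::euclidean_space \<Rightarrow> real"
  assumes "open S" "smooth_on S f" "\<And>x. x \<in> S \<Longrightarrow> f x > 0"
  shows "smooth_on S (\<lambda>x. sqrt (f x))"
  by (rule smooth_on_compose[OF assms(1) _ _ assms(2) smooth_on_sqrt_real]) (use assms(3) in auto)

text \<open>A product rule for tensor components applied to moving vectors. Differentiability is
  only asked for each fixed argument: in finite dimension the basis expansion reduces the claim to
  finitely many scalar products.\<close>

lemma has_derivative_linear_family:
  fixes L :: "'a::euclidean_space \<Rightarrow> 'b::euclidean_space \<Rightarrow> 'c::real_normed_vector"
  assumes "open S" "x \<in> S" "\<And>y. y \<in> S \<Longrightarrow> linear (L y)"
    and "\<And>u. (\<lambda>y. L y u) differentiable (at x)" "(U has_derivative U') (at x)"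
  shows "((\<lambda>y. L y (U y)) has_derivative (\<lambda>t. frechet_derivative (\<lambda>y. L y (U x)) (at x) t + L x (U' t))) (at x)"
    and "linear (\<lambda>u. frechet_derivative (\<lambda>y. L y u) (at x) t)"
proof -
  let ?D = "\<lambda>u. frechet_derivative (\<lambda>y. L y u) (at x)"
  have D: "((\<lambda>y. L y u) has_derivative ?D u) (at x)" for u
    using assms(4) frechet_derivative_works by blast
  have rep: "L y u = (\<Sum>i\<in>Basis. (u \<bullet> i) *\<^sub>R L y i)" if "y \<in> S" for y u
    by (rule linear_basis_expansion[OF assms(3)[OF that]])
  have Dlin: "?D u t = (\<Sum>i\<in>Basis. (u \<bullet> i) *\<^sub>R ?D i t)" for u t
  proof -
    have "((\<lambda>y. (\<Sum>i\<in>Basis. (u \<bullet> i) *\<^sub>R L y i)) has_derivative (\<lambda>t. \<Sum>i\<in>Basis. (u \<bullet> i) *\<^sub>R ?D i t)) (at x)"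
      by (intro has_derivative_sum has_derivative_scaleR_right D)
    then have "((\<lambda>y. L y u) has_derivative (\<lambda>t. \<Sum>i\<in>Basis. (u \<bullet> i) *\<^sub>R ?D i t)) (at x)"
      by (rule has_derivative_transform_within_open[OF _ assms(1,2)]) (simp add: rep)
    then show ?thesis by (simp add: frechet_derivative_eqI)
  qed
  then show "linear (\<lambda>u. ?D u t)"
    by (intro linearI) (simp_all add: Dlin[of "_ + _"] Dlin[of "_ *\<^sub>R _"] inner_add_left scaleR_add_left sum.distrib
        Dlin[symmetric] scaleR_scaleR[symmetric] scaleR_sum_right[symmetric] del: scaleR_scaleR)
  have "((\<lambda>y. (\<Sum>i\<in>Basis. (U y \<bullet> i) *\<^sub>R L y i)) has_derivative
     (\<lambda>t. \<Sum>i\<in>Basis. (U x \<bullet> i) *\<^sub>R ?D i t + (U' t \<bullet> i) *\<^sub>R L x i)) (at x)"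
    by (intro has_derivative_sum has_derivative_scaleR D has_derivative_inner_left assms)
  then have "((\<lambda>y. L y (U y)) has_derivative
     (\<lambda>t. \<Sum>i\<in>Basis. (U x \<bullet> i) *\<^sub>R ?D i t + (U' t \<bullet> i) *\<^sub>R L x i)) (at x)"
    by (rule has_derivative_transform_within_open[OF _ assms(1,2)]) (simp add: rep)
  moreover have "(\<lambda>t. \<Sum>i\<in>Basis. (U x \<bullet> i) *\<^sub>R ?D i t + (U' t \<bullet> i) *\<^sub>R L x i) = (\<lambda>t. ?D (U x) t + L x (U' t))"
    by (rule ext) (simp only: sum.distrib Dlin[symmetric] rep[OF assms(2), symmetric])
  ultimately show "((\<lambda>y. L y (U y)) has_derivative (\<lambda>t. ?D (U x) t + L x (U' t))) (at x)"
    by simp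
qed

lemma smooth_on_linear_family:
  fixes L :: "'a::euclidean_space \<Rightarrow> 'b::euclidean_space \<Rightarrow> 'c::real_normed_vector"
  assumes "open S" "\<And>y. y \<in> S \<Longrightarrow> linear (L y)" "\<And>u. smooth_on S (\<lambda>y. L y u)" "smooth_on S U"
  shows "smooth_on S (\<lambda>y. L y (U y))"
proof -
  have rep: "L y u = (\<Sum>i\<in>Basis. (u \<bullet> i) *\<^sub>R L y i)" if "y \<in> S" for y u
    by (rule linear_basis_expansion[OF assms(2)[OF that]])
  have "smooth_on S (\<lambda>y. \<Sum>i\<in>Basis. (U y \<bullet> i) *\<^sub>R L y i)"
    by (intro smooth_on_sum smooth_on_scaleR smooth_on_inner_left assms finite_Basis)
  then show ?thesis
    using smooth_on_cong[OF assms(1), of "\<lambda>y. L y (U y)" "\<lambda>y. \<Sum>i\<in>Basis. (U y \<bullet> i) *\<^sub>R L y i"] rep by simp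
qed

text \<open>The mixed second difference over a small parallelogram is symmetric in \<open>u\<close>
  and \<open>v\<close>. Two applications of the mean value theorem, in either order, express it by
  the two mixed derivatives at nearby points; continuity of these gives the claim in the
  limit.\<close>

lemma second_derivative_symmetric_real:
  fixes f :: "'a::euclidean_space \<Rightarrow> real"
  assumes "open S" "x \<in> S" "Ck_on 2 S f"
  shows "frechet_derivative (\<lambda>y. frechet_derivative f (at y) v) (at x) u =
    frechet_derivative (\<lambda>y. frechet_derivative f (at y) u) (at x) v"
proof -
  let ?D = "\<lambda>v y. frechet_derivative f (at y) v"
  let ?DD = "\<lambda>v u y. frechet_derivative (?D v) (at y) u"
  have f1: "(f has_derivative (\<lambda>v. ?D v y)) (at y)" if "y \<in> S" for y
    using assms(3) that by (auto simp: numeral_2_eq_2 frechet_derivative_works[symmetric])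
  have f2: "(?D v has_derivative (\<lambda>u. ?DD v u y)) (at y)" if "y \<in> S" for y v
    using assms(3) that by (auto simp: numeral_2_eq_2 frechet_derivative_works[symmetric])
  have f3: "continuous_on S (?DD v u)" for u v
    using assms(3) by (auto simp: numeral_2_eq_2)
  obtain r where r: "r > 0" "ball x r \<subseteq> S"
    using assms(1,2) openE by blast
  \<comment> \<open>Parallelograms at \<open>x\<close> with parameters below \<open>c\<close> stay
    in the ball; the summand 1 keeps the quotient meaningful when \<open>u\<close> and
    \<open>v\<close> are both zero.\<close>
  define c where "c = r / (norm u + norm v + 1)"
  have c: "c > 0" unfolding c_def using r by (auto intro!: divide_pos_pos add_nonneg_pos)
  have inS: "x + a *\<^sub>R u + b *\<^sub>R v \<in> ball x r" if "0 \<le> a" "a < c" "0 \<le> b" "b < c" for a b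
  proof -
    have "norm (a *\<^sub>R u + b *\<^sub>R v) \<le> a * norm u + b * norm v"
      using norm_triangle_ineq[of "a *\<^sub>R u" "b *\<^sub>R v"] that by simp
    also have "\<dots> \<le> c * norm u + c * norm v" using that by (intro add_mono mult_right_mono) auto
    also have "\<dots> < c * (norm u + norm v + 1)" using c by (simp add: algebra_simps)
    also have "\<dots> = r" unfolding c_def using norm_ge_zero[of u] norm_ge_zero[of v] by (smt (verit) nonzero_eq_divide_eq)
    finally show ?thesis
      by (metis add.assoc add_diff_cancel_left' dist_commute dist_norm mem_ball)
  qed
  \<comment> \<open>Stated for arbitrary \<open>u\<close> and \<open>v\<close>, with the containment
    as a premise, because it is applied once to the given pair and once to the swapped pair.\<close>
  have mvt: "\<exists>a b. 0 < a \<and> a < s \<and> 0 < b \<and> b < s \<and>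
     f (x + s *\<^sub>R u + s *\<^sub>R v) - f (x + s *\<^sub>R u) - f (x + s *\<^sub>R v) + f x = s * s * ?DD u v (x + a *\<^sub>R u + b *\<^sub>R v)"
    if s: "0 < s" "s < c" and inS: "\<And>a b. 0 \<le> a \<Longrightarrow> a < c \<Longrightarrow> 0 \<le> b \<Longrightarrow> b < c \<Longrightarrow> x + a *\<^sub>R u + b *\<^sub>R v \<in> S"
    for s and u v
  proof -
    have "\<exists>a. 0 < a \<and> a < s \<and>
      (f (x + s *\<^sub>R u + s *\<^sub>R v) - f (x + s *\<^sub>R u)) - (f (x + 0 *\<^sub>R u + s *\<^sub>R v) - f (x + 0 *\<^sub>R u)) =
      (s - 0) * (?D u (x + a *\<^sub>R u + s *\<^sub>R v) - ?D u (x + a *\<^sub>R u))"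
    proof (rule MVT2[where f="\<lambda>a. f (x + a *\<^sub>R u + s *\<^sub>R v) - f (x + a *\<^sub>R u)"])
      fix a assume a: "0 \<le> a" "a \<le> s"
      have p: "x + a *\<^sub>R u + s *\<^sub>R v \<in> S" "x + a *\<^sub>R u \<in> S"
        using inS[of a s] inS[of a 0] a s c by auto
      have l: "linear (\<lambda>v. ?D v y)" if "y \<in> S" for y
        using f1[OF that] by (simp add: has_derivative_def bounded_linear.linear)
      have 1: "((\<lambda>a. f (x + a *\<^sub>R u + s *\<^sub>R v)) has_derivative (\<lambda>t. ?D (t *\<^sub>R u) (x + a *\<^sub>R u + s *\<^sub>R v))) (at a)"
        by (rule has_derivative_compose[where f="\<lambda>a. x + a *\<^sub>R u + s *\<^sub>R v", OF _ f1[OF p(1)]]) (auto intro!: derivative_eq_intros)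
      have 2: "((\<lambda>a. f (x + a *\<^sub>R u)) has_derivative (\<lambda>t. ?D (t *\<^sub>R u) (x + a *\<^sub>R u))) (at a)"
        by (rule has_derivative_compose[where f="\<lambda>a. x + a *\<^sub>R u", OF _ f1[OF p(2)]]) (auto intro!: derivative_eq_intros)
      have "((\<lambda>a. f (x + a *\<^sub>R u + s *\<^sub>R v) - f (x + a *\<^sub>R u)) has_derivative
        (\<lambda>t. (?D u (x + a *\<^sub>R u + s *\<^sub>R v) - ?D u (x + a *\<^sub>R u)) * t)) (at a)"
        by (rule has_derivative_eq_rhs[OF has_derivative_diff[OF 1 2]])
           (simp only: linear_cmul[OF l[OF p(1)]] linear_cmul[OF l[OF p(2)]] left_diff_distrib right_diff_distrib real_scaleR_def mult.commute)
      then show "((\<lambda>a. f (x + a *\<^sub>R u + s *\<^sub>R v) - f (x + a *\<^sub>R u)) has_real_derivative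
        ?D u (x + a *\<^sub>R u + s *\<^sub>R v) - ?D u (x + a *\<^sub>R u)) (at a)"
        by (simp add: has_field_derivative_def)
    qed (use s in auto)
    then obtain a where a: "0 < a" "a < s"
      and e1: "f (x + s *\<^sub>R u + s *\<^sub>R v) - f (x + s *\<^sub>R u) - f (x + s *\<^sub>R v) + f x =
      s * (?D u (x + a *\<^sub>R u + s *\<^sub>R v) - ?D u (x + a *\<^sub>R u))" by auto
    have "\<exists>b. 0 < b \<and> b < s \<and> ?D u (x + a *\<^sub>R u + s *\<^sub>R v) - ?D u (x + a *\<^sub>R u + 0 *\<^sub>R v) =
      (s - 0) * ?DD u v (x + a *\<^sub>R u + b *\<^sub>R v)"
    proof (rule MVT2)
      fix b assume b: "0 \<le> b" "b \<le> s"
      have p: "x + a *\<^sub>R u + b *\<^sub>R v \<in> S"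
        using inS[of a b] a b s c by auto
      have l: "linear (\<lambda>v. ?DD u v y)" if "y \<in> S" for y
        using f2[OF that] by (simp add: has_derivative_def bounded_linear.linear)
      have 1: "((\<lambda>b. ?D u (x + a *\<^sub>R u + b *\<^sub>R v)) has_derivative (\<lambda>t. ?DD u (t *\<^sub>R v) (x + a *\<^sub>R u + b *\<^sub>R v))) (at b)"
        by (rule has_derivative_compose[where f="\<lambda>b. x + a *\<^sub>R u + b *\<^sub>R v", OF _ f2[OF p]]) (auto intro!: derivative_eq_intros)
      then show "((\<lambda>b. ?D u (x + a *\<^sub>R u + b *\<^sub>R v)) has_real_derivative
        ?DD u v (x + a *\<^sub>R u + b *\<^sub>R v)) (at b)"
        unfolding has_field_derivative_def
        by (rule has_derivative_eq_rhs) (simp add: fun_eq_iff linear_cmul[OF l[OF p]])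
    qed (use s in auto)
    then show ?thesis using a e1 by auto
  qed
  have lim: "(\<lambda>n. ?DD u v (x + a n *\<^sub>R u + b n *\<^sub>R v)) \<longlonglongrightarrow> ?DD u v x"
    if "\<And>n. 0 < a n \<and> a n < c / (real n + 2)" "\<And>n. 0 < b n \<and> b n < c / (real n + 2)" for u v and a b :: "nat \<Rightarrow> real"
  proof -
    have z: "(\<lambda>n. c / (real n + 2)) \<longlonglongrightarrow> 0"
      using LIMSEQ_ignore_initial_segment[OF lim_const_over_n[of c], of 2] by (simp add: add.commute)
    have "a \<longlonglongrightarrow> 0" "b \<longlonglongrightarrow> 0"
      using that by (auto intro!: tendsto_sandwich[OF _ _ tendsto_const z] always_eventually simp: less_imp_le)
    then have "(\<lambda>n. x + a n *\<^sub>R u + b n *\<^sub>R v) \<longlonglongrightarrow> x + 0 *\<^sub>R u + 0 *\<^sub>R v"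
      by (intro tendsto_intros)
    moreover have "isCont (?DD u v) x" using f3[of u v] assms(1,2) by (simp add: continuous_on_eq_continuous_at)
    ultimately show ?thesis by (auto intro: isCont_tendsto_compose)
  qed
  \<comment> \<open>The side lengths use \<open>n + 2\<close> and not \<open>n + 1\<close>, so that
    they are strictly below \<open>c\<close> already for \<open>n = 0\<close>.\<close>
  have "\<forall>n. \<exists>a b a' b'. 0 < a \<and> a < c / (real n + 2) \<and> 0 < b \<and> b < c / (real n + 2) \<and>
    0 < a' \<and> a' < c / (real n + 2) \<and> 0 < b' \<and> b' < c / (real n + 2) \<and>
    ?DD u v (x + a *\<^sub>R u + b *\<^sub>R v) = ?DD v u (x + a' *\<^sub>R v + b' *\<^sub>R u)"
  proof
    fix n
    let ?s = "c / (real n + 2)"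
    have "c / (real n + 2) < c / 1" using c by (intro divide_strict_left_mono) auto
    then have s: "0 < ?s" "?s < c" using c by auto
    obtain a b where 1: "0 < a \<and> a < ?s \<and> 0 < b \<and> b < ?s \<and>
     f (x + ?s *\<^sub>R u + ?s *\<^sub>R v) - f (x + ?s *\<^sub>R u) - f (x + ?s *\<^sub>R v) + f x = ?s * ?s * ?DD u v (x + a *\<^sub>R u + b *\<^sub>R v)"
      using mvt[OF s, of u v] inS r by (meson subsetD)
    have "x + a *\<^sub>R v + b *\<^sub>R u \<in> S" if "0 \<le> a" "a < c" "0 \<le> b" "b < c" for a b
      using inS[of b a] that r by (auto simp: ac_simps)
    then obtain a' b' where 2: "0 < a' \<and> a' < ?s \<and> 0 < b' \<and> b' < ?s \<and>
     f (x + ?s *\<^sub>R v + ?s *\<^sub>R u) - f (x + ?s *\<^sub>R v) - f (x + ?s *\<^sub>R u) + f x = ?s * ?s * ?DD v u (x + a' *\<^sub>R v + b' *\<^sub>R u)"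
      using mvt[OF s, of v u] by meson
    have p: "x + ?s *\<^sub>R u + ?s *\<^sub>R v = x + ?s *\<^sub>R v + ?s *\<^sub>R u" by (simp add: ac_simps)
    have "?s * ?s * ?DD u v (x + a *\<^sub>R u + b *\<^sub>R v) =
      f (x + ?s *\<^sub>R u + ?s *\<^sub>R v) - f (x + ?s *\<^sub>R u) - f (x + ?s *\<^sub>R v) + f x"
      using 1 by (elim conjE) (rule sym)
    also have "\<dots> = f (x + ?s *\<^sub>R v + ?s *\<^sub>R u) - f (x + ?s *\<^sub>R v) - f (x + ?s *\<^sub>R u) + f x"
      unfolding p by (simp only: diff_right_commute)
    also have "\<dots> = ?s * ?s * ?DD v u (x + a' *\<^sub>R v + b' *\<^sub>R u)"
      using 2 by (elim conjE)
    finally have "?s * ?s * ?DD u v (x + a *\<^sub>R u + b *\<^sub>R v) = ?s * ?s * ?DD v u (x + a' *\<^sub>R v + b' *\<^sub>R u)" .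
    then have "?DD u v (x + a *\<^sub>R u + b *\<^sub>R v) = ?DD v u (x + a' *\<^sub>R v + b' *\<^sub>R u)"
      using s by simp
    then show "\<exists>a b a' b'. 0 < a \<and> a < ?s \<and> 0 < b \<and> b < ?s \<and>
    0 < a' \<and> a' < ?s \<and> 0 < b' \<and> b' < ?s \<and>
    ?DD u v (x + a *\<^sub>R u + b *\<^sub>R v) = ?DD v u (x + a' *\<^sub>R v + b' *\<^sub>R u)"
      using 1 2 by blast
  qed
  then obtain a b a' b' where ab: "\<And>n. 0 < a n \<and> a n < c / (real n + 2)" "\<And>n. 0 < b n \<and> b n < c / (real n + 2)"
    "\<And>n. 0 < a' n \<and> a' n < c / (real n + 2)" "\<And>n. 0 < b' n \<and> b' n < c / (real n + 2)"
    "\<And>n. ?DD u v (x + a n *\<^sub>R u + b n *\<^sub>R v) = ?DD v u (x + a' n *\<^sub>R v + b' n *\<^sub>R u)"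
    by metis
  show ?thesis
    using LIMSEQ_unique[OF lim[OF ab(1,2), of u v]] lim[OF ab(3,4), of v u] ab(5) by simp
qed

lemma second_derivative_symmetric:
  fixes f :: "'a::euclidean_space \<Rightarrow> 'b::euclidean_space"
  assumes "open S" "x \<in> S" "smooth_on S f"
  shows "frechet_derivative (\<lambda>y. frechet_derivative f (at y) v) (at x) u =
    frechet_derivative (\<lambda>y. frechet_derivative f (at y) u) (at x) v"
proof (rule euclidean_eqI)
  fix i :: 'b assume "i \<in> Basis"
  have s: "smooth_on S (\<lambda>y. f y \<bullet> i)"
    using smooth_on_inner_left[OF assms(1,3)] .
  have d: "frechet_derivative (\<lambda>y. g y \<bullet> i) (at y) w = frechet_derivative g (at y) w \<bullet> i"
    if "smooth_on S g" "y \<in> S" for g :: "'a \<Rightarrow> 'b" and y w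
    using frechet_derivative_eqI[OF has_derivative_inner_left[OF smooth_on_has_derivative[OF that]]] by simp
  have "frechet_derivative (\<lambda>y. frechet_derivative (\<lambda>y. f y \<bullet> i) (at y) v) (at x) u =
     frechet_derivative (\<lambda>y. frechet_derivative f (at y) v) (at x) u \<bullet> i" for u v
  proof -
    have "frechet_derivative (\<lambda>y. frechet_derivative (\<lambda>y. f y \<bullet> i) (at y) v) (at x) =
      frechet_derivative (\<lambda>y. frechet_derivative f (at y) v \<bullet> i) (at x)"
      by (rule frechet_derivative_cong_open[OF assms(1,2)]) (simp add: d[OF assms(3)])
    then show ?thesis by (simp add: d[OF smooth_on_derivative[OF assms(3)] assms(2)])
  qed
  then show "frechet_derivative (\<lambda>y. frechet_derivative f (at y) v) (at x) u \<bullet> i =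
    frechet_derivative (\<lambda>y. frechet_derivative f (at y) u) (at x) v \<bullet> i"
    using second_derivative_symmetric_real[OF assms(1,2), of "\<lambda>y. f y \<bullet> i"] s
    unfolding smooth_on_def by metis
qed

lemma Ck_on_linear_family:
  fixes L :: "'a::euclidean_space \<Rightarrow> 'b::euclidean_space \<Rightarrow> 'c::real_normed_vector"
  assumes "open S" "\<And>y. y \<in> S \<Longrightarrow> linear (L y)" "\<And>u. Ck_on k S (\<lambda>y. L y u)" "Ck_on k S U"
  shows "Ck_on k S (\<lambda>y. L y (U y))"
proof -
  have "Ck_on k S (\<lambda>y. \<Sum>i\<in>Basis. (U y \<bullet> i) *\<^sub>R L y i)"
    by (intro Ck_on_sum[OF assms(1) finite_Basis] Ck_on_bounded_bilinear[OF assms(1) bounded_bilinear_scaleR]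
        Ck_on_compose_bounded_linear[OF assms(1,4) bounded_linear_inner_left] assms(3))
  moreover have "L y (U y) = (\<Sum>i\<in>Basis. (U y \<bullet> i) *\<^sub>R L y i)" if "y \<in> S" for y
    by (rule linear_basis_expansion[OF assms(2)[OF that]])
  ultimately show ?thesis
    using Ck_on_cong[OF assms(1), of "\<lambda>y. L y (U y)" "\<lambda>y. \<Sum>i\<in>Basis. (U y \<bullet> i) *\<^sub>R L y i"] by simp
qed

text \<open>\<open>g\<close> is of the order of the distance to \<open>x\<close> and
  \<open>f\<close> tends to zero, so the product is of smaller order than the distance. Mere
  continuity of \<open>f\<close> suffices; this handles the error term of a linear system whose
  solution is so far only known to be continuous.\<close>

lemma has_derivative_scaleR_null:
  fixes g :: "'a::real_normed_vector \<Rightarrow> 'b::real_normed_vector"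
  assumes "isCont f x" "f x = (0::real)" "(g has_derivative g') (at x)" "g x = 0"
  shows "((\<lambda>y. f y *\<^sub>R g y) has_derivative (\<lambda>_. 0)) (at x)"
proof -
  obtain K where K: "\<And>v. norm (g' v) \<le> norm v * K"
    using assms(3) bounded_linear.bounded unfolding has_derivative_def by metis
  have "((\<lambda>y. norm ((g y - g x) - g' (y - x)) / norm (y - x)) \<longlongrightarrow> 0) (at x)"
    using assms(3) by (simp add: has_derivative_iff_norm)
  then have ev: "\<forall>\<^sub>F y in at x. norm ((g y - g x) - g' (y - x)) / norm (y - x) < 1"
    by (rule order_tendstoD) simp
  have "\<forall>\<^sub>F y in at x. norm (norm (f y *\<^sub>R g y) / norm (y - x)) \<le> \<bar>f y\<bar> * (1 + K)"
    using ev eventually_neq_at_within[of x x UNIV]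
  proof (eventually_elim)
    case (elim y)
    then have n: "norm (y - x) > 0" by simp
    have "norm (g y) \<le> norm (g y - g' (y - x)) + norm (g' (y - x))"
      using norm_triangle_ineq[of "g y - g' (y - x)" "g' (y - x)"] by simp
    also have "\<dots> \<le> norm (y - x) + norm (y - x) * K"
      using elim(1) n K[of "y - x"] assms(4) by (auto simp: field_simps)
    finally have "norm (g y) / norm (y - x) \<le> 1 + K"
      using n by (simp add: field_simps)
    then have "\<bar>f y\<bar> * (norm (g y) / norm (y - x)) \<le> \<bar>f y\<bar> * (1 + K)"
      by (intro mult_left_mono) auto
    then show ?case by simp
  qed
  moreover have "((\<lambda>y. \<bar>f y\<bar> * (1 + K)) \<longlongrightarrow> \<bar>f x\<bar> * (1 + K)) (at x)"
    by (intro tendsto_intros isContD assms(1))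
  ultimately have "((\<lambda>y. norm (f y *\<^sub>R g y) / norm (y - x)) \<longlongrightarrow> 0) (at x)"
    using assms(2) by (auto intro: Lim_null_comparison)
  then show ?thesis
    using assms(2,4) by (simp add: has_derivative_iff_norm)
qed

text \<open>With \<open>K\<close> a left inverse of \<open>H x\<close>, the map \<open>K\<close>
  after \<open>H y\<close> is close to the identity near \<open>x\<close>. The solution therefore
  equals \<open>K (C y)\<close> up to a small multiple of itself, which first bounds it near
  \<open>x\<close> and then shows that it is continuous.\<close>

lemma eventually_bound_linear_solve:
  fixes H :: "'a::euclidean_space \<Rightarrow> 'e::euclidean_space \<Rightarrow> 'e"
  assumes "open S" "x \<in> S" "\<And>y. y \<in> S \<Longrightarrow> linear (H y)" "inj (H x)"
    and "\<And>u. isCont (\<lambda>y. H y u) x" "isCont C x"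
    and "\<And>y. y \<in> S \<Longrightarrow> H y (z y) = C y"
  obtains K where "linear K" "\<And>u. K (H x u) = u"
    "\<And>y. y \<in> S \<Longrightarrow> z y = K (C y) - (\<Sum>b\<in>Basis. (z y \<bullet> b) *\<^sub>R (K (H y b) - b))"
    "isCont z x"
proof -
  obtain K where K: "linear K" "K \<circ> H x = id"
    using linear_injective_left_inverse[OF assms(3)[OF assms(2)] assms(4)] by blast
  then have KH: "K (H x u) = u" for u by (metis comp_apply id_apply)
  have bl: "bounded_linear K" using K(1) by (simp add: linear_conv_bounded_linear)
  have rep: "z y = K (C y) - (\<Sum>b\<in>Basis. (z y \<bullet> b) *\<^sub>R (K (H y b) - b))" if "y \<in> S" for y
  proof -
    have "linear (\<lambda>u. K (H y u) - u)"
      using linear_compose_sub[OF linear_compose[OF assms(3)[OF that] K(1)] linear_ident] by (simp add: o_def)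
    from linear_basis_expansion[OF this, of "z y"] show ?thesis using assms(7)[OF that] by (simp add: algebra_simps)
  qed
  let ?e = "\<lambda>y. \<Sum>b\<in>Basis. norm (K (H y b) - b)"
  have e0: "(\<lambda>y. norm (K (H y b) - b)) \<midarrow>x\<rightarrow> 0" for b
  proof -
    have "isCont (\<lambda>y. norm (K (H y b) - b)) x"
      by (intro continuous_intros bounded_linear.isCont[OF bl] assms(5))
    then show ?thesis using KH by (simp add: isCont_def)
  qed
  then have "?e \<midarrow>x\<rightarrow> 0" by (rule tendsto_null_sum)
  then have ev1: "\<forall>\<^sub>F y in at x. ?e y < 1/2" by (rule order_tendstoD) simp
  have KC: "(\<lambda>y. K (C y)) \<midarrow>x\<rightarrow> K (C x)"
    using bounded_linear.isCont[OF bl assms(6)] by (simp add: isCont_def)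
  then have "(\<lambda>y. norm (K (C y))) \<midarrow>x\<rightarrow> norm (K (C x))" by (rule tendsto_norm)
  then have ev2: "\<forall>\<^sub>F y in at x. norm (K (C y)) < norm (K (C x)) + 1" by (rule order_tendstoD) simp
  \<comment> \<open>From \<open>n <= k + n / 2\<close> one gets \<open>n <= 2 * k\<close>, with
    \<open>k\<close> bounded by \<open>norm (K (C x)) + 1\<close>.\<close>
  define B where "B = 2 * (norm (K (C x)) + 1)"
  have evS: "\<forall>\<^sub>F y in at x. y \<in> S" using assms(1,2) by (rule eventually_at_in_open')
  have ev: "\<forall>\<^sub>F y in at x. norm (z y) \<le> B"
    using ev1 ev2 evS
  proof eventually_elim
    case (elim y)
    have "norm (\<Sum>b\<in>Basis. (z y \<bullet> b) *\<^sub>R (K (H y b) - b)) \<le> (\<Sum>b\<in>Basis. norm (z y) * norm (K (H y b) - b))"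
      by (rule sum_norm_le) (auto intro!: mult_right_mono Basis_le_norm)
    also have "\<dots> = norm (z y) * ?e y" by (simp add: sum_distrib_left)
    also have "\<dots> \<le> norm (z y) * (1/2)" using elim(1) by (intro mult_left_mono) auto
    finally have 1: "norm (\<Sum>b\<in>Basis. (z y \<bullet> b) *\<^sub>R (K (H y b) - b)) \<le> norm (z y) / 2" by simp
    have 2: "norm (z y) \<le> norm (K (C y)) + norm (\<Sum>b\<in>Basis. (z y \<bullet> b) *\<^sub>R (K (H y b) - b))"
      using rep[OF elim(3)] norm_triangle_ineq4 by metis
    have "n \<le> B" if "s \<le> n / 2" "n \<le> k + s" "k < norm (K (C x)) + 1" for n s k :: real
      using that unfolding B_def by argo
    from this[OF 1 2 elim(2)] show ?case .
  qed
  have t: "(\<lambda>y. (z y \<bullet> b) *\<^sub>R (K (H y b) - b)) \<midarrow>x\<rightarrow> 0" if "b \<in> Basis" for b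
  proof (rule Lim_null_comparison)
    show "\<forall>\<^sub>F y in at x. norm ((z y \<bullet> b) *\<^sub>R (K (H y b) - b)) \<le> B * norm (K (H y b) - b)"
      using ev
    proof eventually_elim
      case (elim y)
      then have "\<bar>z y \<bullet> b\<bar> \<le> B" using Basis_le_norm[OF that, of "z y"] by linarith
      then show ?case by (auto intro!: mult_right_mono)
    qed
    show "(\<lambda>y. B * norm (K (H y b) - b)) \<midarrow>x\<rightarrow> 0"
      by (rule tendsto_mult_right_zero[OF e0])
  qed
  have "(\<lambda>y. K (C y) - (\<Sum>b\<in>Basis. (z y \<bullet> b) *\<^sub>R (K (H y b) - b))) \<midarrow>x\<rightarrow> K (C x) - 0"
    by (intro tendsto_diff KC tendsto_null_sum t)
  moreover have "\<forall>\<^sub>F y in at x. z y = K (C y) - (\<Sum>b\<in>Basis. (z y \<bullet> b) *\<^sub>R (K (H y b) - b))"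
    using evS by eventually_elim (rule rep)
  ultimately have "z \<midarrow>x\<rightarrow> K (C x) - 0"
    by (rule Lim_transform_eventually[OF _ eventually_mono]) simp
  moreover have "K (C x) = z x" using assms(7)[OF assms(2)] KH by metis
  ultimately have "isCont z x" by (simp add: isCont_def)
  then show ?thesis using that[OF K(1) KH _ _] rep by simp
qed

text \<open>In the representation of \<open>z\<close> by \<open>K\<close>, each coefficient is split
  into its increment and its value at \<open>x\<close>. The increment multiplies a factor that also
  vanishes at \<open>x\<close>, so \<open>has_derivative_scaleR_null\<close> applies; the rest is
  differentiable by assumption.\<close>

lemma has_derivative_linear_solve:
  fixes H :: "'a::euclidean_space \<Rightarrow> 'e::euclidean_space \<Rightarrow> 'e"
  assumes "open S" "x \<in> S" "\<And>y. y \<in> S \<Longrightarrow> linear (H y)" "inj (H x)"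
    and "\<And>u. (\<lambda>y. H y u) differentiable (at x)" "C differentiable (at x)"
    and "\<And>y. y \<in> S \<Longrightarrow> H y (z y) = C y"
  shows "z differentiable (at x)"
proof -
  obtain K where K: "linear K" "\<And>u. K (H x u) = u"
    and rep: "\<And>y. y \<in> S \<Longrightarrow> z y = K (C y) - (\<Sum>b\<in>Basis. (z y \<bullet> b) *\<^sub>R (K (H y b) - b))"
    and cont: "isCont z x"
    using eventually_bound_linear_solve[where H=H and z=z and C=C, OF assms(1-4) _ _ assms(7)]
      differentiable_imp_continuous_within[OF assms(5)] differentiable_imp_continuous_within[OF assms(6)] by blast
  have bl: "bounded_linear K" using K(1) by (simp add: linear_conv_bounded_linear)
  obtain C' H' where C': "(C has_derivative C') (at x)" and H': "\<And>u. ((\<lambda>y. H y u) has_derivative H' u) (at x)"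
    using assms(5,6) unfolding differentiable_def by metis
  have E: "((\<lambda>y. K (H y b) - b) has_derivative (\<lambda>v. K (H' b v))) (at x)" for b
    using has_derivative_diff[OF bounded_linear.has_derivative[OF bl H'] has_derivative_const[of b]] by simp
  have 1: "((\<lambda>y. ((z y - z x) \<bullet> b) *\<^sub>R (K (H y b) - b)) has_derivative (\<lambda>_. 0)) (at x)" for b
    by (rule has_derivative_scaleR_null[OF _ _ E]) (auto intro!: continuous_intros cont simp: K)
  have 2: "((\<lambda>y. (z x \<bullet> b) *\<^sub>R (K (H y b) - b)) has_derivative (\<lambda>v. (z x \<bullet> b) *\<^sub>R K (H' b v))) (at x)" for b
    by (intro has_derivative_scaleR_right E)
  have "((\<lambda>y. K (C y) - (\<Sum>b\<in>Basis. ((z y - z x) \<bullet> b) *\<^sub>R (K (H y b) - b) + (z x \<bullet> b) *\<^sub>R (K (H y b) - b)))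
    has_derivative (\<lambda>v. K (C' v) - (\<Sum>b\<in>Basis. 0 + (z x \<bullet> b) *\<^sub>R K (H' b v)))) (at x)"
    by (intro has_derivative_diff has_derivative_sum has_derivative_add 1 2 bounded_linear.has_derivative[OF bl C'])
  then have "(z has_derivative (\<lambda>v. K (C' v) - (\<Sum>b\<in>Basis. 0 + (z x \<bullet> b) *\<^sub>R K (H' b v)))) (at x)"
  proof (rule has_derivative_transform_within_open[OF _ assms(1,2)])
    fix y assume "y \<in> S"
    then show "K (C y) - (\<Sum>b\<in>Basis. ((z y - z x) \<bullet> b) *\<^sub>R (K (H y b) - b) + (z x \<bullet> b) *\<^sub>R (K (H y b) - b)) = z y"
      by (subst (3) rep) (simp_all add: inner_diff_left scaleR_diff_left)
  qed
  then show ?thesis by (auto simp: differentiable_def)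
qed

lemma linear_derivative_family:
  fixes L :: "'a::euclidean_space \<Rightarrow> 'b::euclidean_space \<Rightarrow> 'c::real_normed_vector"
  assumes "open S" "x \<in> S" "\<And>y. y \<in> S \<Longrightarrow> linear (L y)" "\<And>u. (\<lambda>y. L y u) differentiable (at x)"
  shows "linear (\<lambda>u. frechet_derivative (\<lambda>y. L y u) (at x) t)"
  by (rule has_derivative_linear_family(2)[OF assms has_derivative_const])

text \<open>Differentiating the system shows that each directional derivative of \<open>z\<close>
  solves a system with the same \<open>H\<close> and a new right-hand side, so the order can be
  raised inductively. No inverse matrix is formed; raising an index with the metric is the intended
  application.\<close>

lemma Ck_on_linear_solve:
  fixes H :: "'a::euclidean_space \<Rightarrow> 'e::euclidean_space \<Rightarrow> 'e"
  assumes "open S" "\<And>y. y \<in> S \<Longrightarrow> linear (H y)" "\<And>y. y \<in> S \<Longrightarrow> inj (H y)"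
    and "\<And>u. smooth_on S (\<lambda>y. H y u)" "Ck_on k S C"
    and "\<And>y. y \<in> S \<Longrightarrow> H y (z y) = C y"
  shows "Ck_on k S z"
  using assms(5,6)
proof (induction k arbitrary: C z)
  case 0
  have "isCont z x" if "x \<in> S" for x
  proof -
    have 1: "isCont (\<lambda>y. H y u) x" for u
      using smooth_on_imp_continuous_on[OF assms(4)] that assms(1) continuous_on_eq_continuous_at by blast
    have 2: "isCont C x" using "0.prems"(1) that assms(1) by (simp add: continuous_on_eq_continuous_at)
    show ?thesis
      by (rule eventually_bound_linear_solve[where H=H and z=z and C=C,
          OF assms(1) that assms(2) assms(3)[OF that] 1 2 "0.prems"(2)])
  qed
  then show ?case by (simp add: continuous_at_imp_continuous_on)
next
  case (Suc k)
  have Cd: "C differentiable (at x)" if "x \<in> S" for x using Suc.prems(1) that by simp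
  have Hd: "(\<lambda>y. H y u) differentiable (at x)" if "x \<in> S" for x u
    using smooth_on_imp_differentiable[OF assms(4) that] .
  have zd: "z differentiable (at x)" if "x \<in> S" for x
    by (rule has_derivative_linear_solve[OF assms(1) that assms(2) assms(3)[OF that] Hd[OF that] Cd[OF that] Suc.prems(2)])
  let ?D = "\<lambda>f x. frechet_derivative f (at x)"
  \<comment> \<open>The right-hand side of the differentiated system contains \<open>z\<close>, so
    the regularity of \<open>z\<close> at order \<open>k\<close> has to come first.\<close>
  have zk: "Ck_on k S z"
    by (rule Suc.IH[OF Ck_on_Suc_D[OF Suc.prems(1)] Suc.prems(2)])
  have "Ck_on k S (\<lambda>x. ?D z x v)" for v
  proof (rule Suc.IH)
    have "linear (\<lambda>u. ?D (\<lambda>y. H y u) x v)" if "x \<in> S" for x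
      by (rule linear_derivative_family[OF assms(1) that assms(2) Hd[OF that]])
    then have "Ck_on k S (\<lambda>x. ?D (\<lambda>y. H y (z x)) x v)"
      using smooth_on_derivative[OF assms(4), of _ v] unfolding smooth_on_def
      by (intro Ck_on_linear_family[where L="\<lambda>x u. ?D (\<lambda>y. H y u) x v", OF assms(1) _ _ zk]) blast+
    moreover have "Ck_on k S (\<lambda>x. ?D C x v)" by (rule Ck_on_Suc_derivative[OF Suc.prems(1)])
    ultimately have "Ck_on k S (\<lambda>x. ?D C x v + (- ?D (\<lambda>y. H y (z x)) x v))"
      by (intro Ck_on_add assms(1) Ck_on_compose_bounded_linear[OF _ _ bounded_linear_minus[OF bounded_linear_ident]])
    then show "Ck_on k S (\<lambda>x. ?D C x v - ?D (\<lambda>y. H y (z x)) x v)" by simp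
    fix x assume x: "x \<in> S"
    have "((\<lambda>y. H y (z y)) has_derivative (\<lambda>t. ?D (\<lambda>y. H y (z x)) x t + H x (?D z x t))) (at x)"
      using has_derivative_linear_family(1)[OF assms(1) x assms(2) Hd[OF x]] zd[OF x] frechet_derivative_works by blast
    then have "(C has_derivative (\<lambda>t. ?D (\<lambda>y. H y (z x)) x t + H x (?D z x t))) (at x)"
      by (rule has_derivative_transform_within_open[OF _ assms(1) x]) (rule Suc.prems(2))
    from frechet_derivative_eqI[OF this]
    show "H x (?D z x v) = ?D C x v - ?D (\<lambda>y. H y (z x)) x v" by simp
  qed
  then show ?case using zd by simp
qed

lemma has_derivative_bilinear_family:
  fixes B :: "'a::euclidean_space \<Rightarrow> 'b::euclidean_space \<Rightarrow> 'c::euclidean_space \<Rightarrow> 'd::real_normed_vector"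
  assumes "open S" "x \<in> S" "\<And>y v. y \<in> S \<Longrightarrow> linear (\<lambda>u. B y u v)" "\<And>y u. y \<in> S \<Longrightarrow> linear (B y u)"
    and "\<And>u v. (\<lambda>y. B y u v) differentiable (at x)"
    and "(U has_derivative U') (at x)" "(V has_derivative V') (at x)"
  shows "((\<lambda>y. B y (U y) (V y)) has_derivative (\<lambda>t. frechet_derivative (\<lambda>y. B y (U x) (V x)) (at x) t +
     B x (U' t) (V x) + B x (U x) (V' t))) (at x)"
proof -
  have 1: "((\<lambda>y. B y u (V y)) has_derivative (\<lambda>t. frechet_derivative (\<lambda>y. B y u (V x)) (at x) t + B x u (V' t))) (at x)" for u
    by (rule has_derivative_linear_family(1)[OF assms(1,2) assms(4) assms(5) assms(7)])
  have "((\<lambda>y. B y (U y) (V y)) has_derivative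
     (\<lambda>t. frechet_derivative (\<lambda>y. B y (U x) (V y)) (at x) t + B x (U' t) (V x))) (at x)"
    by (rule has_derivative_linear_family(1)[where L="\<lambda>y u. B y u (V y)", OF assms(1,2) assms(3) _ assms(6)])
       (use 1 in \<open>auto simp: differentiable_def\<close>)
  then show ?thesis
    by (simp add: frechet_derivative_eqI[OF 1] add_ac)
qed

lemma smooth_on_bilinear_family:
  fixes B :: "'a::euclidean_space \<Rightarrow> 'b::euclidean_space \<Rightarrow> 'c::euclidean_space \<Rightarrow> 'd::real_normed_vector"
  assumes "open S" "\<And>y v. y \<in> S \<Longrightarrow> linear (\<lambda>u. B y u v)" "\<And>y u. y \<in> S \<Longrightarrow> linear (B y u)"
    and "\<And>u v. smooth_on S (\<lambda>y. B y u v)"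
    and "smooth_on S U" "smooth_on S V"
  shows "smooth_on S (\<lambda>y. B y (U y) (V y))"
  by (rule smooth_on_linear_family[where L="\<lambda>y u. B y u (V y)", OF assms(1,2) _ assms(5)])
     (auto intro!: smooth_on_linear_family assms)

section \<open>Metrics in coordinates\<close>

abbreviation dd :: "('a::real_normed_vector \<Rightarrow> 'b::real_normed_vector) \<Rightarrow> 'a \<Rightarrow> 'a \<Rightarrow> 'b"
  where "dd f x \<equiv> frechet_derivative f (at x)"

text \<open>A version of \<open>christoffel\<close> that sees only the component function of the
  metric, so that the local theory can be developed without an atlas.\<close>

definition levi_civita :: "('e::euclidean_space \<Rightarrow> 'e \<Rightarrow> 'e \<Rightarrow> real) \<Rightarrow> 'e \<Rightarrow> 'e \<Rightarrow> 'e \<Rightarrow> 'e"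
  where "levi_civita h x u v = (THE z. \<forall>w. 2 * h x z w =
    dd (\<lambda>y. h y v w) x u + dd (\<lambda>y. h y u w) x v - dd (\<lambda>y. h y u v) x w)"

definition curvature :: "('e::euclidean_space \<Rightarrow> 'e \<Rightarrow> 'e \<Rightarrow> real) \<Rightarrow> 'e \<Rightarrow> 'e \<Rightarrow> 'e \<Rightarrow> 'e \<Rightarrow> 'e"
  where "curvature h x u v w =
    dd (\<lambda>y. levi_civita h y v w) x u - dd (\<lambda>y. levi_civita h y u w) x v
    + levi_civita h x u (levi_civita h x v w) - levi_civita h x v (levi_civita h x u w)"

lemma christoffel_eq: "christoffel A g \<phi> = levi_civita (coord_form A g \<phi>)"
  by (simp add: fun_eq_iff christoffel_def levi_civita_def)

lemma coord_curvature_eq: "coord_curvature A g \<phi> = curvature (coord_form A g \<phi>)"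
  by (simp add: fun_eq_iff coord_curvature_def curvature_def christoffel_eq)

lemma has_derivative_unique_dd:
  assumes "(f has_derivative f') (at x)" "open S" "x \<in> S" "\<And>y. y \<in> S \<Longrightarrow> f y = g y"
  shows "dd g x = f'"
  using frechet_derivative_eqI[OF has_derivative_transform_within_open[OF assms(1-3)]] assms(4) by blast

text \<open>Nondegeneracy takes the place of positivity, so that both signs of \<epsilon> are
  covered. Linearity in the other argument follows from symmetry.\<close>

locale local_metric =
  fixes S :: "'e::euclidean_space set" and h :: "'e \<Rightarrow> 'e \<Rightarrow> 'e \<Rightarrow> real"
  assumes open_S: "open S"
    and sym: "x \<in> S \<Longrightarrow> h x u v = h x v u"
    and lin: "x \<in> S \<Longrightarrow> linear (h x u)"
    and nondeg: "x \<in> S \<Longrightarrow> (\<And>v. h x u v = 0) \<Longrightarrow> u = 0"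
    and smooth: "smooth_on S (\<lambda>x. h x u v)"
begin

abbreviation G where "G \<equiv> levi_civita h"

lemma lin':
  assumes "x \<in> S"
  shows "linear (\<lambda>u. h x u v)"
proof -
  have "(\<lambda>u. h x u v) = h x v" using sym[OF assms] by blast
  then show ?thesis using lin[OF assms] by simp
qed

lemma h_simps:
  assumes "x \<in> S"
  shows "h x (a + b) c = h x a c + h x b c" "h x c (a + b) = h x c a + h x c b"
    "h x (a - b) c = h x a c - h x b c" "h x c (a - b) = h x c a - h x c b"
    "h x (r *\<^sub>R a) c = r * h x a c" "h x c (r *\<^sub>R a) = r * h x c a"
    "h x (- a) c = - h x a c" "h x c (- a) = - h x c a"
    "h x 0 c = 0" "h x c 0 = 0"
  using linear_add[OF lin[OF assms]] linear_add[OF lin'[OF assms]] linear_diff[OF lin[OF assms]] linear_diff[OF lin'[OF assms]]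
    linear_cmul[OF lin[OF assms]] linear_cmul[OF lin'[OF assms]] linear_neg[OF lin[OF assms]] linear_neg[OF lin'[OF assms]]
    linear_0[OF lin[OF assms]] linear_0[OF lin'[OF assms]]
  by simp_all

lemma eqI:
  assumes "x \<in> S" "\<And>w. h x u w = h x v w"
  shows "u = v"
proof -
  have "u - v = 0" by (rule nondeg[OF assms(1)]) (simp add: h_simps[OF assms(1)] assms(2))
  then show ?thesis by simp
qed

text \<open>The musical isomorphism that lowers an index, with covectors stored as vectors through
  the Euclidean basis; it has nothing to do with vanishing curvature.\<close>

definition flat where "flat x u = (\<Sum>b\<in>Basis. h x u b *\<^sub>R b)"

lemma flat_inner: "b \<in> Basis \<Longrightarrow> flat x u \<bullet> b = h x u b"
  by (simp add: flat_def inner_sum_left inner_Basis if_distrib sum.delta cong: if_cong)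

lemma linear_flat: "x \<in> S \<Longrightarrow> linear (flat x)"
  unfolding flat_def
  by (intro linear_compose_sum ballI linearI) (simp_all add: h_simps scaleR_add_left)

lemma flat_eq_iff:
  assumes "x \<in> S" "linear c"
  shows "flat x u = (\<Sum>b\<in>Basis. c b *\<^sub>R b) \<longleftrightarrow> (\<forall>w. h x u w = c w)"
proof
  assume *: "flat x u = (\<Sum>b\<in>Basis. c b *\<^sub>R b)"
  have "h x u b = c b" if "b \<in> Basis" for b
    using arg_cong[OF *, of "\<lambda>z. z \<bullet> b"] that
    by (simp add: flat_inner inner_sum_left inner_Basis if_distrib sum.delta cong: if_cong)
  then show "\<forall>w. h x u w = c w"
    using linear_basis_expansion[OF lin[OF assms(1)], of u] linear_basis_expansion[OF assms(2)]
    by (metis (no_types, lifting) sum.cong)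
qed (simp add: flat_def)

lemma inj_flat: "x \<in> S \<Longrightarrow> inj (flat x)"
  using flat_inner nondeg linear_flat eqI
  by (metis (no_types, lifting) flat_def flat_eq_iff injI lin)

lemma ex_sharp:
  assumes "x \<in> S" "linear c"
  obtains z where "\<And>w. h x z w = c w"
proof -
  have "surj (flat x)"
    by (rule linear_injective_imp_surjective[OF linear_flat inj_flat]) (use assms in auto)
  then obtain z where "flat x z = (\<Sum>b\<in>Basis. c b *\<^sub>R b)" by (metis surjD)
  then show thesis using flat_eq_iff[OF assms] that by blast
qed

text \<open>Raising an index is solving the linear system with matrix \<open>flat\<close>. Every
  implicitly given vector field, the Christoffel map and gradients included, gets its smoothness
  from here.\<close>

lemma smooth_sharp:
  assumes "\<And>w. smooth_on S (\<lambda>x. c x w)" "\<And>x w. x \<in> S \<Longrightarrow> h x (z x) w = c x w"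
  shows "smooth_on S z"
  unfolding smooth_on_def
proof
  fix k
  have C: "smooth_on S (\<lambda>x. \<Sum>b\<in>Basis. c x b *\<^sub>R b)"
    by (intro smooth_on_sum open_S finite_Basis smooth_on_scaleR assms smooth_on_const)
  show "Ck_on k S z"
  proof (rule Ck_on_linear_solve[OF open_S linear_flat inj_flat])
    show "smooth_on S (\<lambda>x. flat x u)" for u
      unfolding flat_def
      by (intro smooth_on_sum open_S finite_Basis smooth_on_scaleR smooth smooth_on_const)
    show "Ck_on k S (\<lambda>x. \<Sum>b\<in>Basis. c x b *\<^sub>R b)" using C by (simp add: smooth_on_def)
    show "flat x (z x) = (\<Sum>b\<in>Basis. c x b *\<^sub>R b)" if "x \<in> S" for x
      using assms(2)[OF that] by (simp add: flat_def)
  qed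
qed

lemma dh: "x \<in> S \<Longrightarrow> ((\<lambda>y. h y u v) has_derivative dd (\<lambda>y. h y u v) x) (at x)"
  by (rule smooth_on_has_derivative[OF smooth])

lemma dh_differentiable: "x \<in> S \<Longrightarrow> (\<lambda>y. h y u v) differentiable (at x)"
  by (rule smooth_on_imp_differentiable[OF smooth])

lemma dh_sym: "x \<in> S \<Longrightarrow> dd (\<lambda>y. h y u v) x = dd (\<lambda>y. h y v u) x"
  by (rule frechet_derivative_cong_open[OF open_S]) (auto intro: sym)

lemma linear_dh:
  assumes "x \<in> S"
  shows "linear (dd (\<lambda>y. h y u v) x)" "linear (\<lambda>u. dd (\<lambda>y. h y u v) x t)" "linear (\<lambda>v. dd (\<lambda>y. h y u v) x t)"
  using has_derivative_linear[OF dh[OF assms]]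
    linear_derivative_family[OF open_S assms lin' dh_differentiable[OF assms]]
    linear_derivative_family[OF open_S assms lin dh_differentiable[OF assms]] by auto

text \<open>The right-hand side is linear in \<open>w\<close>, hence represented by a vector, and
  nondegeneracy makes the vector unique; so the definite description in \<open>levi_civita\<close>
  denotes.\<close>

lemma koszul:
  assumes "x \<in> S"
  shows "2 * h x (G x u v) w = dd (\<lambda>y. h y v w) x u + dd (\<lambda>y. h y u w) x v - dd (\<lambda>y. h y u v) x w"
proof -
  have "linear (\<lambda>w. (dd (\<lambda>y. h y v w) x u + dd (\<lambda>y. h y u w) x v - dd (\<lambda>y. h y u v) x w) / 2)"
    using linear_compose_scale_right[OF linear_compose_sub[OF linear_compose_add[OF linear_dh(3)[OF assms, of v u]
      linear_dh(3)[OF assms, of u v]] linear_dh(1)[OF assms, of u v]], of "1/2"] by simp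
  then obtain z where *: "\<And>w. h x z w = (dd (\<lambda>y. h y v w) x u + dd (\<lambda>y. h y u w) x v - dd (\<lambda>y. h y u v) x w) / 2"
    using ex_sharp[OF assms] by blast
  have z: "\<forall>w. 2 * h x z w = dd (\<lambda>y. h y v w) x u + dd (\<lambda>y. h y u w) x v - dd (\<lambda>y. h y u v) x w" by (simp add: *)
  have "z' = z" if "\<forall>w. 2 * h x z' w = dd (\<lambda>y. h y v w) x u + dd (\<lambda>y. h y u w) x v - dd (\<lambda>y. h y u v) x w" for z'
    by (rule eqI[OF assms]) (use that z in \<open>metis mult_cancel_left zero_neq_numeral\<close>)
  then have "G x u v = z" unfolding levi_civita_def using z by (intro the_equality) blast+
  then show ?thesis using z by simp
qed

text \<open>In the sum of the Koszul identities for (t, u, v) and (t, v, u) the derivatives in the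
  directions \<open>u\<close> and \<open>v\<close> cancel.\<close>

lemma compat:
  assumes "x \<in> S"
  shows "dd (\<lambda>y. h y u v) x t = h x (G x t u) v + h x u (G x t v)"
  using koszul[OF assms, of t u v] koszul[OF assms, of t v u] sym[OF assms, of u]
    dh_sym[OF assms, of v u] dh_sym[OF assms, of v t] dh_sym[OF assms, of u t] by simp

text \<open>The Koszul formula uses nothing but symmetry and compatibility. Every connection
  computed below is found by exhibiting a candidate and checking these two properties at a single
  point.\<close>

lemma levi_civita_unique:
  assumes "x \<in> S" "\<And>u v. K u v = K v u"
    "\<And>t u v. dd (\<lambda>y. h y u v) x t = h x (K t u) v + h x u (K t v)"
  shows "G x u v = K u v"
proof (rule eqI[OF assms(1)])
  fix w
  have "2 * h x (G x u v) w = 2 * h x (K u v) w"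
    unfolding koszul[OF assms(1)] assms(3)
    using assms(2)[of u v] assms(2)[of w u] assms(2)[of w v] sym[OF assms(1)] by simp
  then show "h x (G x u v) w = h x (K u v) w" by simp
qed

lemma levi_civita_sym:
  assumes "x \<in> S"
  shows "G x u v = G x v u"
proof (rule eqI[OF assms])
  show "h x (G x u v) w = h x (G x v u) w" for w
    using koszul[OF assms, of u v w] koszul[OF assms, of v u w] dh_sym[OF assms, of u v] by simp
qed

lemma linear_levi_civita:
  assumes x: "x \<in> S"
  shows "linear (G x u)"
proof (rule linearI)
  have K: "h x (G x u v) w = (dd (\<lambda>y. h y v w) x u + dd (\<lambda>y. h y u w) x v - dd (\<lambda>y. h y u v) x w) / 2" for v w
    using koszul[OF x, of u v w] by simp
  note l = linear_dh[OF x]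
  show "G x u (a + b) = G x u a + G x u b" for a b
    by (rule eqI[OF x]) (simp add: h_simps[OF x] K linear_add[OF l(1)] linear_add[OF l(2)] linear_add[OF l(3)] algebra_simps add_divide_distrib diff_divide_distrib)
  show "G x u (r *\<^sub>R a) = r *\<^sub>R G x u a" for r a
    by (rule eqI[OF x]) (simp add: h_simps[OF x] K linear_cmul[OF l(1)] linear_cmul[OF l(2)] linear_cmul[OF l(3)] algebra_simps)
qed

lemma linear_levi_civita':
  assumes "x \<in> S"
  shows "linear (\<lambda>u. G x u v)"
proof -
  have "(\<lambda>u. G x u v) = G x v" using levi_civita_sym[OF assms] by blast
  then show ?thesis using linear_levi_civita[OF assms] by simp
qed

lemma G_simps:
  assumes "x \<in> S"
  shows "G x (a + b) c = G x a c + G x b c" "G x c (a + b) = G x c a + G x c b"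
    "G x (a - b) c = G x a c - G x b c" "G x c (a - b) = G x c a - G x c b"
    "G x (r *\<^sub>R a) c = r *\<^sub>R G x a c" "G x c (r *\<^sub>R a) = r *\<^sub>R G x c a"
    "G x (- a) c = - G x a c" "G x c (- a) = - G x c a"
    "G x 0 c = 0" "G x c 0 = 0"
  using linear_add[OF linear_levi_civita[OF assms]] linear_add[OF linear_levi_civita'[OF assms]]
    linear_diff[OF linear_levi_civita[OF assms]] linear_diff[OF linear_levi_civita'[OF assms]]
    linear_cmul[OF linear_levi_civita[OF assms]] linear_cmul[OF linear_levi_civita'[OF assms]]
    linear_neg[OF linear_levi_civita[OF assms]] linear_neg[OF linear_levi_civita'[OF assms]]
    linear_0[OF linear_levi_civita[OF assms]] linear_0[OF linear_levi_civita'[OF assms]]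
  by simp_all

lemma smooth_levi_civita: "smooth_on S (\<lambda>x. G x u v)"
proof (rule smooth_sharp)
  show "smooth_on S (\<lambda>x. (dd (\<lambda>y. h y v w) x u + dd (\<lambda>y. h y u w) x v - dd (\<lambda>y. h y u v) x w) * (1/2))" for w
    by (intro smooth_on_mult smooth_on_diff smooth_on_add smooth_on_derivative smooth open_S smooth_on_const)
  show "h x (G x u v) w = (dd (\<lambda>y. h y v w) x u + dd (\<lambda>y. h y u w) x v - dd (\<lambda>y. h y u v) x w) * (1/2)"
    if "x \<in> S" for x w using koszul[OF that, of u v w] by simp
qed

lemma dG: "x \<in> S \<Longrightarrow> ((\<lambda>y. G y u v) has_derivative dd (\<lambda>y. G y u v) x) (at x)"
  by (rule smooth_on_has_derivative[OF smooth_levi_civita])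

lemma dG_differentiable: "x \<in> S \<Longrightarrow> (\<lambda>y. G y u v) differentiable (at x)"
  by (rule smooth_on_imp_differentiable[OF smooth_levi_civita])

lemma linear_dG:
  assumes "x \<in> S"
  shows "linear (dd (\<lambda>y. G y u v) x)" "linear (\<lambda>u. dd (\<lambda>y. G y u v) x t)" "linear (\<lambda>v. dd (\<lambda>y. G y u v) x t)"
  using has_derivative_linear[OF dG[OF assms]]
    linear_derivative_family[OF open_S assms linear_levi_civita' dG_differentiable[OF assms]]
    linear_derivative_family[OF open_S assms linear_levi_civita dG_differentiable[OF assms]] by auto

text \<open>The terms \<open>U' t + G x t (U x)\<close> and \<open>V' t + G x t (V x)\<close> are
  covariant derivatives: the product rule together with \<open>compat\<close>.\<close>

lemma has_derivative_metric:
  assumes "x \<in> S" "(U has_derivative U') (at x)" "(V has_derivative V') (at x)"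
  shows "((\<lambda>y. h y (U y) (V y)) has_derivative
    (\<lambda>t. h x (U' t + G x t (U x)) (V x) + h x (U x) (V' t + G x t (V x)))) (at x)"
  by (rule has_derivative_eq_rhs[OF has_derivative_bilinear_family[OF open_S assms(1) lin' lin dh_differentiable[OF assms(1)] assms(2,3)]])
     (simp_all add: fun_eq_iff compat[OF assms(1)] h_simps[OF assms(1)])

lemma linear_curvature:
  assumes x: "x \<in> S"
  shows "linear (curvature h x u v)" "linear (\<lambda>v. curvature h x u v w)" "linear (\<lambda>u. curvature h x u v w)"
proof -
  note l = linear_dG[OF x]
  note ls = linear_add[OF l(1)] linear_add[OF l(2)] linear_add[OF l(3)]
    linear_cmul[OF l(1)] linear_cmul[OF l(2)] linear_cmul[OF l(3)] G_simps[OF x]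
  show "linear (curvature h x u v)" "linear (\<lambda>v. curvature h x u v w)" "linear (\<lambda>u. curvature h x u v w)"
    unfolding curvature_def by (intro linearI; simp add: ls algebra_simps)+
qed

text \<open>The second derivatives of \<open>h w w\<close> in the directions \<open>u\<close> and
  \<open>v\<close> commute. Written with the connection, they differ by twice the curvature term,
  since the products of two first-order terms are symmetric.\<close>

lemma curvature_skew:
  assumes x: "x \<in> S"
  shows "h x (curvature h x u v w) w = 0"
proof -
  have d1: "dd (\<lambda>z. h z w w) y a = 2 * h y (G y a w) w" if "y \<in> S" for y a
    using compat[OF that, of w w a] sym[OF that] by simp
  have d2: "dd (\<lambda>y. dd (\<lambda>z. h z w w) y a) x b =
    2 * (h x (dd (\<lambda>y. G y a w) x b + G x b (G x a w)) w + h x (G x a w) (G x b w))" for a b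
  proof -
    have "((\<lambda>y. 2 * h y (G y a w) w) has_derivative (\<lambda>t. 2 * (h x (dd (\<lambda>y. G y a w) x t + G x t (G x a w)) w + h x (G x a w) (0 + G x t w)))) (at x)"
      by (intro has_derivative_mult_right has_derivative_metric x dG has_derivative_const)
    from has_derivative_unique_dd[OF this open_S x] show ?thesis using d1 by (simp add: fun_eq_iff)
  qed
  have "dd (\<lambda>y. dd (\<lambda>z. h z w w) y v) x u = dd (\<lambda>y. dd (\<lambda>z. h z w w) y u) x v"
    by (rule second_derivative_symmetric[OF open_S x smooth])
  then show ?thesis unfolding d2 curvature_def by (simp add: h_simps[OF x] sym[OF x, of "G x u w"])
qed

end

lemma local_metric_subset:
  assumes "local_metric S h" "open T" "T \<subseteq> S"
  shows "local_metric T h"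
proof -
  interpret local_metric S h by fact
  show ?thesis
    by (rule local_metric.intro)
       (use assms(2,3) sym lin nondeg smooth_on_subset[OF smooth assms(3)] in \<open>blast+\<close>)
qed

lemma local_metric_cong:
  assumes "local_metric S h" "\<And>x u v. x \<in> S \<Longrightarrow> h x u v = h' x u v"
  shows "local_metric S h'" "x \<in> S \<Longrightarrow> levi_civita h' x = levi_civita h x"
    "x \<in> S \<Longrightarrow> curvature h' x = curvature h x"
proof -
  interpret local_metric S h by fact
  have e: "x \<in> S \<Longrightarrow> h' x = h x" for x using assms(2) by (simp add: fun_eq_iff)
  show lm: "local_metric S h'"
  proof (rule local_metric.intro)
    show "smooth_on S (\<lambda>x. h' x u v)" for u v
      using smooth smooth_on_cong[OF open_S, of "\<lambda>x. h x u v" "\<lambda>x. h' x u v"] assms(2) by blast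
    show "h' x u v = h' x v u" "linear (h' x u)" if "x \<in> S" for x u v
      using sym[OF that] lin[OF that] by (simp_all add: e[OF that])
    show "u = 0" if "x \<in> S" "\<And>v. h' x u v = 0" for x u
      using nondeg[OF that(1)] that(2) by (simp add: e[OF that(1)])
  qed (rule open_S)
  then interpret L: local_metric S h' .
  have l: "levi_civita h' x = levi_civita h x" if "x \<in> S" for x
  proof (intro ext L.levi_civita_unique[OF that levi_civita_sym[OF that]])
    fix t u v
    have "dd (\<lambda>y. h' y u v) x = dd (\<lambda>y. h y u v) x"
      by (rule frechet_derivative_cong_open[OF open_S that]) (simp add: assms(2))
    then show "dd (\<lambda>y. h' y u v) x t = h' x (G x t u) v + h' x u (G x t v)"
      using compat[OF that] e[OF that] by simp
  qed
  show "x \<in> S \<Longrightarrow> levi_civita h' x = levi_civita h x" by (rule l)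
  assume x: "x \<in> S"
  have "dd (\<lambda>y. levi_civita h' y u v) x = dd (\<lambda>y. levi_civita h y u v) x" for u v
    by (rule frechet_derivative_cong_open[OF open_S x]) (simp add: l)
  then show "curvature h' x = curvature h x"
    by (simp add: fun_eq_iff curvature_def l[OF x])
qed

text \<open>Under an isometry the connection changes by the second derivative of \<open>T\<close>.
  One more differentiation produces second and third derivatives of \<open>T\<close>; after
  antisymmetrising in \<open>u\<close> and \<open>v\<close> they cancel by symmetry. Applied to
  transition maps, this makes the curvature a tensor.\<close>

lemma curvature_transform:
  fixes T :: "'e::euclidean_space \<Rightarrow> 'e"
  assumes h: "local_metric S h" and h': "local_metric S' h'" and T: "smooth_on S T" "T ` S \<subseteq> S'"
    and iso: "\<And>y u v. y \<in> S \<Longrightarrow> h y u v = h' (T y) (dd T y u) (dd T y v)" and x: "x \<in> S"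
  shows "dd T x (curvature h x u v w) = curvature h' (T x) (dd T x u) (dd T x v) (dd T x w)"
proof -
  interpret local_metric S h by fact
  interpret M: local_metric S' h' by fact
  have Tx: "T y \<in> S'" if "y \<in> S" for y using T(2) that by auto
  have dT: "(T has_derivative dd T y) (at y)" if "y \<in> S" for y
    by (rule smooth_on_has_derivative[OF T(1) that])
  have lT: "linear (dd T y)" if "y \<in> S" for y by (rule has_derivative_linear[OF dT[OF that]])
  have dT2: "((\<lambda>y. dd T y a) has_derivative dd (\<lambda>y. dd T y a) y) (at y)" if "y \<in> S" for y a
    by (rule smooth_on_has_derivative[OF smooth_on_derivative[OF T(1)] that])
  have T2sym: "dd (\<lambda>y. dd T y a) y b = dd (\<lambda>y. dd T y b) y a" if "y \<in> S" for y a b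
    by (rule second_derivative_symmetric[OF open_S that T(1)])
  have lc: "dd T y (G y u v) = M.G (T y) (dd T y u) (dd T y v) + dd (\<lambda>y. dd T y v) y u" if y: "y \<in> S" for y u v
  proof -
    have "inj (dd T y)"
      unfolding linear_injective_0[OF lT[OF y]]
    proof (intro allI impI)
      fix a assume "dd T y a = 0"
      then show "a = 0" by (intro nondeg[OF y]) (simp add: iso[OF y] M.h_simps[OF Tx[OF y]])
    qed
    then obtain Q where Q: "\<And>w. dd T y (Q w) = w"
      using linear_injective_imp_surjective[OF lT[OF y]] surjD by metis
    \<comment> \<open>The connection of \<open>h'\<close> pulled back by \<open>T\<close>, corrected
      by the second derivative of \<open>T\<close>; \<open>Q\<close> is a right inverse of the
      differential, which is onto because an isometry is injective on tangent vectors.\<close>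
    let ?K = "\<lambda>u v. Q (M.G (T y) (dd T y u) (dd T y v) + dd (\<lambda>y. dd T y v) y u)"
    have "G y u v = ?K u v"
    proof (rule levi_civita_unique[OF y])
      show "?K u v = ?K v u" for u v
        by (simp add: M.levi_civita_sym[OF Tx[OF y], of "dd T y u"] T2sym[OF y, of u])
      fix t u v
      let ?B = "\<lambda>y. h' (T y)"
      have chain: "((\<lambda>y. ?B y a b) has_derivative (\<lambda>t. dd (\<lambda>z. h' z a b) (T y) (dd T y t))) (at y)" for a b
        using has_derivative_compose[OF dT[OF y] M.dh[OF Tx[OF y], of a b]] .
      have "((\<lambda>y. ?B y (dd T y u) (dd T y v)) has_derivative (\<lambda>t. dd (\<lambda>z. ?B z (dd T y u) (dd T y v)) y t +
          ?B y (dd (\<lambda>y. dd T y u) y t) (dd T y v) + ?B y (dd T y u) (dd (\<lambda>y. dd T y v) y t))) (at y)"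
        by (rule has_derivative_bilinear_family[OF open_S y _ _ _ dT2[OF y] dT2[OF y]])
           (use chain in \<open>auto intro!: M.lin M.lin' Tx simp: differentiable_def\<close>)
      from has_derivative_unique_dd[OF this open_S y, of "\<lambda>y. h y u v"]
      have "dd (\<lambda>y. h y u v) y t = dd (\<lambda>z. h' z (dd T y u) (dd T y v)) (T y) (dd T y t) +
          ?B y (dd (\<lambda>y. dd T y u) y t) (dd T y v) + ?B y (dd T y u) (dd (\<lambda>y. dd T y v) y t)"
        using frechet_derivative_eqI[OF chain] iso by simp
      then show "dd (\<lambda>y. h y u v) y t = h y (?K t u) v + h y u (?K t v)"
        by (simp add: iso[OF y] Q M.compat[OF Tx[OF y]] M.h_simps[OF Tx[OF y]])
    qed
    then show ?thesis by (simp add: Q)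
  qed
  let ?T2 = "\<lambda>a b. dd (\<lambda>y. dd T y b) x a"
  \<comment> \<open>The transformation law \<open>lc\<close> differentiated in the direction
    \<open>u\<close>: the product rule on the left, the chain rule on the right.\<close>
  have main: "?T2 u (G x v w) + dd T x (dd (\<lambda>y. G y v w) x u) =
     dd (\<lambda>z. M.G z (dd T x v) (dd T x w)) (T x) (dd T x u) + M.G (T x) (?T2 u v) (dd T x w) + M.G (T x) (dd T x v) (?T2 u w)
      + dd (\<lambda>y. dd (\<lambda>z. dd T z w) y v) x u" for u v w
  proof -
    have 1: "((\<lambda>y. dd T y (G y v w)) has_derivative (\<lambda>t. dd (\<lambda>y. dd T y (G x v w)) x t + dd T x (dd (\<lambda>y. G y v w) x t))) (at x)"
      by (rule has_derivative_linear_family(1)[OF open_S x lT _ dG[OF x]])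
         (use dT2[OF x] in \<open>auto simp: differentiable_def\<close>)
    have chain: "((\<lambda>y. M.G (T y) a b) has_derivative (\<lambda>t. dd (\<lambda>z. M.G z a b) (T x) (dd T x t))) (at x)" for a b
      using has_derivative_compose[OF dT[OF x] M.dG[OF Tx[OF x], of a b]] .
    have "((\<lambda>y. M.G (T y) (dd T y v) (dd T y w)) has_derivative (\<lambda>t. dd (\<lambda>z. M.G (T z) (dd T x v) (dd T x w)) x t +
          M.G (T x) (dd (\<lambda>y. dd T y v) x t) (dd T x w) + M.G (T x) (dd T x v) (dd (\<lambda>y. dd T y w) x t))) (at x)"
        by (rule has_derivative_bilinear_family[OF open_S x _ _ _ dT2[OF x] dT2[OF x]])
           (use chain in \<open>auto intro!: M.linear_levi_civita M.linear_levi_civita' Tx simp: differentiable_def\<close>)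
    moreover have "((\<lambda>y. dd (\<lambda>z. dd T z w) y v) has_derivative dd (\<lambda>y. dd (\<lambda>z. dd T z w) y v) x) (at x)"
      by (rule smooth_on_has_derivative[OF smooth_on_derivative[OF smooth_on_derivative[OF T(1)]] x])
    ultimately have 2: "((\<lambda>y. M.G (T y) (dd T y v) (dd T y w) + dd (\<lambda>z. dd T z w) y v) has_derivative
       (\<lambda>t. (dd (\<lambda>z. M.G (T z) (dd T x v) (dd T x w)) x t +
          M.G (T x) (dd (\<lambda>y. dd T y v) x t) (dd T x w) + M.G (T x) (dd T x v) (dd (\<lambda>y. dd T y w) x t)) +
          dd (\<lambda>y. dd (\<lambda>z. dd T z w) y v) x t)) (at x)"
      by (rule has_derivative_add)
    from has_derivative_unique_dd[OF 2 open_S x, of "\<lambda>y. dd T y (G y v w)"] lc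
    have "dd (\<lambda>y. dd T y (G y v w)) x u = (dd (\<lambda>z. M.G z (dd T x v) (dd T x w)) (T x) (dd T x u) +
          M.G (T x) (dd (\<lambda>y. dd T y v) x u) (dd T x w) + M.G (T x) (dd T x v) (dd (\<lambda>y. dd T y w) x u)) +
          dd (\<lambda>y. dd (\<lambda>z. dd T z w) y v) x u"
      using frechet_derivative_eqI[OF chain] by simp
    then show ?thesis using frechet_derivative_eqI[OF 1] by simp
  qed
  \<comment> \<open>The only third-order term is symmetric in \<open>u\<close> and \<open>v\<close>,
    so it disappears from the curvature.\<close>
  have T3: "dd (\<lambda>y. dd (\<lambda>z. dd T z w) y v) x u = dd (\<lambda>y. dd (\<lambda>z. dd T z w) y u) x v"
    by (rule second_derivative_symmetric[OF open_S x smooth_on_derivative[OF T(1)]])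
  have a: "dd T x (dd (\<lambda>y. G y v w) x u) = dd (\<lambda>z. M.G z (dd T x v) (dd T x w)) (T x) (dd T x u) + M.G (T x) (?T2 u v) (dd T x w) + M.G (T x) (dd T x v) (?T2 u w)
      + dd (\<lambda>y. dd (\<lambda>z. dd T z w) y v) x u - ?T2 u (G x v w)" for u v w
    using main[where u=u and v=v and w=w] by (simp add: algebra_simps)
  note l = linear_add[OF lT[OF x]] linear_diff[OF lT[OF x]]
  show "dd T x (curvature h x u v w) = curvature h' (T x) (dd T x u) (dd T x v) (dd T x w)"
    unfolding curvature_def l a lc[OF x] M.G_simps[OF Tx[OF x]] T3[of]
    by (simp add: T2sym[OF x, of u v] T3)
qed

section \<open>Gradients, Hessians and conformal change of the metric\<close>

context local_metric
begin

text \<open>\<open>dd N x u + G x u (N x)\<close> is the Hessian as an endomorphism. It is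
  self-adjoint because second derivatives commute and the connection is symmetric.\<close>

lemma gradient_derivatives:
  assumes N: "\<And>y w. y \<in> S \<Longrightarrow> h y (N y) w = dd \<phi> y w" and \<phi>: "smooth_on S \<phi>" and x: "x \<in> S"
  shows "smooth_on S N" "dd (\<lambda>y. dd \<phi> y v) x u = h x (dd N x u + G x u (N x)) v + h x (N x) (G x u v)"
    "h x (dd N x u + G x u (N x)) v = h x (dd N x v + G x v (N x)) u"
proof -
  show sN: "smooth_on S N"
    by (rule smooth_sharp[OF smooth_on_derivative[OF \<phi>] N])
  have e: "dd (\<lambda>y. dd \<phi> y v) x u = h x (dd N x u + G x u (N x)) v + h x (N x) (G x u v)" for u v
  proof -
    have "((\<lambda>y. h y (N y) v) has_derivative (\<lambda>t. h x (dd N x t + G x t (N x)) v + h x (N x) (0 + G x t v))) (at x)"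
      by (rule has_derivative_metric[OF x smooth_on_has_derivative[OF sN x] has_derivative_const])
    from has_derivative_unique_dd[OF this open_S x, of "\<lambda>y. dd \<phi> y v"] show ?thesis by (simp add: N)
  qed
  show "dd (\<lambda>y. dd \<phi> y v) x u = h x (dd N x u + G x u (N x)) v + h x (N x) (G x u v)" by (rule e)
  have "dd (\<lambda>y. dd \<phi> y v) x u = dd (\<lambda>y. dd \<phi> y u) x v"
    by (rule second_derivative_symmetric[OF open_S x \<phi>])
  then show "h x (dd N x u + G x u (N x)) v = h x (dd N x v + G x v (N x)) u"
    unfolding e levi_civita_sym[OF x, of v u] by simp
qed

lemma scaled_metric:
  assumes "smooth_on S c" "\<And>y. y \<in> S \<Longrightarrow> c y > 0"
  shows "local_metric S (\<lambda>y u v. c y * h y u v)"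
proof (rule local_metric.intro)
  show "smooth_on S (\<lambda>x. c x * h x u v)" for u v
    by (intro smooth_on_mult open_S assms smooth)
  show "u = 0" if "x \<in> S" "\<And>v. c x * h x u v = 0" for x u
    using nondeg[OF that(1)] that(2) assms(2)[OF that(1)] by auto
  show "linear (\<lambda>v. c x * h x u v)" if "x \<in> S" for x u
    using linear_compose_scale_right[OF lin[OF that]] by simp
qed (use open_S sym in auto)

lemma conformal_metric:
  assumes \<phi>: "smooth_on S \<phi>" "\<And>y. y \<in> S \<Longrightarrow> \<phi> y > 0"
  shows "local_metric S (\<lambda>y u v. (inverse (\<phi> y))\<^sup>2 * h y u v)"
proof (rule scaled_metric)
  show "smooth_on S (\<lambda>y. (inverse (\<phi> y))\<^sup>2)"
    unfolding power2_eq_square by (intro smooth_on_mult open_S smooth_on_inverse \<phi>)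
qed (use \<phi>(2) in force)

text \<open>\<open>P\<close> is the Hessian endomorphism of \<phi>. The new connection differs from
  the old one by \<psi> times a term algebraic in the gradient, so the new curvature has parts of
  order 0, 1 and 2 in \<psi>. In the second order only the squared length of the gradient
  survives.\<close>

lemma conformal_curvature:
  assumes \<phi>: "smooth_on S \<phi>" "\<And>y. y \<in> S \<Longrightarrow> \<phi> y > 0"
    and N: "\<And>y w. y \<in> S \<Longrightarrow> h y (N y) w = dd \<phi> y w" and x: "x \<in> S"
    and P: "P = (\<lambda>u. dd N x u + G x u (N x))" and \<psi>: "\<psi> = inverse (\<phi> x)"
  shows "curvature (\<lambda>y u v. (inverse (\<phi> y))\<^sup>2 * h y u v) x u v w = curvature h x u v w
    + \<psi> *\<^sub>R (h x (P v) w *\<^sub>R u - h x (P u) w *\<^sub>R v + h x v w *\<^sub>R P u - h x u w *\<^sub>R P v)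
    - (\<psi>\<^sup>2 * h x (N x) (N x)) *\<^sub>R (h x v w *\<^sub>R u - h x u w *\<^sub>R v)"
proof -
  interpret C: local_metric S "\<lambda>y u v. (inverse (\<phi> y))\<^sup>2 * h y u v"
    by (rule conformal_metric[OF \<phi>])
  let ?i = "\<lambda>y. inverse (\<phi> y)"
  \<comment> \<open>The difference tensor of the two connections, up to the factor 1/\<phi>; it is
    read off from the derivative of the conformal weight.\<close>
  define C where "C y v w = - h y (N y) v *\<^sub>R w - h y (N y) w *\<^sub>R v + h y v w *\<^sub>R N y" for y v w
  have di: "(?i has_derivative (\<lambda>t. - (?i y)\<^sup>2 * h y (N y) t)) (at y)" if "y \<in> S" for y
    by (rule has_derivative_eq_rhs[OF Deriv.has_derivative_inverse[OF _ smooth_on_has_derivative[OF \<phi>(1) that]]])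
       (use \<phi>(2)[OF that] in \<open>auto simp: N[OF that] power2_eq_square fun_eq_iff\<close>)
  have lc: "C.G y v w = G y v w + ?i y *\<^sub>R C y v w" if y: "y \<in> S" for y v w
  proof (rule C.levi_civita_unique[OF y])
    show "G y v w + ?i y *\<^sub>R C y v w = G y w v + ?i y *\<^sub>R C y w v" for v w
      by (simp add: levi_civita_sym[OF y, of v] C_def sym[OF y, of v w])
    fix t u v
    have "((\<lambda>y. (?i y * ?i y) * h y u v) has_derivative (\<lambda>t. (?i y * ?i y) * dd (\<lambda>y. h y u v) y t +
       (?i y * (- (?i y)\<^sup>2 * h y (N y) t) + (- (?i y)\<^sup>2 * h y (N y) t) * ?i y) * h y u v)) (at y)"
      by (intro has_derivative_mult di y dh)
    from frechet_derivative_eqI[OF this]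
    show "dd (\<lambda>y. (?i y)\<^sup>2 * h y u v) y t = (?i y)\<^sup>2 * h y (G y t u + ?i y *\<^sub>R C y t u) v
       + (?i y)\<^sup>2 * h y u (G y t v + ?i y *\<^sub>R C y t v)"
      unfolding C_def by (simp add: power2_eq_square compat[OF y] h_simps[OF y] sym[OF y] algebra_simps)
  qed
  have sN: "smooth_on S N" by (rule gradient_derivatives(1)[OF N \<phi>(1) x])
  note dN = smooth_on_has_derivative[OF sN x]
  have dlc: "dd (\<lambda>y. C.G y v w) x u = dd (\<lambda>y. G y v w) x u - (\<psi>\<^sup>2 * h x (N x) u) *\<^sub>R C x v w +
     \<psi> *\<^sub>R (- (h x (P u) v + h x (N x) (G x u v)) *\<^sub>R w - (h x (P u) w + h x (N x) (G x u w)) *\<^sub>R v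
      + (h x (G x u v) w + h x v (G x u w)) *\<^sub>R N x + h x v w *\<^sub>R (P u - G x u (N x)))" for u v w
  proof -
    have hN: "((\<lambda>y. h y (N y) a) has_derivative (\<lambda>t. h x (P t) a + h x (N x) (0 + G x t a))) (at x)" for a
      unfolding P by (rule has_derivative_metric[OF x dN has_derivative_const])
    have "((\<lambda>y. G y v w + ?i y *\<^sub>R C y v w) has_derivative (\<lambda>t. dd (\<lambda>y. G y v w) x t + (?i x *\<^sub>R (
       - (h x (P t) v + h x (N x) (0 + G x t v)) *\<^sub>R w - (h x (P t) w + h x (N x) (0 + G x t w)) *\<^sub>R v +
        (h x v w *\<^sub>R dd N x t + dd (\<lambda>y. h y v w) x t *\<^sub>R N x)) +
       (- (?i x)\<^sup>2 * h x (N x) t) *\<^sub>R C x v w))) (at x)"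
      unfolding C_def
      by (intro has_derivative_add has_derivative_diff has_derivative_scaleR has_derivative_minus
         has_derivative_scaleR_left hN di x dh dG dN)
    from has_derivative_unique_dd[OF this open_S x, of "\<lambda>y. C.G y v w"] lc
    have "dd (\<lambda>y. C.G y v w) x u = dd (\<lambda>y. G y v w) x u + (?i x *\<^sub>R (
       - (h x (P u) v + h x (N x) (0 + G x u v)) *\<^sub>R w - (h x (P u) w + h x (N x) (0 + G x u w)) *\<^sub>R v +
        (h x v w *\<^sub>R dd N x u + dd (\<lambda>y. h y v w) x u *\<^sub>R N x)) +
       (- (?i x)\<^sup>2 * h x (N x) u) *\<^sub>R C x v w)" by simp
    also have "dd N x u = P u - G x u (N x)" by (simp add: P)
    finally show ?thesis by (simp add: \<psi> compat[OF x] algebra_simps)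
  qed
  have Psym: "h x (P u) v = h x (P v) u" for u v
    unfolding P by (rule gradient_derivatives(3)[OF N \<phi>(1) x])
  \<comment> \<open>\<open>B\<close> and \<open>E\<close> collect the coefficients of \<psi> and
    \<psi>^2. The derivative of 1/\<phi> contributes to \<open>E\<close> and not to
    \<open>B\<close>, as it is itself of second order in \<psi>. Only their antisymmetric parts
    enter the curvature, and there all Christoffel terms of \<open>B\<close> cancel.\<close>
  define B where "B u v w = - (h x (P u) v + h x (N x) (G x u v)) *\<^sub>R w - (h x (P u) w + h x (N x) (G x u w)) *\<^sub>R v
      + (h x (G x u v) w + h x v (G x u w)) *\<^sub>R N x + h x v w *\<^sub>R (P u - G x u (N x))
      + (- h x (N x) v *\<^sub>R G x u w - h x (N x) w *\<^sub>R G x u v + h x v w *\<^sub>R G x u (N x)) + C x u (G x v w)" for u v w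
  define E where "E u v w = C x u (C x v w) - h x (N x) u *\<^sub>R C x v w" for u v w
  have first: "dd (\<lambda>y. C.G y v w) x u + C.G x u (C.G x v w) =
    dd (\<lambda>y. G y v w) x u + G x u (G x v w) + \<psi> *\<^sub>R B u v w + \<psi>\<^sup>2 *\<^sub>R E u v w" for u v w
  proof -
    have "C.G x u (C.G x v w) = G x u (G x v w)
      + \<psi> *\<^sub>R (- h x (N x) v *\<^sub>R G x u w - h x (N x) w *\<^sub>R G x u v + h x v w *\<^sub>R G x u (N x))
      + \<psi> *\<^sub>R C x u (G x v w) + \<psi>\<^sup>2 *\<^sub>R C x u (C x v w)"
      unfolding lc[OF x] \<psi>[symmetric]
      by (simp add: C_def G_simps[OF x] h_simps[OF x] power2_eq_square algebra_simps)
    then show ?thesis unfolding dlc B_def E_def by (simp add: scaleR_add_right scaleR_diff_right)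
  qed
  note hs = sym[OF x, of u "N x"] sym[OF x, of v "N x"] sym[OF x, of w "N x"]
      sym[OF x, of v u] sym[OF x, of _ "G x _ _"]
  have G_vu: "G x v u = G x u v" by (rule levi_civita_sym[OF x])
  have B_antisym: "B u v w - B v u w = h x (P v) w *\<^sub>R u - h x (P u) w *\<^sub>R v + h x v w *\<^sub>R P u - h x u w *\<^sub>R P v"
    unfolding B_def C_def G_vu Psym[of v u] hs by (simp add: algebra_simps)
  have two: "(2 * r) *\<^sub>R z = r *\<^sub>R z + r *\<^sub>R z" for r and z :: 'e
    by (simp only: mult_2 scaleR_add_left)
  have "E u v w - E v u w = (h x (N x) u * h x (N x) w - h x (N x) u * h x (N x) w) *\<^sub>R v
      - h x (N x) (N x) *\<^sub>R (h x v w *\<^sub>R u - h x u w *\<^sub>R v)"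
    unfolding E_def C_def by (simp add: h_simps[OF x] hs) (simp add: algebra_simps two)
  then have E_antisym: "E u v w - E v u w = - (h x (N x) (N x) *\<^sub>R (h x v w *\<^sub>R u - h x u w *\<^sub>R v))"
    by simp
  have "curvature (\<lambda>y u v. (inverse (\<phi> y))\<^sup>2 * h y u v) x u v w =
      (dd (\<lambda>y. C.G y v w) x u + C.G x u (C.G x v w)) - (dd (\<lambda>y. C.G y u w) x v + C.G x v (C.G x u w))"
    by (simp add: curvature_def)
  also have "\<dots> = curvature h x u v w + \<psi> *\<^sub>R (B u v w - B v u w) + \<psi>\<^sup>2 *\<^sub>R (E u v w - E v u w)"
    unfolding first by (simp add: curvature_def scaleR_diff_right)
  finally show ?thesis unfolding B_antisym E_antisym by simp
qed

end

text \<open>The connection is guessed factor by factor and confirmed by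
  \<open>levi_civita_unique\<close>. The constant \<epsilon> is absent from the connection and the
  curvature operator, since both are unchanged when a factor is rescaled by a constant.\<close>

lemma
  fixes h1 :: "'a::euclidean_space \<Rightarrow> 'a \<Rightarrow> 'a \<Rightarrow> real" and h2 :: "'b::euclidean_space \<Rightarrow> 'b \<Rightarrow> 'b \<Rightarrow> real" and \<epsilon> :: real
  assumes h1: "local_metric S h1" and h2: "local_metric T h2" and \<epsilon>: "\<epsilon> \<noteq> 0"
  defines "h \<equiv> \<lambda>z u v. h1 (fst z) (fst u) (fst v) + \<epsilon> * h2 (snd z) (snd u) (snd v)"
  shows local_metric_product: "local_metric (S \<times> T) h"
    and levi_civita_product: "z \<in> S \<times> T \<Longrightarrow> levi_civita h z u v =
      (levi_civita h1 (fst z) (fst u) (fst v), levi_civita h2 (snd z) (snd u) (snd v))"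
    and curvature_product: "z \<in> S \<times> T \<Longrightarrow> curvature h z u v w =
      (curvature h1 (fst z) (fst u) (fst v) (fst w), curvature h2 (snd z) (snd u) (snd v) (snd w))"
proof -
  interpret A: local_metric S h1 by fact
  interpret B: local_metric T h2 by fact
  have o: "open (S \<times> T)" by (intro open_Times A.open_S B.open_S)
  have sA: "smooth_on (S \<times> T) (\<lambda>z. f (fst z))" if "smooth_on S f" for f :: "'a \<Rightarrow> real"
    by (rule smooth_on_compose[OF o A.open_S _ smooth_on_bounded_linear[OF o bounded_linear_fst] that]) auto
  have sB: "smooth_on (S \<times> T) (\<lambda>z. f (snd z))" if "smooth_on T f" for f :: "'b \<Rightarrow> real"
    by (rule smooth_on_compose[OF o B.open_S _ smooth_on_bounded_linear[OF o bounded_linear_snd] that]) auto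
  show lm: "local_metric (S \<times> T) h"
  proof (rule local_metric.intro)
    show "h x u v = h x v u" if "x \<in> S \<times> T" for x u v
      using that A.sym B.sym by (auto simp: h_def)
    show "linear (h x u)" if "x \<in> S \<times> T" for x u
      using that by (intro linearI) (auto simp: h_def A.h_simps B.h_simps algebra_simps)
    show "u = 0" if x: "x \<in> S \<times> T" and z: "\<And>v. h x u v = 0" for x u
    proof -
      have "fst u = 0" using z[of "(_, 0)"] x
        by (intro A.nondeg[of "fst x"]) (auto simp: h_def B.h_simps)
      moreover have "snd u = 0" using z[of "(0, _)"] x \<epsilon>
        by (intro B.nondeg[of "snd x"]) (auto simp: h_def A.h_simps)
      ultimately show ?thesis by (simp add: prod_eq_iff)
    qed
    show "smooth_on (S \<times> T) (\<lambda>x. h x u v)" for u v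
      unfolding h_def
      by (intro smooth_on_add smooth_on_mult smooth_on_const o sA[of "\<lambda>x. h1 x _ _"] sB[of "\<lambda>x. h2 x _ _"] A.smooth B.smooth)
  qed (rule o)
  interpret local_metric "S \<times> T" h by fact
  have lc: "G z u v = (A.G (fst z) (fst u) (fst v), B.G (snd z) (snd u) (snd v))" if z: "z \<in> S \<times> T" for z u v
  proof (rule levi_civita_unique[OF z])
    have z1: "fst z \<in> S" and z2: "snd z \<in> T" using z by auto
    show "(A.G (fst z) (fst u) (fst v), B.G (snd z) (snd u) (snd v)) =
        (A.G (fst z) (fst v) (fst u), B.G (snd z) (snd v) (snd u))" for u v
      by (simp add: A.levi_civita_sym[OF z1, of "fst u"] B.levi_civita_sym[OF z2, of "snd u"])
    fix t u v
    have "((\<lambda>y. h y u v) has_derivative (\<lambda>t. dd (\<lambda>y. h1 y (fst u) (fst v)) (fst z) (fst t) +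
       \<epsilon> * dd (\<lambda>y. h2 y (snd u) (snd v)) (snd z) (snd t))) (at z)"
      unfolding h_def
      by (intro has_derivative_add has_derivative_mult_right
         has_derivative_compose[OF has_derivative_fst[OF has_derivative_ident] A.dh[OF z1]]
         has_derivative_compose[OF has_derivative_snd[OF has_derivative_ident] B.dh[OF z2]])
    from frechet_derivative_eqI[OF this]
    show "dd (\<lambda>y. h y u v) z t =
       h z (A.G (fst z) (fst t) (fst u), B.G (snd z) (snd t) (snd u)) v +
       h z u (A.G (fst z) (fst t) (fst v), B.G (snd z) (snd t) (snd v))"
      by (simp add: A.compat[OF z1] B.compat[OF z2] h_def algebra_simps)
  qed
  then show "z \<in> S \<times> T \<Longrightarrow> levi_civita h z u v =
      (levi_civita h1 (fst z) (fst u) (fst v), levi_civita h2 (snd z) (snd u) (snd v))" .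
  assume z: "z \<in> S \<times> T"
  have z1: "fst z \<in> S" and z2: "snd z \<in> T" using z by auto
  have d: "dd (\<lambda>y. G y v w) z u = (dd (\<lambda>y. A.G y (fst v) (fst w)) (fst z) (fst u),
     dd (\<lambda>y. B.G y (snd v) (snd w)) (snd z) (snd u))" for u v w
  proof -
    have "((\<lambda>y. (A.G (fst y) (fst v) (fst w), B.G (snd y) (snd v) (snd w))) has_derivative
      (\<lambda>u. (dd (\<lambda>y. A.G y (fst v) (fst w)) (fst z) (fst u), dd (\<lambda>y. B.G y (snd v) (snd w)) (snd z) (snd u)))) (at z)"
      by (intro has_derivative_Pair
         has_derivative_compose[OF has_derivative_fst[OF has_derivative_ident] A.dG[OF z1]]
         has_derivative_compose[OF has_derivative_snd[OF has_derivative_ident] B.dG[OF z2]])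
    from has_derivative_unique_dd[OF this o z, of "\<lambda>y. G y v w"] lc show ?thesis by simp
  qed
  show "curvature h z u v w =
      (curvature h1 (fst z) (fst u) (fst v) (fst w), curvature h2 (snd z) (snd u) (snd v) (snd w))"
    by (simp add: curvature_def d lc[OF z])
qed

text \<open>The sectional curvature evaluated on the coordinate frame, an explicit quotient;
  independence of the frame is part of \<open>curvature_eq_gauss\<close>.\<close>

definition gauss :: "(real^2 \<Rightarrow> real^2 \<Rightarrow> real^2 \<Rightarrow> real) \<Rightarrow> real^2 \<Rightarrow> real"
  where "gauss h x = h x (curvature h x (axis 1 1) (axis 2 1) (axis 2 1)) (axis 1 1) /
    (h x (axis 1 1) (axis 1 1) * h x (axis 2 1) (axis 2 1) - (h x (axis 1 1) (axis 2 1))\<^sup>2)"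

lemma real2_expansion: "(u :: real^2) = u$1 *\<^sub>R axis 1 1 + u$2 *\<^sub>R axis 2 1"
  by (simp add: vec_eq_iff forall_2 axis_def)

lemma real2_alternating:
  fixes b :: "real^2 \<Rightarrow> real^2 \<Rightarrow> real"
  assumes "\<And>u. linear (b u)" "\<And>v. linear (\<lambda>u. b u v)" "\<And>u. b u u = 0"
  shows "b u v = b (axis 1 1) (axis 2 1) * (u$1 * v$2 - u$2 * v$1)"
proof -
  let ?e = "axis 1 1 :: real^2" and ?f = "axis 2 1 :: real^2"
  have a: "b ?f ?e = - b ?e ?f"
    using assms(3)[of "?e + ?f"] assms(3)[of ?e] assms(3)[of ?f]
    by (simp add: linear_add[OF assms(1)] linear_add[OF assms(2)])
  have "b u v = b (u$1 *\<^sub>R ?e + u$2 *\<^sub>R ?f) (v$1 *\<^sub>R ?e + v$2 *\<^sub>R ?f)"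
    using real2_expansion by metis
  also have "\<dots> = b ?e ?f * (u$1 * v$2 - u$2 * v$1)"
    by (simp add: linear_add[OF assms(1)] linear_add[OF assms(2)] linear_cmul[OF assms(1)] linear_cmul[OF assms(2)]
      assms(3) a algebra_simps)
  finally show ?thesis .
qed

locale local_surface = local_metric S h for S :: "(real^2) set" and h :: "real^2 \<Rightarrow> real^2 \<Rightarrow> real^2 \<Rightarrow> real" +
  assumes pos: "x \<in> S \<Longrightarrow> u \<noteq> 0 \<Longrightarrow> h x u u > 0"
begin

abbreviation "e1 \<equiv> axis 1 1 :: real^2"
abbreviation "e2 \<equiv> axis 2 1 :: real^2"

definition gram where "gram x = h x e1 e1 * h x e2 e2 - (h x e1 e2)\<^sup>2"

lemma gram_pos:
  assumes "x \<in> S"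
  shows "gram x > 0"
proof -
  note hs = h_simps[OF assms]
  have e: "e1 \<noteq> 0" by simp
  have p: "h x e1 e1 > 0" by (rule pos[OF assms e])
  \<comment> \<open>Gram-Schmidt without division: orthogonal to \<open>e1\<close>, with squared
    length \<open>h x e1 e1 * gram x\<close>.\<close>
  let ?z = "h x e1 e1 *\<^sub>R e2 - h x e1 e2 *\<^sub>R e1"
  have "?z \<noteq> 0"
  proof
    assume "?z = 0"
    then have "?z $ 2 = 0" by simp
    then show False using p by (simp add: axis_def)
  qed
  from pos[OF assms this] have "h x e1 e1 * gram x > 0"
    by (simp add: hs gram_def power2_eq_square algebra_simps sym[OF assms, of e2 e1])
  then show ?thesis using p by (simp add: zero_less_mult_iff)
qed

text \<open>Both sides are alternating in \<open>u\<close>, \<open>v\<close> and again in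
  \<open>z\<close>, \<open>w\<close>, so their values on the coordinate frame decide.\<close>

lemma gram_eq:
  assumes "x \<in> S"
  shows "h x v w * h x u z - h x u w * h x v z = gram x * (u$1 * v$2 - u$2 * v$1) * (z$1 * w$2 - z$2 * w$1)"
proof -
  note hs = h_simps[OF assms]
  let ?b = "\<lambda>u v. h x v w * h x u z - h x u w * h x v z"
  have 1: "?b u v = ?b e1 e2 * (u$1 * v$2 - u$2 * v$1)"
    by (rule real2_alternating[of ?b]) (auto intro!: linearI simp: hs algebra_simps)
  let ?c = "\<lambda>z w. h x e2 w * h x e1 z - h x e1 w * h x e2 z"
  have "?c z w = ?c e1 e2 * (z$1 * w$2 - z$2 * w$1)"
    by (rule real2_alternating[of ?c]) (auto intro!: linearI simp: hs algebra_simps)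
  also have "?c e1 e2 = gram x"
    by (simp add: gram_def power2_eq_square sym[OF assms, of e2 e1])
  finally show ?thesis using 1 by simp
qed

text \<open>Paired with \<open>z\<close>, the curvature is alternating in \<open>u\<close>,
  \<open>v\<close> and, by \<open>curvature_skew\<close>, also in \<open>z\<close>,
  \<open>w\<close>. So is the right-hand side, and \<open>gauss\<close> is the ratio of the two on
  the coordinate frame.\<close>

lemma curvature_eq_gauss:
  assumes x: "x \<in> S"
  shows "curvature h x u v w = gauss h x *\<^sub>R (h x v w *\<^sub>R u - h x u w *\<^sub>R v)"
proof (rule eqI[OF x])
  fix z
  note hs = h_simps[OF x] linear_add[OF linear_curvature(1)[OF x]] linear_add[OF linear_curvature(2)[OF x]]
    linear_add[OF linear_curvature(3)[OF x]] linear_cmul[OF linear_curvature(1)[OF x]] linear_cmul[OF linear_curvature(2)[OF x]]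
    linear_cmul[OF linear_curvature(3)[OF x]]
  let ?b = "\<lambda>u v. h x (curvature h x u v w) z"
  have uu: "curvature h x u u w = 0" for u w by (simp add: curvature_def)
  have 1: "?b u v = ?b e1 e2 * (u$1 * v$2 - u$2 * v$1)"
    by (rule real2_alternating[of ?b]) (auto intro!: linearI simp: hs uu algebra_simps)
  let ?c = "\<lambda>z w. h x (curvature h x e1 e2 w) z"
  have "?c z w = ?c e1 e2 * (z$1 * w$2 - z$2 * w$1)"
    by (rule real2_alternating[of ?c]) (auto intro!: linearI simp: hs curvature_skew[OF x] algebra_simps)
  then have "h x (curvature h x u v w) z = gauss h x * gram x * (u$1 * v$2 - u$2 * v$1) * (z$1 * w$2 - z$2 * w$1)"
    using 1 gram_pos[OF x] by (simp add: gauss_def gram_def)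
  also have "\<dots> = gauss h x * (h x v w * h x u z - h x u w * h x v z)"
    using gram_eq[OF x, of v w u z] by simp
  finally show "h x (curvature h x u v w) z = h x (gauss h x *\<^sub>R (h x v w *\<^sub>R u - h x u w *\<^sub>R v)) z"
    by (simp add: hs algebra_simps)
qed

end

section \<open>Linear total differential equations\<close>

text \<open>The Leibniz rule. The integrand has full derivatives on \<open>U\<close>, as
  \<open>Ck_on\<close> demands, instead of one-sided ones at the two ends of the interval.\<close>

lemma has_derivative_integral_param:
  fixes k :: "'a::euclidean_space \<times> real \<Rightarrow> 'b::euclidean_space"
  assumes "open B" "B \<times> {0..1} \<subseteq> U" "Ck_on 1 U k" "x \<in> B"
  shows "((\<lambda>x. integral {0..1} (\<lambda>t. k (x, t))) has_derivative
    (\<lambda>v. integral {0..1} (\<lambda>t. dd k (x, t) (v, 0)))) (at x)"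
proof -
  obtain r where r: "r > 0" "ball x r \<subseteq> B" using assms(1,4) openE by blast
  have dk: "(k has_derivative dd k z) (at z)" if "z \<in> U" for z
    using Ck_on_Suc_has_derivative assms(3) that unfolding One_nat_def by blast
  have inU: "(y, t) \<in> U" if "y \<in> ball x r" "t \<in> cbox 0 1" for y t
    using subsetD[OF assms(2), of "(y, t)"] subsetD[OF r(2)] that by auto
  have bl: "bounded_linear (\<lambda>v. dd k z (v, 0))" if "z \<in> U" for z
    using bounded_linear_compose[OF has_derivative_bounded_linear[OF dk[OF that]]
      bounded_linear_Pair[OF bounded_linear_ident bounded_linear_zero]] .
  \<comment> \<open>\<open>leibniz_rule\<close> takes the partial derivative as a continuous family
    of bounded linear maps; its continuity is checked on basis vectors.\<close>
  define fx where "fx y t = Blinfun (\<lambda>v. dd k (y, t) (v, 0))" for y t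
  have fx: "blinfun_apply (fx y t) = (\<lambda>v. dd k (y, t) (v, 0))" if "(y, t) \<in> U" for y t
    unfolding fx_def by (rule bounded_linear_Blinfun_apply[OF bl[OF that]])
  have cdd: "continuous_on U (\<lambda>z. dd k z v)" for v
    using Ck_on_Suc_derivative[of 0 U k v] assms(3) by (simp only: One_nat_def Ck_on.simps(1))
  have ck: "continuous_on U k" using assms(3) Ck_on_Suc_D[of 0 U k] by simp
  have cfx: "continuous_on (ball x r \<times> cbox 0 1) (\<lambda>(y, t). fx y t)"
  proof (rule continuous_on_blinfun_componentwise)
    fix i :: 'a
    have "continuous_on (ball x r \<times> cbox 0 1) (\<lambda>z. dd k z (i, 0))"
      by (rule continuous_on_subset[OF cdd]) (use inU in auto)
    then show "continuous_on (ball x r \<times> cbox 0 1) (\<lambda>z. blinfun_apply (case z of (y, t) \<Rightarrow> fx y t) i)"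
      by (rule continuous_on_eq) (use inU fx in \<open>auto simp: split_beta\<close>)
  qed
  have "((\<lambda>x. integral (cbox 0 1) (\<lambda>t. k (x, t))) has_derivative blinfun_apply (integral (cbox 0 1) (fx x))) (at x within ball x r)"
  proof (rule leibniz_rule[OF _ _ cfx])
    fix y t assume yt: "y \<in> ball x r" "t \<in> cbox (0::real) 1"
    have "((\<lambda>y. k (y, t)) has_derivative (\<lambda>v. dd k (y, t) (v, 0))) (at y)"
      by (rule has_derivative_compose[where f="\<lambda>y. (y, t)", OF _ dk[OF inU[OF yt]]])
         (auto intro!: derivative_eq_intros)
    then show "((\<lambda>y. k (y, t)) has_derivative blinfun_apply (fx y t)) (at y within ball x r)"
      using fx[OF inU[OF yt]] has_derivative_at_withinI by fastforce
  next
    fix y assume y: "y \<in> ball x r"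
    have "continuous_on (cbox 0 1) (\<lambda>t. k (y, t))"
      by (rule continuous_on_compose2[OF ck]) (use inU[OF y] in \<open>auto intro!: continuous_intros\<close>)
    then show "(\<lambda>t. k (y, t)) integrable_on cbox 0 1" by (rule integrable_continuous)
  qed (use r in auto)
  moreover
  have "blinfun_apply (integral (cbox 0 1) (fx x)) v = integral {0..1} (\<lambda>t. dd k (x, t) (v, 0))" for v
  proof -
    have "continuous_on (cbox 0 1) (\<lambda>t. fx x t)"
      using continuous_on_compose2[OF cfx continuous_on_Pair[OF continuous_on_const continuous_on_id], of x] r by force
    then have "blinfun_apply (integral (cbox 0 1) (fx x)) v = integral (cbox 0 1) (\<lambda>t. blinfun_apply (fx x t) v)"
      by (intro blinfun_apply_integral integrable_continuous)
    also have "\<dots> = integral (cbox 0 1) (\<lambda>t. dd k (x, t) (v, 0))"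
      by (rule integral_cong) (use fx inU r in auto)
    finally show ?thesis by simp
  qed
  then have "blinfun_apply (integral (cbox 0 1) (fx x)) = (\<lambda>v. integral {0..1} (\<lambda>t. dd k (x, t) (v, 0)))" by blast
  ultimately show ?thesis using r(1) by (simp add: at_within_open[of _ "ball x r"])
qed

lemma Ck_on_integral_param:
  fixes k :: "'a::euclidean_space \<times> real \<Rightarrow> 'b::euclidean_space"
  assumes "open B" "B \<times> {0..1} \<subseteq> U" "Ck_on n U k"
  shows "Ck_on n B (\<lambda>x. integral {0..1} (\<lambda>t. k (x, t)))"
  using assms(3)
proof (induction n arbitrary: k)
  case 0
  have "continuous_on (B \<times> cbox 0 1) (\<lambda>(x, t). k (x, t))"
    using 0 assms(2) by (auto intro: continuous_on_subset)
  from integral_continuous_on_param[OF this] show ?case by simp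
next
  case (Suc n)
  have "Ck_on 1 U k" using Suc.prems
  proof (induction n)
    case (Suc m) then show ?case using Ck_on_Suc_D by blast
  qed simp
  then show ?case
    by (intro Ck_on_SucI[OF assms(1) has_derivative_integral_param[OF assms(1,2)]])
       (use Suc in \<open>auto intro: Suc.IH\<close>)
qed

text \<open>The differential of the radial primitive recovers the 1-form up to an integral of its exterior
  derivative (Poincare's homotopy formula).\<close>

definition radial_primitive :: "'a::euclidean_space \<Rightarrow> ('a \<Rightarrow> 'a \<Rightarrow> 'b::euclidean_space) \<Rightarrow> 'a \<Rightarrow> 'b"
  where "radial_primitive x0 \<alpha> x = integral {0..1} (\<lambda>t. \<alpha> (x0 + t *\<^sub>R (x - x0)) (x - x0))"

lemma segment_in_ball:
  fixes x :: "'a::real_normed_vector"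
  assumes "x \<in> ball x0 r" "t \<in> {0..1::real}"
  shows "x0 + t *\<^sub>R (x - x0) \<in> ball x0 r"
proof -
  have "norm (t *\<^sub>R (x - x0)) \<le> norm (x - x0)"
    using assms(2) by (simp add: mult_left_le_one_le)
  then show ?thesis using assms(1) by (auto simp: dist_norm norm_minus_commute)
qed

lemma
  fixes \<alpha> :: "'a::euclidean_space \<Rightarrow> 'a \<Rightarrow> 'b::euclidean_space"
  assumes lin: "\<And>y. y \<in> ball x0 r \<Longrightarrow> linear (\<alpha> y)" and smooth: "\<And>u. smooth_on (ball x0 r) (\<lambda>y. \<alpha> y u)"
  shows smooth_on_radial_primitive: "smooth_on (ball x0 r) (radial_primitive x0 \<alpha>)"
    and has_derivative_radial_primitive: "x \<in> ball x0 r \<Longrightarrow> (radial_primitive x0 \<alpha> has_derivative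
     (\<lambda>v. \<alpha> x v - integral {0..1} (\<lambda>t. t *\<^sub>R (dd (\<lambda>y. \<alpha> y v) (x0 + t *\<^sub>R (x - x0)) (x - x0) -
        dd (\<lambda>y. \<alpha> y (x - x0)) (x0 + t *\<^sub>R (x - x0)) v)))) (at x)"
    and continuous_on_radial_defect: "x \<in> ball x0 r \<Longrightarrow> continuous_on {0..1}
      (\<lambda>t. t *\<^sub>R (dd (\<lambda>y. \<alpha> y v) (x0 + t *\<^sub>R (x - x0)) (x - x0) - dd (\<lambda>y. \<alpha> y (x - x0)) (x0 + t *\<^sub>R (x - x0)) v))"
proof -
  let ?B = "ball x0 r"
  \<comment> \<open>The radial contraction of the ball. The set \<open>U\<close> on which it stays
    in the ball is open and contains the closed strip over [0, 1].\<close>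
  define q where "q z = x0 + snd z *\<^sub>R (fst z - x0)" for z :: "'a \<times> real"
  define U where "U = {z. fst z \<in> ?B \<and> q z \<in> ?B}"
  have sq: "smooth_on UNIV q" unfolding q_def
    by (intro smooth_on_add smooth_on_scaleR smooth_on_diff smooth_on_const smooth_on_bounded_linear bounded_linear_fst bounded_linear_snd open_UNIV)
  have oU: "open U"
  proof -
    have "open (fst -` ?B \<inter> q -` ?B)"
      by (intro open_Int open_vimage continuous_intros smooth_on_imp_continuous_on[OF sq]) auto
    then show ?thesis by (simp add: U_def vimage_def Int_def)
  qed
  have BU: "?B \<times> {0..1} \<subseteq> U" using segment_in_ball[of _ x0 r] unfolding U_def q_def by force
  define k where "k z = \<alpha> (q z) (fst z - x0)" for z
  have aq: "smooth_on U (\<lambda>z. f (q z))" if "smooth_on ?B f" for f :: "'a \<Rightarrow> 'b"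
    by (rule smooth_on_compose[OF oU open_ball _ smooth_on_subset[OF sq] that]) (auto simp: U_def)
  have sk: "smooth_on U k"
    unfolding k_def
    by (rule smooth_on_linear_family[where L="\<lambda>z. \<alpha> (q z)", OF oU lin aq[OF smooth]])
       (auto simp: U_def[symmetric] intro: smooth_on_diff[OF oU smooth_on_bounded_linear[OF oU bounded_linear_fst] smooth_on_const[OF oU]],
        auto simp: U_def)
  have rp: "radial_primitive x0 \<alpha> = (\<lambda>x. integral {0..1} (\<lambda>t. k (x, t)))"
    by (simp add: radial_primitive_def k_def q_def fun_eq_iff)
  show "smooth_on ?B (radial_primitive x0 \<alpha>)"
    unfolding rp using Ck_on_integral_param[OF open_ball BU] sk by (auto simp: smooth_on_def)
  show "continuous_on {0..1} (\<lambda>t. t *\<^sub>R (dd (\<lambda>y. \<alpha> y v) (x0 + t *\<^sub>R (x - x0)) (x - x0) - dd (\<lambda>y. \<alpha> y (x - x0)) (x0 + t *\<^sub>R (x - x0)) v))"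
    if x: "x \<in> ?B" for x v
    using segment_in_ball[OF x]
    by (intro continuous_intros continuous_on_compose2[OF smooth_on_imp_continuous_on[OF smooth_on_derivative[OF smooth]]]) auto
  assume x: "x \<in> ?B"
  let ?z = "x - x0" and ?y = "\<lambda>t. x0 + t *\<^sub>R (x - x0)"
  have da: "((\<lambda>y. \<alpha> y u) has_derivative dd (\<lambda>y. \<alpha> y u) y) (at y)" if "y \<in> ?B" for y u
    by (rule smooth_on_has_derivative[OF smooth that])
  have dk: "dd k (x, t) (v, 0) = t *\<^sub>R dd (\<lambda>y. \<alpha> y ?z) (?y t) v + \<alpha> (?y t) v" if t: "t \<in> {0..1}" for t v
  proof -
    have xt: "(x, t) \<in> U" using BU x t by auto
    have yB: "?y t \<in> ?B" by (rule segment_in_ball[OF x t])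
    have dq: "(q has_derivative (\<lambda>w. t *\<^sub>R fst w + snd w *\<^sub>R ?z)) (at (x, t))"
      unfolding q_def by (auto intro!: derivative_eq_intros)
    have chain: "((\<lambda>z. \<alpha> (q z) u) has_derivative (\<lambda>w. dd (\<lambda>y. \<alpha> y u) (?y t) (t *\<^sub>R fst w + snd w *\<^sub>R ?z))) (at (x, t))" for u
      using has_derivative_compose[OF dq, of "\<lambda>y. \<alpha> y u"] da[OF yB] by (simp add: q_def)
    have "(k has_derivative (\<lambda>w. dd (\<lambda>z. \<alpha> (q z) (fst (x, t) - x0)) (x, t) w + \<alpha> (q (x, t)) (fst w))) (at (x, t))"
      unfolding k_def
      by (rule has_derivative_linear_family(1)[where L="\<lambda>z. \<alpha> (q z)", OF oU xt lin])
         (use chain in \<open>auto simp: U_def differentiable_def intro!: derivative_eq_intros\<close>)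
    from frechet_derivative_eqI[OF this]
    have "dd k (x, t) (v, 0) = dd (\<lambda>y. \<alpha> y ?z) (?y t) (t *\<^sub>R fst (v, 0::real) + snd (v, 0::real) *\<^sub>R ?z) + \<alpha> (q (x, t)) v"
      unfolding fst_conv frechet_derivative_eqI[OF chain] by simp
    then show ?thesis
      by (simp add: q_def linear_cmul[OF has_derivative_linear[OF da[OF yB]]])
  qed
  have hd: "(radial_primitive x0 \<alpha> has_derivative (\<lambda>v. integral {0..1} (\<lambda>t. dd k (x, t) (v, 0)))) (at x)"
    unfolding rp by (rule has_derivative_integral_param[OF open_ball BU _ x]) (use sk in \<open>auto simp: smooth_on_def\<close>)
  have "integral {0..1} (\<lambda>t. dd k (x, t) (v, 0)) =
    \<alpha> x v - integral {0..1} (\<lambda>t. t *\<^sub>R (dd (\<lambda>y. \<alpha> y v) (?y t) ?z - dd (\<lambda>y. \<alpha> y ?z) (?y t) v))" for v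
  proof -
    have ca: "continuous_on {0..1} (\<lambda>t. \<alpha> (?y t) v)"
      using segment_in_ball[OF x]
      by (intro continuous_intros continuous_on_compose2[OF smooth_on_imp_continuous_on[OF smooth]]) auto
    have cd: "continuous_on {0..1} (\<lambda>t. dd (\<lambda>y. \<alpha> y u) (?y t) w)" for u w
      using segment_in_ball[OF x]
      by (intro continuous_intros continuous_on_compose2[OF smooth_on_imp_continuous_on[OF smooth_on_derivative[OF smooth]]]) auto
    \<comment> \<open>This is the integral of the derivative of \<open>t\<close> times the form at
      \<open>?y t\<close>: the boundary value at 1 is the form itself, the one at 0 vanishes. What
      is left of the Leibniz integral is the contracted exterior derivative.\<close>
    have "((\<lambda>t. \<alpha> (?y t) v + t *\<^sub>R dd (\<lambda>y. \<alpha> y v) (?y t) ?z) has_integral 1 *\<^sub>R \<alpha> (?y 1) v - 0 *\<^sub>R \<alpha> (?y 0) v) {0..1}"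
    proof (rule fundamental_theorem_of_calculus)
      fix t :: real assume t: "t \<in> {0..1}"
      have yB: "?y t \<in> ?B" by (rule segment_in_ball[OF x t])
      have "((\<lambda>t. \<alpha> (?y t) v) has_derivative (\<lambda>s. dd (\<lambda>y. \<alpha> y v) (?y t) (s *\<^sub>R ?z))) (at t)"
        by (rule has_derivative_compose[where f="?y", OF _ da[OF yB]]) (auto intro!: derivative_eq_intros)
      then have "((\<lambda>t. \<alpha> (?y t) v) has_vector_derivative dd (\<lambda>y. \<alpha> y v) (?y t) ?z) (at t)"
        unfolding has_vector_derivative_def
        by (simp add: linear_cmul[OF has_derivative_linear[OF da[OF yB]]])
      then have "((\<lambda>t. t *\<^sub>R \<alpha> (?y t) v) has_vector_derivative
         t *\<^sub>R dd (\<lambda>y. \<alpha> y v) (?y t) ?z + 1 *\<^sub>R \<alpha> (?y t) v) (at t)"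
        by (intro has_vector_derivative_scaleR) (auto intro!: derivative_eq_intros)
      then show "((\<lambda>t. t *\<^sub>R \<alpha> (?y t) v) has_vector_derivative \<alpha> (?y t) v + t *\<^sub>R dd (\<lambda>y. \<alpha> y v) (?y t) ?z) (at t within {0..1})"
        by (auto intro: has_vector_derivative_at_within simp: add.commute)
    qed simp
    then have 1: "integral {0..1} (\<lambda>t. \<alpha> (?y t) v + t *\<^sub>R dd (\<lambda>y. \<alpha> y v) (?y t) ?z) = \<alpha> x v"
      by (auto dest: integral_unique)
    have "integral {0..1} (\<lambda>t. dd k (x, t) (v, 0)) = integral {0..1} (\<lambda>t. (\<alpha> (?y t) v + t *\<^sub>R dd (\<lambda>y. \<alpha> y v) (?y t) ?z)
      - t *\<^sub>R (dd (\<lambda>y. \<alpha> y v) (?y t) ?z - dd (\<lambda>y. \<alpha> y ?z) (?y t) v))"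
      by (rule integral_cong) (simp add: dk algebra_simps)
    also have "\<dots> = integral {0..1} (\<lambda>t. \<alpha> (?y t) v + t *\<^sub>R dd (\<lambda>y. \<alpha> y v) (?y t) ?z)
      - integral {0..1} (\<lambda>t. t *\<^sub>R (dd (\<lambda>y. \<alpha> y v) (?y t) ?z - dd (\<lambda>y. \<alpha> y ?z) (?y t) v))"
      by (intro integral_diff integrable_continuous_interval continuous_intros ca cd)
    finally show ?thesis using 1 by simp
  qed
  with hd show "(radial_primitive x0 \<alpha> has_derivative (\<lambda>v. \<alpha> x v - integral {0..1} (\<lambda>t. t *\<^sub>R (dd (\<lambda>y. \<alpha> y v) (?y t) ?z -
        dd (\<lambda>y. \<alpha> y ?z) (?y t) v)))) (at x)" by simp
qed

lemma geometric_limit: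
  fixes a :: "nat \<Rightarrow> 'b::banach"
  assumes "\<And>n. norm (a (Suc n) - a n) \<le> c / 4 ^ n" "c \<ge> 0"
  obtains l where "a \<longlonglongrightarrow> l" "\<And>n. norm (a n - l) \<le> 2 * c / 4 ^ n"
proof -
  \<comment> \<open>Subtracting the remaining tail lets the induction close, because
    \<open>c - 2 * c <= - 2 * c / 4\<close>; the sharp factor in place of 2 would be 4/3.\<close>
  have *: "norm (a (n + k) - a n) \<le> 2 * c / 4 ^ n - 2 * c / 4 ^ (n + k)" for n k
  proof (induction k)
    case (Suc k)
    have "norm (a (n + Suc k) - a n) \<le> norm (a (Suc (n + k)) - a (n + k)) + norm (a (n + k) - a n)"
      using norm_triangle_ineq[of "a (Suc (n + k)) - a (n + k)" "a (n + k) - a n"] by simp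
    also have "\<dots> \<le> c / 4 ^ (n + k) + (2 * c / 4 ^ n - 2 * c / 4 ^ (n + k))"
      using assms(1)[of "n + k"] Suc by simp
    also have "\<dots> \<le> 2 * c / 4 ^ n - 2 * c / 4 ^ (n + Suc k)"
      using assms(2) by (simp add: field_simps)
    finally show ?case .
  qed simp
  have **: "norm (a m - a n) \<le> 2 * c / 4 ^ n" if "m \<ge> n" for m n
    using *[of n "m - n"] that assms(2) by (smt (verit) divide_nonneg_pos le_add_diff_inverse zero_less_power)
  have lim0: "(\<lambda>n. 2 * c / 4 ^ n) \<longlonglongrightarrow> 0"
    using tendsto_mult_right_zero[OF LIMSEQ_power_zero[of "1/4::real"], of "2 * c"] by (simp add: power_divide)
  have "Cauchy a"
  proof (rule CauchyI')
    fix e :: real assume "e > 0"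
    then obtain N where N: "2 * c / 4 ^ N < e / 2"
      using order_tendstoD(2)[OF lim0, of "e/2"] by (auto simp: eventually_sequentially)
    show "\<exists>M. \<forall>m\<ge>M. \<forall>n>m. dist (a m) (a n) < e"
    proof (intro exI[of _ N] allI impI)
      fix m n assume "N \<le> m" "m < n"
      then have "norm (a m - a N) < e / 2" "norm (a n - a N) < e / 2"
        using **[of N m] **[of N n] N by auto
      then show "dist (a m) (a n) < e"
        unfolding dist_norm using norm_triangle_ineq4[of "a m - a N" "a n - a N"] by simp
    qed
  qed
  then obtain l where l: "a \<longlonglongrightarrow> l" using Cauchy_convergent_iff convergent_def by blast
  have "norm (a n - l) \<le> 2 * c / 4 ^ n" for n
  proof -
    have "norm (l - a n) \<le> 2 * c / 4 ^ n"
      by (rule Lim_norm_ubound[OF _ tendsto_diff[OF l tendsto_const]])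
         (auto simp: eventually_sequentially intro!: exI[of _ n] **)
    then show ?thesis by (simp add: norm_minus_commute)
  qed
  then show thesis by (rule that[OF l])
qed

lemma bilinear_family_bound:
  fixes A :: "'a::euclidean_space \<Rightarrow> 'b::euclidean_space \<Rightarrow> 'f::euclidean_space \<Rightarrow> 'g::real_normed_vector"
  assumes "compact K" "\<And>y F. y \<in> K \<Longrightarrow> linear (\<lambda>v. A y v F)" "\<And>y v. y \<in> K \<Longrightarrow> linear (A y v)"
    and "\<And>v F. continuous_on K (\<lambda>y. A y v F)"
  obtains M where "M > 0" "\<And>y v F. y \<in> K \<Longrightarrow> norm (A y v F) \<le> M * norm v * norm F"
proof -
  let ?m = "\<lambda>y. \<Sum>i\<in>Basis. \<Sum>j\<in>Basis. norm (A y i j)"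
  have "continuous_on K ?m" by (intro continuous_intros assms(4))
  then have "bounded (?m ` K)"
    using assms(1) by (intro compact_imp_bounded compact_continuous_image)
  then obtain M where M: "M > 0" "\<And>y. y \<in> K \<Longrightarrow> norm (?m y) \<le> M"
    unfolding bounded_pos by auto
  have "norm (A y v F) \<le> M * norm v * norm F" if y: "y \<in> K" for y v F
  proof -
    have "A y v F = (\<Sum>i\<in>Basis. (v \<bullet> i) *\<^sub>R (\<Sum>j\<in>Basis. (F \<bullet> j) *\<^sub>R A y i j))"
      by (subst linear_basis_expansion[OF assms(2)[OF y]], subst linear_basis_expansion[OF assms(3)[OF y], of _ F]) simp
    also have "norm \<dots> \<le> (\<Sum>i\<in>Basis. norm v * (\<Sum>j\<in>Basis. norm F * norm (A y i j)))"
      by (intro sum_norm_le) (auto intro!: mult_mono sum_norm_le mult_right_mono Basis_le_norm)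
    also have "\<dots> = norm v * norm F * ?m y"
      by (simp add: sum_distrib_left mult.assoc)
    also have "\<dots> \<le> norm v * norm F * M"
      using M(2)[OF y] by (intro mult_left_mono) auto
    finally show ?thesis by (simp add: mult_ac)
  qed
  with M(1) that show thesis by blast
qed

text \<open>Frobenius' theorem for the linear total differential equation \<open>dF = A F\<close>. Picard iteration with
  the radial primitive contracts both the increments of the iterates and the defect \<open>dF\<^sub>n - A F\<^sub>n\<close>,
  because the exterior derivative of \<open>A F\<^sub>n\<close> is \<open>A\<close> applied to the defect.\<close>

lemma linear_frobenius:
  fixes A :: "'a::euclidean_space \<Rightarrow> 'a \<Rightarrow> 'f::euclidean_space \<Rightarrow> 'f"
  assumes "open S" "x0 \<in> S"
    and lin1: "\<And>y F. y \<in> S \<Longrightarrow> linear (\<lambda>v. A y v F)" and lin2: "\<And>y v. y \<in> S \<Longrightarrow> linear (A y v)"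
    and smooth: "\<And>v F. smooth_on S (\<lambda>y. A y v F)"
    and integrable: "\<And>y u v F. y \<in> S \<Longrightarrow>
      dd (\<lambda>y. A y v F) y u + A y v (A y u F) = dd (\<lambda>y. A y u F) y v + A y u (A y v F)"
  obtains r F where "r > 0" "ball x0 r \<subseteq> S" "F x0 = F0" "smooth_on (ball x0 r) F"
    "\<And>x. x \<in> ball x0 r \<Longrightarrow> (F has_derivative (\<lambda>v. A x v (F x))) (at x)"
proof -
  obtain r0 where r0: "r0 > 0" "cball x0 r0 \<subseteq> S" using assms(1,2) open_contains_cball by blast
  have l: "linear (\<lambda>v. A y v F)" "linear (A y v)" if "y \<in> cball x0 r0" for y v F
    using lin1 lin2 that r0(2) by blast+
  have l3: "continuous_on (cball x0 r0) (\<lambda>y. A y v F)" for v F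
    by (rule continuous_on_subset[OF smooth_on_imp_continuous_on[OF smooth] r0(2)])
  obtain M where M: "M > 0" "\<And>y v F. y \<in> cball x0 r0 \<Longrightarrow> norm (A y v F) \<le> M * norm v * norm F"
    by (rule bilinear_family_bound[where A=A, OF compact_cball l l3]) blast+
  \<comment> \<open>With \<open>M * r <= 1/8\<close> an increment of the iterates shrinks at least
    by the factor 1/4. In the defect estimate two such terms occur, and together they give
    1/4.\<close>
  define r where "r = min r0 (1 / (8 * M))"
  have r: "r > 0" "r \<le> r0" "M * r \<le> 1 / 8" using r0 M(1) by (auto simp: r_def min_def field_simps)
  let ?B = "ball x0 r"
  have BS: "?B \<subseteq> S" using r r0 by (auto simp: subset_eq)
  have Mb: "norm (A y v G) \<le> M * norm v * norm G" if "y \<in> ?B" for y v G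
    using M(2) that r(2) by auto
  define F where "F n = rec_nat (\<lambda>x. F0) (\<lambda>n G x. F0 + radial_primitive x0 (\<lambda>y v. A y v (G y)) x) n" for n :: nat
  have F_0: "F 0 = (\<lambda>x. F0)" by (simp add: F_def)
  have F_Suc: "F (Suc n) = (\<lambda>x. F0 + radial_primitive x0 (\<lambda>y v. A y v (F n y)) x)" for n by (simp add: F_def)
  have sm_a: "smooth_on ?B (\<lambda>y. A y v (G y))" if "smooth_on ?B G" for G v
    by (rule smooth_on_linear_family[OF open_ball lin2 smooth_on_subset[OF smooth BS] that]) (use BS in auto)
  have lin_a: "linear (\<lambda>v. A y v G)" if "y \<in> ?B" for y G using lin1 BS that by blast
  have sF: "smooth_on ?B (F n)" for n
  proof (induction n)
    case 0 show ?case by (simp add: F_0 smooth_on_const)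
  next
    case (Suc n)
    show ?case unfolding F_Suc
      by (intro smooth_on_add smooth_on_const open_ball smooth_on_radial_primitive[OF lin_a sm_a[OF Suc]])
  qed
  have F_x0: "F n x0 = F0" for n
  proof (cases n)
    case (Suc m)
    have "A x0 0 (F m x0) = 0" using linear_0[OF lin_a[of x0 "F m x0"]] r(1) by simp
    then show ?thesis unfolding Suc F_Suc radial_primitive_def by simp
  qed (simp add: F_0)
  define c where "c = norm F0"
  have "c \<ge> 0" by (simp add: c_def)
  have seg: "x0 + t *\<^sub>R (x - x0) \<in> ?B" if "x \<in> ?B" "t \<in> {0..1}" for x t
    by (rule segment_in_ball[OF that])
  have z: "norm (x - x0) \<le> r" if "x \<in> ?B" for x using that by (simp add: dist_norm norm_minus_commute)
  have cont: "continuous_on {0..1} (\<lambda>t. A (x0 + t *\<^sub>R (x - x0)) v (G (x0 + t *\<^sub>R (x - x0))))"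
    if "x \<in> ?B" "smooth_on ?B G" for x v G
    by (rule continuous_on_compose2[OF smooth_on_imp_continuous_on[OF sm_a[OF that(2)]]])
       (use seg[OF that(1)] in \<open>auto intro!: continuous_intros\<close>)
  have delta: "norm (F (Suc n) x - F n x) \<le> c / 4 ^ n" if "x \<in> ?B" for n x
    using that
  proof (induction n arbitrary: x)
    case 0
    have "norm (radial_primitive x0 (\<lambda>y v. A y v (F 0 y)) x) \<le> c * (1 - 0)"
      unfolding radial_primitive_def
    proof (rule integral_bound)
      fix t :: real assume t: "t \<in> {0..1}"
      have "norm (A (x0 + t *\<^sub>R (x - x0)) (x - x0) F0) \<le> M * norm (x - x0) * norm F0"
        by (rule Mb[OF seg[OF 0 t]])
      also have "\<dots> \<le> M * r * norm F0" using M(1) z[OF 0] by (intro mult_right_mono mult_left_mono) auto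
      also have "\<dots> \<le> 1 * norm F0" using r(3) by (intro mult_right_mono) auto
      finally show "norm (A (x0 + t *\<^sub>R (x - x0)) (x - x0) (F 0 (x0 + t *\<^sub>R (x - x0)))) \<le> c"
        by (simp add: F_0 c_def)
    qed (use cont[OF 0 sF] in auto)
    then show ?case by (simp add: F_Suc F_0)
  next
    case (Suc n)
    let ?y = "\<lambda>t. x0 + t *\<^sub>R (x - x0)"
    have "F (Suc (Suc n)) x - F (Suc n) x = integral {0..1} (\<lambda>t. A (?y t) (x - x0) (F (Suc n) (?y t))) -
      integral {0..1} (\<lambda>t. A (?y t) (x - x0) (F n (?y t)))"
      by (simp only: F_Suc[of "Suc n"] F_Suc[of n] radial_primitive_def add_diff_cancel_left)
    also have "\<dots> = integral {0..1} (\<lambda>t. A (?y t) (x - x0) (F (Suc n) (?y t)) - A (?y t) (x - x0) (F n (?y t)))"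
      by (rule integral_diff[symmetric]) (intro integrable_continuous_interval cont Suc sF)+
    also have "norm \<dots> \<le> c / 4 ^ Suc n * (1 - 0)"
    proof (rule integral_bound)
      fix t :: real assume t: "t \<in> {0..1}"
      have yS: "?y t \<in> S" using seg[OF Suc.prems t] BS by auto
      have "norm (A (?y t) (x - x0) (F (Suc n) (?y t)) - A (?y t) (x - x0) (F n (?y t))) =
        norm (A (?y t) (x - x0) (F (Suc n) (?y t) - F n (?y t)))"
        by (simp add: linear_diff[OF lin2[OF yS]])
      also have "\<dots> \<le> M * norm (x - x0) * norm (F (Suc n) (?y t) - F n (?y t))"
        by (rule Mb[OF seg[OF Suc.prems t]])
      also have "\<dots> \<le> M * r * (c / 4 ^ n)" using M(1) z[OF Suc.prems] r(1) Suc.IH[OF seg[OF Suc.prems t]]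
        by (intro mult_mono mult_left_mono) auto
      also have "\<dots> \<le> 1/8 * (c / 4 ^ n)" using r(3) \<open>c \<ge> 0\<close> by (intro mult_right_mono) auto
      also have "\<dots> \<le> c / 4 ^ Suc n" using \<open>c \<ge> 0\<close> by (simp add: field_simps)
      finally show "norm (A (?y t) (x - x0) (F (Suc n) (?y t)) - A (?y t) (x - x0) (F n (?y t))) \<le> c / 4 ^ Suc n" .
    qed (auto intro!: continuous_on_diff cont[OF Suc.prems sF])
    finally show ?case by simp
  qed
  \<comment> \<open>Chosen so that the increment contributes \<open>C / 4 ^ n / 4\<close> to the
    next defect. The integral term contributes another quarter of \<open>C / 2 ^ n\<close>, so the
    defect is at least halved in each round.\<close>
  define C where "C = 4 * M * c"
  have "C \<ge> 0" using M(1) \<open>c \<ge> 0\<close> by (simp add: C_def)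
  have defect: "norm (dd (F n) x v - A x v (F n x)) \<le> C / 2 ^ n * norm v" if "x \<in> ?B" for n x v
    using that
  proof (induction n arbitrary: x v)
    case 0
    have "norm (A x v F0) \<le> M * norm v * norm F0" by (rule Mb[OF 0])
    also have "\<dots> \<le> 4 * (M * norm v * norm F0)" using M(1) by simp
    finally show ?case by (simp add: F_0 frechet_derivative_const C_def c_def mult_ac)
  next
    case (Suc n)
    let ?y = "\<lambda>t. x0 + t *\<^sub>R (x - x0)" and ?z = "x - x0"
    let ?E = "\<lambda>y v. dd (F n) y v - A y v (F n y)"
    have dF: "(F n has_derivative dd (F n) y) (at y)" if "y \<in> ?B" for y
      by (rule smooth_on_has_derivative[OF sF that])
    have ext: "dd (\<lambda>y. A y v (F n y)) y u - dd (\<lambda>y. A y u (F n y)) y v = A y v (?E y u) - A y u (?E y v)"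
      if y: "y \<in> ?B" for y u v
    proof -
      have yS: "y \<in> S" using y BS by auto
      \<comment> \<open>\<open>y'\<close> is a frozen copy of \<open>y\<close>: inside the
        abstraction the name \<open>y\<close> would be captured by the variable of
        differentiation.\<close>
      have "dd (\<lambda>y. A y v (F n y)) y = (\<lambda>t. dd (\<lambda>y. A y v (F n y')) y t + A y v (dd (F n) y t))" if "y' = y" for v y'
        unfolding that
        by (rule frechet_derivative_eqI[OF has_derivative_linear_family(1)[OF open_ball y _ _ dF[OF y]]])
           (use BS lin2 y smooth_on_imp_differentiable[OF smooth yS] in auto)
      then show ?thesis
        using integrable[OF yS, of v "F n y" u] by (simp add: linear_diff[OF lin2[OF yS]] algebra_simps)
    qed
    let ?I = "integral {0..1} (\<lambda>t. t *\<^sub>R (dd (\<lambda>y. A y v (F n y)) (?y t) ?z - dd (\<lambda>y. A y ?z (F n y)) (?y t) v))"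
    have "(F (Suc n) has_derivative (\<lambda>v. 0 + (A x v (F n x) - integral {0..1} (\<lambda>t. t *\<^sub>R (dd (\<lambda>y. A y v (F n y)) (?y t) ?z -
        dd (\<lambda>y. A y ?z (F n y)) (?y t) v))))) (at x)"
      unfolding F_Suc
      by (intro has_derivative_add has_derivative_const has_derivative_radial_primitive[OF lin_a sm_a[OF sF] Suc.prems])
    then have "dd (F (Suc n)) x v = A x v (F n x) - ?I"
      by (simp add: frechet_derivative_eqI)
    then have eq: "dd (F (Suc n)) x v - A x v (F (Suc n) x) = - A x v (F (Suc n) x - F n x) - ?I"
      by (simp only: linear_diff[OF lin2[OF subsetD[OF BS Suc.prems]]]) simp
    have "norm (dd (F (Suc n)) x v - A x v (F (Suc n) x)) \<le> norm (A x v (F (Suc n) x - F n x)) + norm ?I"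
      unfolding eq using norm_triangle_ineq4[of "- A x v (F (Suc n) x - F n x)" ?I] by (simp only: norm_minus_cancel)
    also have "\<dots> \<le> M * norm v * (c / 4 ^ n) + (C / 2 ^ n * norm v / 4) * (1 - 0)"
    proof (rule add_mono)
      show "norm (A x v (F (Suc n) x - F n x)) \<le> M * norm v * (c / 4 ^ n)"
        by (rule order_trans[OF Mb[OF Suc.prems] mult_left_mono[OF delta[OF Suc.prems]]]) (use M(1) in simp)
      show "norm ?I \<le> (C / 2 ^ n * norm v / 4) * (1 - 0)"
      proof (rule integral_bound[OF _ continuous_on_radial_defect[OF lin_a sm_a[OF sF] Suc.prems]])
        fix t :: real assume t: "t \<in> {0..1}"
        have y: "?y t \<in> ?B" by (rule seg[OF Suc.prems t])
        let ?e = "C / 2 ^ n"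
        have e: "?e \<ge> 0" using \<open>C \<ge> 0\<close> by simp
        have z': "norm ?z \<le> r" by (rule z[OF Suc.prems])
        have "norm (t *\<^sub>R (A (?y t) v (?E (?y t) ?z) - A (?y t) ?z (?E (?y t) v))) \<le>
          norm (A (?y t) v (?E (?y t) ?z)) + norm (A (?y t) ?z (?E (?y t) v))"
          using t norm_triangle_ineq4[of "A (?y t) v (?E (?y t) ?z)" "A (?y t) ?z (?E (?y t) v)"]
           mult_left_le_one_le[of "norm (A (?y t) v (?E (?y t) ?z) - A (?y t) ?z (?E (?y t) v))" t] by simp
        also have "\<dots> \<le> M * norm v * (?e * norm ?z) + M * norm ?z * (?e * norm v)"
          using M(1) by (intro add_mono order_trans[OF Mb[OF y]] mult_left_mono Suc.IH[OF y]) auto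
        also have "\<dots> = 2 * ((M * norm ?z) * (?e * norm v))" by simp
        also have "\<dots> \<le> 2 * ((1/8) * (?e * norm v))"
        proof -
          have "M * norm ?z \<le> 1/8" using mult_left_mono[OF z', of M] M(1) r(3) by linarith
          then show ?thesis using e by (intro mult_left_mono mult_right_mono mult_nonneg_nonneg) auto
        qed
        finally show "norm (t *\<^sub>R (dd (\<lambda>y. A y v (F n y)) (?y t) ?z - dd (\<lambda>y. A y ?z (F n y)) (?y t) v)) \<le> ?e * norm v / 4"
          unfolding ext[OF y] by simp
      qed simp
    qed
    also have "\<dots> \<le> C / 2 ^ Suc n * norm v"
    proof -
      have "(2::real) ^ n \<le> 4 ^ n" by (rule power_mono) auto
      then have "C / 4 ^ n \<le> C / 2 ^ n" using \<open>C \<ge> 0\<close> by (intro divide_left_mono) auto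
      then have "C / 4 ^ n * norm v \<le> C / 2 ^ n * norm v" by (intro mult_right_mono) auto
      moreover have "M * norm v * (c / 4 ^ n) = (C / 4 ^ n * norm v) / 4" by (simp add: C_def)
      ultimately show ?thesis by simp
    qed
    finally show ?case .
  qed
  define Flim where "Flim x = lim (\<lambda>n. F n x)" for x
  have lim: "(\<lambda>n. F n x) \<longlonglongrightarrow> Flim x" and lim_bound: "norm (F n x - Flim x) \<le> 2 * c / 4 ^ n" if x: "x \<in> ?B" for x n
  proof -
    obtain l where "(\<lambda>n. F n x) \<longlonglongrightarrow> l" "\<And>n. norm (F n x - l) \<le> 2 * c / 4 ^ n"
      using geometric_limit[of "\<lambda>n. F n x" c] delta[OF x] \<open>c \<ge> 0\<close> by blast
    moreover from this(1) have "Flim x = l" unfolding Flim_def by (rule limI)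
    ultimately show "(\<lambda>n. F n x) \<longlonglongrightarrow> Flim x" "norm (F n x - Flim x) \<le> 2 * c / 4 ^ n" by auto
  qed
  have x0B: "x0 \<in> ?B" using r(1) by simp
  \<comment> \<open>The derivatives of the iterates converge uniformly to \<open>A\<close> applied
    to the limit: the defect decays like \<open>1 / 2 ^ n\<close> and the distance to the limit like
    \<open>1 / 4 ^ n\<close>.\<close>
  have "\<exists>g. \<forall>x\<in>?B. (\<lambda>n. F n x) \<longlonglongrightarrow> g x \<and> (g has_derivative (\<lambda>v. A x v (Flim x))) (at x within ?B)"
  proof (rule has_derivative_sequence[where f=F and f'="\<lambda>n. dd (F n)" and g'="\<lambda>x v. A x v (Flim x)", OF convex_ball _ _ x0B lim[OF x0B]])
    show "(F n has_derivative dd (F n) x) (at x within ?B)" if "x \<in> ?B" for n x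
      by (rule has_derivative_at_withinI[OF smooth_on_has_derivative[OF sF that]])
    fix e :: real assume e: "e > 0"
    have "(\<lambda>n. C * (1/2) ^ n + M * (2 * c * (1/4) ^ n)) \<longlonglongrightarrow> C * 0 + M * (2 * c * 0)"
      by (intro tendsto_intros LIMSEQ_power_zero) auto
    then have "\<forall>\<^sub>F n in sequentially. C * (1/2) ^ n + M * (2 * c * (1/4) ^ n) < e"
      using e by (intro order_tendstoD) auto
    then show "\<forall>\<^sub>F n in sequentially. \<forall>x\<in>?B. \<forall>h. norm (dd (F n) x h - A x h (Flim x)) \<le> e * norm h"
    proof eventually_elim
      case (elim n)
      show ?case
      proof (intro ballI allI)
        fix x h assume x: "x \<in> ?B"
        have "dd (F n) x h - A x h (Flim x) = (dd (F n) x h - A x h (F n x)) + A x h (F n x - Flim x)"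
          by (simp only: linear_diff[OF lin2[OF subsetD[OF BS x]]]) simp
        also have "norm \<dots> \<le> C / 2 ^ n * norm h + M * norm h * (2 * c / 4 ^ n)"
          using M(1) by (intro norm_triangle_mono defect[OF x] order_trans[OF Mb[OF x]] mult_left_mono lim_bound[OF x]) auto
        also have "\<dots> = (C * (1/2) ^ n + M * (2 * c * (1/4) ^ n)) * norm h"
          by (simp add: power_divide algebra_simps)
        also have "\<dots> \<le> e * norm h" using elim by (intro mult_right_mono) auto
        finally show "norm (dd (F n) x h - A x h (Flim x)) \<le> e * norm h" .
      qed
    qed
  qed
  then obtain g where g: "\<And>x. x \<in> ?B \<Longrightarrow> (\<lambda>n. F n x) \<longlonglongrightarrow> g x"
    "\<And>x. x \<in> ?B \<Longrightarrow> (g has_derivative (\<lambda>v. A x v (Flim x))) (at x within ?B)" by blast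
  have gF: "g x = Flim x" if "x \<in> ?B" for x using LIMSEQ_unique[OF g(1)[OF that] lim[OF that]] .
  have dg: "(g has_derivative (\<lambda>v. A x v (g x))) (at x)" if "x \<in> ?B" for x
    using g(2)[OF that] that by (simp add: at_within_open[of _ ?B] gF)
  \<comment> \<open>Bootstrapping: the equation expresses the derivative of \<open>g\<close> through
    \<open>g\<close> itself, so each order yields the next.\<close>
  have "Ck_on k ?B g" for k
  proof (induction k)
    case 0
    then show ?case using has_derivative_continuous[OF dg] by (simp add: continuous_at_imp_continuous_on)
  next
    case (Suc k)
    show ?case
    proof (rule Ck_on_SucI[OF open_ball dg])
      show "Ck_on k ?B (\<lambda>x. A x v (g x))" for v
        using smooth_on_subset[OF smooth BS]
        by (intro Ck_on_linear_family[OF open_ball lin2 _ Suc]) (use BS in \<open>auto simp: smooth_on_def\<close>)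
    qed
  qed
  moreover have "g x0 = F0" using g(1)[OF x0B] LIMSEQ_unique[OF _ tendsto_const] by (simp add: F_x0 LIMSEQ_const_iff)
  ultimately show thesis using that[OF r(1) BS, of g] dg by (simp add: smooth_on_def)
qed

section \<open>Conformal flatness of products of surfaces\<close>

context local_surface
begin

text \<open>The overdetermined system \<open>Hess f = - k f h\<close> is a total differential equation for \<open>f\<close> together
  with its gradient \<open>N\<close>; its integrability condition is that the Gauss curvature equals \<open>k\<close>.\<close>

lemma constant_curvature_hessian_solution:
  assumes k: "\<And>x. x \<in> S \<Longrightarrow> gauss h x = k" and x0: "x0 \<in> S"
  obtains r f N where "r > 0" "ball x0 r \<subseteq> S" "smooth_on (ball x0 r) f" "smooth_on (ball x0 r) N"
    "\<And>x. x \<in> ball x0 r \<Longrightarrow> f x > 0" "\<And>x w. x \<in> ball x0 r \<Longrightarrow> h x (N x) w = dd f x w"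
    "\<And>x u. x \<in> ball x0 r \<Longrightarrow> dd N x u + G x u (N x) = - (k * f x) *\<^sub>R u"
    "\<And>x. x \<in> ball x0 r \<Longrightarrow> h x (N x) (N x) = k - k * (f x)\<^sup>2"
proof -
  \<comment> \<open>The unknown is the pair of \<open>f\<close> and \<open>N\<close>. The first
    component says that \<open>N\<close> is the gradient of \<open>f\<close>, the second that the
    covariant derivative of \<open>N\<close> is \<open>- k * f\<close> times the identity.\<close>
  define A where "A y v F = (h y v (snd F), - G y v (snd F) - (k * fst F) *\<^sub>R v)" for y v and F :: "real \<times> (real^2)"
  have "\<exists>r F. r > 0 \<and> ball x0 r \<subseteq> S \<and> F x0 = (1, 0) \<and> smooth_on (ball x0 r) F \<and>
    (\<forall>x\<in>ball x0 r. (F has_derivative (\<lambda>v. A x v (F x))) (at x))"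
  proof (rule linear_frobenius[OF open_S x0, of A "(1, 0)"])
    show "linear (\<lambda>v. A y v F)" if "y \<in> S" for y F
      by (intro linearI) (simp_all add: A_def h_simps[OF that] G_simps[OF that] algebra_simps)
    show "linear (A y v)" if "y \<in> S" for y v
      by (intro linearI) (simp_all add: A_def h_simps[OF that] G_simps[OF that] algebra_simps)
    show "smooth_on S (\<lambda>y. A y v F)" for v F
      unfolding A_def
      by (intro smooth_on_Pair smooth_on_diff smooth_on_minus smooth_on_const open_S smooth smooth_levi_civita)
    fix y u v F assume y: "y \<in> S"
    have d: "dd (\<lambda>y. A y v F) y u = (dd (\<lambda>y. h y v (snd F)) y u, - dd (\<lambda>y. G y v (snd F)) y u)" for u v
    proof -
      have "((\<lambda>y. A y v F) has_derivative (\<lambda>u. (dd (\<lambda>y. h y v (snd F)) y u, - dd (\<lambda>y. G y v (snd F)) y u - 0))) (at y)"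
        unfolding A_def
        by (intro has_derivative_Pair has_derivative_diff has_derivative_minus has_derivative_const dh[OF y] dG[OF y])
      from frechet_derivative_eqI[OF this] show ?thesis by simp
    qed
    have "dd (\<lambda>y. G y v (snd F)) y u - dd (\<lambda>y. G y u (snd F)) y v + G y u (G y v (snd F)) - G y v (G y u (snd F)) =
      k *\<^sub>R (h y v (snd F) *\<^sub>R u - h y u (snd F) *\<^sub>R v)"
      using curvature_eq_gauss[OF y, of u v "snd F"] k[OF y] by (simp add: curvature_def)
    then have c: "dd (\<lambda>y. G y v (snd F)) y u = dd (\<lambda>y. G y u (snd F)) y v - G y u (G y v (snd F)) + G y v (G y u (snd F)) +
      k *\<^sub>R (h y v (snd F) *\<^sub>R u - h y u (snd F) *\<^sub>R v)" by (simp add: algebra_simps)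
    show "dd (\<lambda>y. A y v F) y u + A y v (A y u F) = dd (\<lambda>y. A y u F) y v + A y u (A y v F)"
      unfolding d compat[OF y] unfolding c unfolding A_def levi_civita_sym[OF y, of v u]
      by (simp add: h_simps[OF y] G_simps[OF y] sym[OF y, of v u] algebra_simps levi_civita_sym[OF y, of v u])
  qed blast
  then obtain r F where r: "r > 0" "ball x0 r \<subseteq> S" and F: "F x0 = (1, 0)" "smooth_on (ball x0 r) F"
    "\<And>x. x \<in> ball x0 r \<Longrightarrow> (F has_derivative (\<lambda>v. A x v (F x))) (at x)" by blast
  define f N where "f = (\<lambda>x. fst (F x))" and "N = (\<lambda>x. snd (F x))"
  have sf: "smooth_on (ball x0 r) f" "smooth_on (ball x0 r) N"
    unfolding f_def N_def by (intro smooth_on_fst smooth_on_snd open_ball F)+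
  have df: "(f has_derivative (\<lambda>v. h x v (N x))) (at x)" if "x \<in> ball x0 r" for x
    using has_derivative_fst[OF F(3)[OF that]] by (simp add: f_def N_def A_def)
  have dN: "(N has_derivative (\<lambda>v. - G x v (N x) - (k * f x) *\<^sub>R v)) (at x)" if "x \<in> ball x0 r" for x
    using has_derivative_snd[OF F(3)[OF that]] by (simp add: f_def N_def A_def)
  have grad: "h x (N x) w = dd f x w" if "x \<in> ball x0 r" for x w
    using frechet_derivative_eqI[OF df[OF that]] sym that r by auto
  have hess: "dd N x u + G x u (N x) = - (k * f x) *\<^sub>R u" if "x \<in> ball x0 r" for x u
    using frechet_derivative_eqI[OF dN[OF that]] by simp
  have x0B: "x0 \<in> ball x0 r" using r(1) by simp
  \<comment> \<open>A first integral of the system: the derivative of \<open>h x (N x) (N x)\<close>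
    is cancelled by that of \<open>k * f * f\<close>. Its value at \<open>x0\<close> is
    \<open>k\<close>, as \<open>f = 1\<close> and \<open>N = 0\<close> there.\<close>
  have energy: "h x (N x) (N x) = k - k * (f x)\<^sup>2" if x: "x \<in> ball x0 r" for x
  proof -
    let ?e = "\<lambda>x. h x (N x) (N x) + k * (f x * f x)"
    have "(?e has_derivative (\<lambda>h. 0)) (at y within ball x0 r)" if y: "y \<in> ball x0 r" for y
    proof -
      have yS: "y \<in> S" using y r by auto
      have d1: "((\<lambda>x. h x (N x) (N x)) has_derivative (\<lambda>t. - 2 * k * f y * h y t (N y))) (at y)"
        using has_derivative_metric[OF yS dN[OF y] dN[OF y]]
        by (simp add: h_simps[OF yS] sym[OF yS, of "N y"] mult.assoc)
      have d2: "((\<lambda>x. k * (f x * f x)) has_derivative (\<lambda>t. k * (f y * h y t (N y) + h y t (N y) * f y))) (at y)"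
        using has_derivative_mult_right[OF has_derivative_mult[OF df[OF y] df[OF y]], of k] .
      have "(?e has_derivative (\<lambda>t. 0)) (at y)"
        using has_derivative_add[OF d1 d2] by (simp add: mult_ac)
      then show ?thesis by (rule has_derivative_at_withinI)
    qed
    from has_derivative_zero_constant[OF convex_ball this]
    obtain c where c: "\<And>y. y \<in> ball x0 r \<Longrightarrow> ?e y = c" by auto
    have "?e x0 = k" using h_simps(9)[OF x0] F(1) by (simp add: f_def N_def)
    then show ?thesis using c[OF x] c[OF x0B] by (simp add: power2_eq_square)
  qed
  \<comment> \<open>The radius is shrunk once more so that \<open>f\<close>, which is 1 at the
    centre, stays positive; a conformal factor is built from it.\<close>
  have "isCont f x0" using has_derivative_continuous[OF df[OF x0B]] .
  then have "f \<midarrow>x0\<rightarrow> 1" using F(1) by (simp add: isCont_def f_def)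
  then have "\<forall>\<^sub>F x in at x0. f x > 0" by (rule order_tendstoD) simp
  then obtain d where d: "d > 0" "\<And>x. x \<noteq> x0 \<Longrightarrow> dist x x0 < d \<Longrightarrow> f x > 0"
    unfolding eventually_at by blast
  have pos: "f x > 0" if "x \<in> ball x0 (min d r)" for x
    using d(2)[of x] that F(1) by (cases "x = x0") (auto simp: f_def dist_commute)
  show thesis
  proof (rule that[of "min d r" f N])
    show "min d r > 0" using d(1) r(1) by simp
    show "ball x0 (min d r) \<subseteq> S" using r(2) by auto
    show "smooth_on (ball x0 (min d r)) f" "smooth_on (ball x0 (min d r)) N"
      by (rule smooth_on_subset[OF sf(1)] smooth_on_subset[OF sf(2)]; auto)+
  qed (use pos grad hess energy in auto)
qed

lemma orthogonal_pair:
  assumes "x \<in> S"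
  obtains e f where "e \<noteq> 0" "f \<noteq> 0" "h x e f = 0"
proof (rule that)
  let ?z = "h x e1 e1 *\<^sub>R e2 - h x e1 e2 *\<^sub>R e1"
  have p: "h x e1 e1 > 0" by (rule pos[OF assms]) simp
  show "e1 \<noteq> 0" by simp
  show "?z \<noteq> 0"
  proof
    assume "?z = 0"
    then have "?z $ 2 = 0" by simp
    then show False using p by (simp add: axis_def)
  qed
  show "h x e1 ?z = 0" by (simp add: h_simps[OF assms])
qed

end

text \<open>The relation between the constants makes the Hessian of \<open>f1 + f2\<close> act as
  \<open>- k1 * f1\<close> on the first plane and as \<open>k1 * f2\<close> on the second, and the
  squared gradient equal to \<open>k1 * (f2^2 - f1^2)\<close>. Dividing by the sum leaves
  \<open>f2 - f1\<close>, and every term of the conformal curvature formula cancels.\<close>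

lemma constant_curvature_product_conformally_flat:
  assumes s1: "local_surface S g1" and s2: "local_surface T g2" and p: "p \<in> S" "q \<in> T"
    and k1: "\<And>x. x \<in> S \<Longrightarrow> gauss g1 x = k1" and k2: "\<And>y. y \<in> T \<Longrightarrow> gauss g2 y = k2"
    and \<epsilon>: "\<epsilon> \<in> {1, -1::real}" and k: "k1 = - \<epsilon> * k2"
  defines "h \<equiv> \<lambda>z u v. g1 (fst z) (fst u) (fst v) + \<epsilon> * g2 (snd z) (snd u) (snd v)"
  obtains U V \<phi> where "open U" "open V" "p \<in> U" "q \<in> V" "U \<subseteq> S" "V \<subseteq> T" "smooth_on (U \<times> V) \<phi>"
    "\<And>z. z \<in> U \<times> V \<Longrightarrow> \<phi> z > 0"
    "\<And>z u v w. z \<in> U \<times> V \<Longrightarrow> curvature (\<lambda>y u v. (inverse (\<phi> y))\<^sup>2 * h y u v) z u v w = 0"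
proof -
  interpret A: local_surface S g1 by fact
  interpret B: local_surface T g2 by fact
  obtain r1 f1 N1 where 1: "r1 > 0" "ball p r1 \<subseteq> S" "smooth_on (ball p r1) f1" "smooth_on (ball p r1) N1"
    "\<And>x. x \<in> ball p r1 \<Longrightarrow> f1 x > 0" "\<And>x w. x \<in> ball p r1 \<Longrightarrow> g1 x (N1 x) w = dd f1 x w"
    "\<And>x u. x \<in> ball p r1 \<Longrightarrow> dd N1 x u + A.G x u (N1 x) = - (k1 * f1 x) *\<^sub>R u"
    "\<And>x. x \<in> ball p r1 \<Longrightarrow> g1 x (N1 x) (N1 x) = k1 - k1 * (f1 x)\<^sup>2"
    using A.constant_curvature_hessian_solution[OF k1 p(1)] by metis
  obtain r2 f2 N2 where 2: "r2 > 0" "ball q r2 \<subseteq> T" "smooth_on (ball q r2) f2" "smooth_on (ball q r2) N2"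
    "\<And>x. x \<in> ball q r2 \<Longrightarrow> f2 x > 0" "\<And>x w. x \<in> ball q r2 \<Longrightarrow> g2 x (N2 x) w = dd f2 x w"
    "\<And>x u. x \<in> ball q r2 \<Longrightarrow> dd N2 x u + B.G x u (N2 x) = - (k2 * f2 x) *\<^sub>R u"
    "\<And>x. x \<in> ball q r2 \<Longrightarrow> g2 x (N2 x) (N2 x) = k2 - k2 * (f2 x)\<^sup>2"
    using B.constant_curvature_hessian_solution[OF k2 p(2)] by metis
  let ?U = "ball p r1" and ?V = "ball q r2"
  have o: "open (?U \<times> ?V)" by (intro open_Times open_ball)
  have e: "\<epsilon> \<noteq> 0" "\<epsilon> * \<epsilon> = 1" using \<epsilon> by auto
  have lm1: "local_metric ?U g1" by (rule local_metric_subset[OF A.local_metric_axioms open_ball 1(2)])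
  have lm2: "local_metric ?V g2" by (rule local_metric_subset[OF B.local_metric_axioms open_ball 2(2)])
  interpret P: local_metric "?U \<times> ?V" h
    unfolding h_def by (rule local_metric_product[OF lm1 lm2 e(1)])
  define \<phi> where "\<phi> z = f1 (fst z) + f2 (snd z)" for z
  \<comment> \<open>The gradient of \<phi> for the product metric. On the second factor the index is
    raised with \<epsilon> times \<open>g2\<close>, and \<epsilon> is its own inverse.\<close>
  define N where "N z = (N1 (fst z), \<epsilon> *\<^sub>R N2 (snd z))" for z
  have s\<phi>: "smooth_on (?U \<times> ?V) \<phi>"
    unfolding \<phi>_def
    by (intro smooth_on_add o smooth_on_compose[OF o open_ball _ smooth_on_bounded_linear[OF o bounded_linear_fst] 1(3)]
       smooth_on_compose[OF o open_ball _ smooth_on_bounded_linear[OF o bounded_linear_snd] 2(3)]) auto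
  have \<phi>_pos: "\<phi> z > 0" if "z \<in> ?U \<times> ?V" for z
    using that 1(5)[of "fst z"] 2(5)[of "snd z"] by (auto simp: \<phi>_def intro: add_pos_pos)
  have d\<phi>: "dd \<phi> z w = dd f1 (fst z) (fst w) + dd f2 (snd z) (snd w)" if "z \<in> ?U \<times> ?V" for z w
  proof -
    have "fst z \<in> ?U" "snd z \<in> ?V" using that by auto
    then have "(\<phi> has_derivative (\<lambda>w. dd f1 (fst z) (fst w) + dd f2 (snd z) (snd w))) (at z)"
      unfolding \<phi>_def
      by (intro has_derivative_add
         has_derivative_compose[OF has_derivative_fst[OF has_derivative_ident] smooth_on_has_derivative[OF 1(3)]]
         has_derivative_compose[OF has_derivative_snd[OF has_derivative_ident] smooth_on_has_derivative[OF 2(3)]])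
    from frechet_derivative_eqI[OF this] show ?thesis by simp
  qed
  have grad: "h z (N z) w = dd \<phi> z w" if "z \<in> ?U \<times> ?V" for z w
    using that lm2[THEN local_metric.h_simps(5)] e(2)
    by (auto simp: d\<phi> h_def N_def 1(6) 2(6) mult.assoc[symmetric])
  have hess: "dd N z u + P.G z u (N z) = (- (k1 * f1 (fst z)) *\<^sub>R fst u, (k1 * f2 (snd z)) *\<^sub>R snd u)"
    if z: "z \<in> ?U \<times> ?V" for z u
  proof -
    have z1: "fst z \<in> ?U" and z2: "snd z \<in> ?V" using that by auto
    have "(N has_derivative (\<lambda>w. (dd N1 (fst z) (fst w), \<epsilon> *\<^sub>R dd N2 (snd z) (snd w)))) (at z)"
      unfolding N_def
      by (intro has_derivative_Pair has_derivative_scaleR_right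
         has_derivative_compose[OF has_derivative_fst[OF has_derivative_ident] smooth_on_has_derivative[OF 1(4) z1]]
         has_derivative_compose[OF has_derivative_snd[OF has_derivative_ident] smooth_on_has_derivative[OF 2(4) z2]])
    moreover have "P.G z u (N z) = (A.G (fst z) (fst u) (N1 (fst z)), \<epsilon> *\<^sub>R B.G (snd z) (snd u) (N2 (snd z)))"
      using levi_civita_product[OF lm1 lm2 e(1) z, of u "N z"] local_metric.G_simps(6)[OF lm2 z2]
      by (simp add: h_def N_def)
    ultimately have "dd N z u + P.G z u (N z) = (dd N1 (fst z) (fst u) + A.G (fst z) (fst u) (N1 (fst z)),
      \<epsilon> *\<^sub>R (dd N2 (snd z) (snd u) + B.G (snd z) (snd u) (N2 (snd z))))"
      by (simp add: frechet_derivative_eqI scaleR_add_right)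
    also have "\<dots> = (- (k1 * f1 (fst z)) *\<^sub>R fst u, (k1 * f2 (snd z)) *\<^sub>R snd u)"
      unfolding 1(7)[OF z1] 2(7)[OF z2] k by simp
    finally show ?thesis .
  qed
  have "curvature (\<lambda>y u v. (inverse (\<phi> y))\<^sup>2 * h y u v) z u v w = 0" if z: "z \<in> ?U \<times> ?V" for z u v w
  proof -
    have z1: "fst z \<in> ?U" and z2: "snd z \<in> ?V" using that by auto
    have zS: "fst z \<in> S" and zT: "snd z \<in> T" using z1 z2 1(2) 2(2) by auto
    define \<psi> where "\<psi> = inverse (\<phi> z)"
    have \<psi>: "\<psi> * (f1 (fst z) + f2 (snd z)) = 1" using \<phi>_pos[OF z] by (simp add: \<psi>_def \<phi>_def)
    have m: "h z (N z) (N z) = k1 * ((f2 (snd z))\<^sup>2 - (f1 (fst z))\<^sup>2)"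
    proof -
      have "h z (N z) (N z) = g1 (fst z) (N1 (fst z)) (N1 (fst z)) + \<epsilon> * g2 (snd z) (N2 (snd z)) (N2 (snd z))"
        using e(2) by (simp add: h_def N_def B.h_simps[OF zT])
      then show ?thesis using 1(8)[OF z1] 2(8)[OF z2] k by (simp add: algebra_simps)
    qed
    have R: "curvature h z u v w =
       (k1 *\<^sub>R (g1 (fst z) (fst v) (fst w) *\<^sub>R fst u - g1 (fst z) (fst u) (fst w) *\<^sub>R fst v),
        k2 *\<^sub>R (g2 (snd z) (snd v) (snd w) *\<^sub>R snd u - g2 (snd z) (snd u) (snd w) *\<^sub>R snd v))"
      unfolding h_def curvature_product[OF lm1 lm2 e(1) z] A.curvature_eq_gauss[OF zS] B.curvature_eq_gauss[OF zT]
        k1[OF zS] k2[OF zT] ..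
    let ?P = "\<lambda>u. dd N z u + P.G z u (N z)"
    have formula: "curvature (\<lambda>y u v. (inverse (\<phi> y))\<^sup>2 * h y u v) z u v w = curvature h z u v w
      + \<psi> *\<^sub>R (h z (?P v) w *\<^sub>R u - h z (?P u) w *\<^sub>R v + h z v w *\<^sub>R ?P u - h z u w *\<^sub>R ?P v)
      - (\<psi>\<^sup>2 * h z (N z) (N z)) *\<^sub>R (h z v w *\<^sub>R u - h z u w *\<^sub>R v)"
      by (rule P.conformal_curvature[OF s\<phi> _ _ z refl \<psi>_def]) (fact \<phi>_pos grad)+
    let ?H = "\<lambda>v w. h z (- (k1 * f1 (fst z)) *\<^sub>R fst v, (k1 * f2 (snd z)) *\<^sub>R snd v) w"
    \<comment> \<open>Separates the vector identity into scalar coefficients of the components of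
      \<open>u\<close> and \<open>v\<close>; they come from just two expressions, \<open>?c1\<close>
      and \<open>?c2\<close>, one for each factor.\<close>
    have split: "(a *\<^sub>R (p *\<^sub>R fst u - q *\<^sub>R fst v), b *\<^sub>R (p' *\<^sub>R snd u - q' *\<^sub>R snd v)) +
        \<psi> *\<^sub>R (H *\<^sub>R u - H' *\<^sub>R v + l *\<^sub>R (x *\<^sub>R fst u, y *\<^sub>R snd u) - l' *\<^sub>R (x *\<^sub>R fst v, y *\<^sub>R snd v)) -
        m *\<^sub>R (l *\<^sub>R u - l' *\<^sub>R v) =
        ((a * p + \<psi> * (H + x * l) - m * l) *\<^sub>R fst u - (a * q + \<psi> * (H' + x * l') - m * l') *\<^sub>R fst v,
         (b * p' + \<psi> * (H + y * l) - m * l) *\<^sub>R snd u - (b * q' + \<psi> * (H' + y * l') - m * l') *\<^sub>R snd v)"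
      for a b p p' q q' \<psi> H H' l l' x y m and u v :: "(real^2) \<times> (real^2)"
      by (cases u; cases v) (simp add: algebra_simps)
    let ?c1 = "\<lambda>v w. k1 * g1 (fst z) (fst v) (fst w) + \<psi> * (?H v w + - (k1 * f1 (fst z)) * h z v w) - \<psi>\<^sup>2 * h z (N z) (N z) * h z v w"
    let ?c2 = "\<lambda>v w. k2 * g2 (snd z) (snd v) (snd w) + \<psi> * (?H v w + k1 * f2 (snd z) * h z v w) - \<psi>\<^sup>2 * h z (N z) (N z) * h z v w"
    have hz: "h z v w = g1 (fst z) (fst v) (fst w) + \<epsilon> * g2 (snd z) (snd v) (snd w)" for v w
      by (simp add: h_def)
    have H: "?H v w = - k1 * f1 (fst z) * g1 (fst z) (fst v) (fst w) + k1 * f2 (snd z) * (\<epsilon> * g2 (snd z) (snd v) (snd w))" for v w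
      by (simp add: h_def A.h_simps[OF zS] B.h_simps[OF zT])
    have k2': "k2 = - \<epsilon> * k1" using k e(2) by algebra
    have c1: "?c1 v w = 0" for v w
      unfolding m H hz[of v w] using \<psi> by algebra
    have c2: "?c2 v w = 0" for v w
      unfolding m H hz[of v w] k2' using \<psi> e(2) by algebra
    have "curvature (\<lambda>y u v. (inverse (\<phi> y))\<^sup>2 * h y u v) z u v w =
       (?c1 v w *\<^sub>R fst u - ?c1 u w *\<^sub>R fst v, ?c2 v w *\<^sub>R snd u - ?c2 u w *\<^sub>R snd v)"
      unfolding formula hess[OF z] R by (rule split)
    then show ?thesis unfolding c1 c2 by (simp add: zero_prod_def)
  qed
  then show thesis
    by (intro that[of ?U ?V \<phi>] open_ball 1(2) 2(2) s\<phi> \<phi>_pos) (use 1(1) 2(1) in auto)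
qed

text \<open>Flatness turns each sectional curvature of an orthogonal plane into one normalised
  Hessian entry per spanning vector plus a common gradient term. In the sum over two complementary
  planes every frame vector occurs once, however the four vectors are paired, so both sums agree
  although the factor is unknown.\<close>

lemma conformally_flat_product_curvature:
  assumes s1: "local_surface S g1" and s2: "local_surface T g2"
    and W: "open W" "W \<subseteq> S \<times> T" "z \<in> W"
    and \<epsilon>: "\<epsilon> \<in> {1, -1::real}" and \<phi>: "smooth_on W \<phi>" "\<And>z. z \<in> W \<Longrightarrow> \<phi> z > 0"
    and flat: "\<And>u v w. curvature (\<lambda>y u v. (inverse (\<phi> y))\<^sup>2 *
      (g1 (fst y) (fst u) (fst v) + \<epsilon> * g2 (snd y) (snd u) (snd v))) z u v w = 0"
  shows "gauss g1 (fst z) = - \<epsilon> * gauss g2 (snd z)"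
proof -
  interpret A: local_surface S g1 by fact
  interpret B: local_surface T g2 by fact
  define h where "h = (\<lambda>z u v. g1 (fst z) (fst u) (fst v) + \<epsilon> * g2 (snd z) (snd u) (snd v))"
  have e: "\<epsilon> \<noteq> 0" "\<epsilon> * \<epsilon> = 1" using \<epsilon> by auto
  have zST: "z \<in> S \<times> T" and zS: "fst z \<in> S" and zT: "snd z \<in> T" using W by auto
  have lm: "local_metric (S \<times> T) h"
    unfolding h_def by (rule local_metric_product[OF A.local_metric_axioms B.local_metric_axioms e(1)])
  interpret P: local_metric W h by (rule local_metric_subset[OF lm W(1,2)])
  have "\<exists>n. \<forall>w. h y n w = dd \<phi> y w" if "y \<in> W" for y
    using P.ex_sharp[OF that has_derivative_linear[OF smooth_on_has_derivative[OF \<phi>(1) that]]] by metis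
  then obtain N where N: "\<And>y w. y \<in> W \<Longrightarrow> h y (N y) w = dd \<phi> y w" by metis
  define P where "P = (\<lambda>u. dd N z u + P.G z u (N z))"
  define \<psi> where "\<psi> = inverse (\<phi> z)"
  have formula: "curvature h z u v w =
    - \<psi> *\<^sub>R (h z (P v) w *\<^sub>R u - h z (P u) w *\<^sub>R v + h z v w *\<^sub>R P u - h z u w *\<^sub>R P v)
    + (\<psi>\<^sup>2 * h z (N z) (N z)) *\<^sub>R (h z v w *\<^sub>R u - h z u w *\<^sub>R v)" for u v w
  proof -
    have c0: "curvature (\<lambda>y u v. (inverse (\<phi> y))\<^sup>2 * h y u v) z u v w = 0"
      using flat[of u v w] by (simp only: h_def)
    have r: "R = - \<psi> *\<^sub>R X + Y" if "0 = R + \<psi> *\<^sub>R X - Y" for R X Y :: "(real^2) \<times> (real^2)"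
      using that by (simp add: algebra_simps)
    show ?thesis
      by (rule r) (use P.conformal_curvature[OF \<phi> N W(3) P_def \<psi>_def, of u v w] c0 in simp)
  qed
  note hs = P.h_simps[OF W(3)]
  let ?K = "\<lambda>u v. h z (curvature h z u v v) u / (h z u u * h z v v)"
  have K: "?K u v = - \<psi> * (h z (P v) v / h z v v + h z (P u) u / h z u u) + \<psi>\<^sup>2 * h z (N z) (N z)"
    if "h z u v = 0" "h z u u \<noteq> 0" "h z v v \<noteq> 0" for u v
    unfolding formula using that P.sym[OF W(3), of v u] by (simp add: hs field_simps)
  have R: "curvature h z u v w = (gauss g1 (fst z) *\<^sub>R (g1 (fst z) (fst v) (fst w) *\<^sub>R fst u - g1 (fst z) (fst u) (fst w) *\<^sub>R fst v),
        gauss g2 (snd z) *\<^sub>R (g2 (snd z) (snd v) (snd w) *\<^sub>R snd u - g2 (snd z) (snd u) (snd w) *\<^sub>R snd v))" for u v w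
    unfolding h_def curvature_product[OF A.local_metric_axioms B.local_metric_axioms e(1) zST]
      A.curvature_eq_gauss[OF zS] B.curvature_eq_gauss[OF zT] ..
  obtain a b where ab: "a \<noteq> 0" "b \<noteq> 0" "g1 (fst z) a b = 0" using A.orthogonal_pair[OF zS] .
  obtain c d where cd: "c \<noteq> 0" "d \<noteq> 0" "g2 (snd z) c d = 0" using B.orthogonal_pair[OF zT] .
  note ap = A.pos[OF zS ab(1)] A.pos[OF zS ab(2)] B.pos[OF zT cd(1)] B.pos[OF zT cd(2)]
  note g0 = A.h_simps[OF zS] B.h_simps[OF zT]
  have nz: "h z (a, 0) (a, 0) \<noteq> 0" "h z (b, 0) (b, 0) \<noteq> 0" "h z (0, c) (0, c) \<noteq> 0" "h z (0, d) (0, d) \<noteq> 0"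
    using ap e(1) by (auto simp: h_def g0)
  have orth: "h z (a, 0) (b, 0) = 0" "h z (0, c) (0, d) = 0" "h z (a, 0) (0, c) = 0" "h z (b, 0) (0, d) = 0"
    using ab cd by (auto simp: h_def g0)
  have "?K (a, 0) (b, 0) + ?K (0, c) (0, d) = ?K (a, 0) (0, c) + ?K (b, 0) (0, d)"
    unfolding K[OF orth(1) nz(1,2)] K[OF orth(2) nz(3,4)] K[OF orth(3) nz(1,3)] K[OF orth(4) nz(2,4)]
    by (simp add: algebra_simps)
  moreover have "?K (a, 0) (0, c) = 0" "?K (b, 0) (0, d) = 0"
    unfolding R by (simp_all add: h_def g0)
  moreover have "?K (a, 0) (b, 0) = gauss g1 (fst z)"
    unfolding R using ab ap by (simp add: h_def g0)
  \<comment> \<open>On the second factor the metric is \<epsilon> times \<open>g2\<close>; its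
    sectional curvature is that of \<open>g2\<close> divided by \<epsilon>, which is the same as
    multiplied by \<epsilon>.\<close>
  moreover have "?K (0, c) (0, d) = \<epsilon> * gauss g2 (snd z)"
    unfolding R using cd ap e by (simp add: h_def g0 field_simps)
  ultimately show ?thesis by simp
qed

section \<open>Manifolds given by an atlas\<close>

locale atlas =
  fixes X :: "'a topology" and A :: "('a, 'e::euclidean_space) chart set"
  assumes smooth_atlas: "smooth_atlas X A"
begin

abbreviation coords :: "('a, 'e) chart \<Rightarrow> 'a set \<Rightarrow> 'e set"
  where "coords \<phi> W \<equiv> snd \<phi> ` (fst \<phi> \<inter> W)"

lemma topspace_charts: "topspace X = (\<Union>\<phi>\<in>A. fst \<phi>)"
  using smooth_atlas by (simp add: smooth_atlas_def)

lemma openin_chart: "\<phi> \<in> A \<Longrightarrow> openin X (fst \<phi>)"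
  using smooth_atlas by (simp add: smooth_atlas_def)

lemma chart_subset: "\<phi> \<in> A \<Longrightarrow> fst \<phi> \<subseteq> topspace X"
  using openin_chart openin_subset by blast

lemma homeomorphic_chart:
  "\<phi> \<in> A \<Longrightarrow> homeomorphic_map (subtopology X (fst \<phi>)) (top_of_set (snd \<phi> ` fst \<phi>)) (snd \<phi>)"
  using smooth_atlas by (simp add: smooth_atlas_def)

lemma inj_on_chart: "\<phi> \<in> A \<Longrightarrow> inj_on (snd \<phi>) (fst \<phi>)"
  using homeomorphic_imp_injective_map[OF homeomorphic_chart] chart_subset
  by (metis inf.absorb2 topspace_subtopology)

lemma open_coords:
  assumes "\<phi> \<in> A" "openin X W"
  shows "open (coords \<phi> W)"
proof -
  have "openin (subtopology X (fst \<phi>)) (fst \<phi> \<inter> W)"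
    using assms(2) by (simp add: openin_subtopology_Int2)
  then have "openin (top_of_set (snd \<phi> ` fst \<phi>)) (coords \<phi> W)"
    using homeomorphic_imp_open_map[OF homeomorphic_chart[OF assms(1)]] unfolding open_map_def by blast
  then show ?thesis
    using smooth_atlas assms(1) openin_open_eq unfolding smooth_atlas_def by blast
qed

lemma open_chart_image: "\<phi> \<in> A \<Longrightarrow> open (snd \<phi> ` fst \<phi>)"
  using smooth_atlas by (simp add: smooth_atlas_def)

lemma chart_inv_chart [simp]: "\<phi> \<in> A \<Longrightarrow> p \<in> fst \<phi> \<Longrightarrow> chart_inv \<phi> (snd \<phi> p) = p"
  by (simp add: chart_inv_def inv_into_f_f[OF inj_on_chart])

lemma charts_at_D: "\<phi> \<in> charts_at A p \<Longrightarrow> \<phi> \<in> A" "\<phi> \<in> charts_at A p \<Longrightarrow> p \<in> fst \<phi>"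
  by (auto simp: charts_at_def)

lemma charts_at_I: "\<phi> \<in> A \<Longrightarrow> p \<in> fst \<phi> \<Longrightarrow> \<phi> \<in> charts_at A p"
  by (auto simp: charts_at_def)

lemma some_chart_at: "p \<in> topspace X \<Longrightarrow> some_chart A p \<in> charts_at A p"
  unfolding some_chart_def by (rule someI_ex) (use topspace_charts in \<open>auto simp: charts_at_def\<close>)

lemma smooth_on_transition:
  "\<phi> \<in> A \<Longrightarrow> \<psi> \<in> A \<Longrightarrow> smooth_on (coords \<phi> (fst \<psi>)) (\<lambda>x. snd \<psi> (chart_inv \<phi> x))"
  using smooth_atlas by (simp add: smooth_atlas_def comp_def)

lemma transition_deriv_eq: "transition_deriv p \<phi> \<psi> = dd (\<lambda>x. snd \<psi> (chart_inv \<phi> x)) (snd \<phi> p)"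
  by (simp add: transition_deriv_def comp_def)

lemma has_derivative_transition:
  assumes "\<phi> \<in> charts_at A p" "\<psi> \<in> charts_at A p"
  shows "((\<lambda>x. snd \<psi> (chart_inv \<phi> x)) has_derivative transition_deriv p \<phi> \<psi>) (at (snd \<phi> p))"
  unfolding transition_deriv_eq
  by (rule smooth_on_has_derivative[OF smooth_on_transition]) (use assms charts_at_D in auto)

lemma linear_transition:
  "\<phi> \<in> charts_at A p \<Longrightarrow> \<psi> \<in> charts_at A p \<Longrightarrow> linear (transition_deriv p \<phi> \<psi>)"
  by (rule has_derivative_linear[OF has_derivative_transition])

lemma transition_deriv_compose:
  assumes "\<phi> \<in> charts_at A p" "\<psi> \<in> charts_at A p" "\<rho> \<in> charts_at A p"
  shows "transition_deriv p \<psi> \<rho> (transition_deriv p \<phi> \<psi> u) = transition_deriv p \<phi> \<rho> u"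
proof -
  note d = charts_at_D[OF assms(1)] charts_at_D[OF assms(2)] charts_at_D[OF assms(3)]
  have "((\<lambda>x. snd \<rho> (chart_inv \<psi> x)) has_derivative transition_deriv p \<psi> \<rho>) (at (snd \<psi> (chart_inv \<phi> (snd \<phi> p))))"
    using has_derivative_transition[OF assms(2,3)] d by simp
  from has_derivative_compose[OF has_derivative_transition[OF assms(1,2)] this]
  have "((\<lambda>x. snd \<rho> (chart_inv \<psi> (snd \<psi> (chart_inv \<phi> x)))) has_derivative
     (\<lambda>u. transition_deriv p \<psi> \<rho> (transition_deriv p \<phi> \<psi> u))) (at (snd \<phi> p))" .
  then have "((\<lambda>x. snd \<rho> (chart_inv \<phi> x)) has_derivative
     (\<lambda>u. transition_deriv p \<psi> \<rho> (transition_deriv p \<phi> \<psi> u))) (at (snd \<phi> p))"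
    by (rule has_derivative_transform_within_open[OF _ open_coords[OF d(1) openin_chart[OF d(3)]]])
       (use d in auto)
  from frechet_derivative_eqI[OF this] show ?thesis by (simp add: transition_deriv_eq)
qed

lemma transition_deriv_same:
  assumes "\<phi> \<in> charts_at A p"
  shows "transition_deriv p \<phi> \<phi> u = u"
proof -
  note d = charts_at_D[OF assms(1)]
  have "((\<lambda>x. snd \<phi> (chart_inv \<phi> x)) has_derivative (\<lambda>u. u)) (at (snd \<phi> p))"
    by (rule has_derivative_transform_within_open[OF has_derivative_ident open_chart_image[OF d(1)]])
       (use d in auto)
  from frechet_derivative_eqI[OF this] show ?thesis by (simp add: transition_deriv_eq)
qed

lemma coord_vec_apply: "\<psi> \<in> charts_at A p \<Longrightarrow> coord_vec A \<phi> p u \<psi> = transition_deriv p \<phi> \<psi> u"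
  by (simp add: coord_vec_def)

lemma coord_vec_same [simp]: "\<phi> \<in> charts_at A p \<Longrightarrow> coord_vec A \<phi> p u \<phi> = u"
  by (simp add: coord_vec_apply transition_deriv_same)

lemma coord_vec_tangent: "\<phi> \<in> charts_at A p \<Longrightarrow> coord_vec A \<phi> p u \<in> tangent_space A p"
  unfolding tangent_space_def by (auto simp: coord_vec_def transition_deriv_compose)

lemma tangent_transition:
  "v \<in> tangent_space A p \<Longrightarrow> \<phi> \<in> charts_at A p \<Longrightarrow> \<psi> \<in> charts_at A p \<Longrightarrow> v \<psi> = transition_deriv p \<phi> \<psi> (v \<phi>)"
  unfolding tangent_space_def by blast

lemma tangent_outside: "v \<in> tangent_space A p \<Longrightarrow> \<phi> \<notin> charts_at A p \<Longrightarrow> v \<phi> = 0"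
  unfolding tangent_space_def by blast

lemma coord_vec_component:
  assumes "v \<in> tangent_space A p" "\<phi> \<in> charts_at A p"
  shows "coord_vec A \<phi> p (v \<phi>) = v"
proof
  show "coord_vec A \<phi> p (v \<phi>) \<psi> = v \<psi>" for \<psi>
    by (cases "\<psi> \<in> charts_at A p")
       (simp_all add: coord_vec_def tangent_transition[OF assms, symmetric] tangent_outside[OF assms(1)])
qed

lemma tangent_eqI:
  "v \<in> tangent_space A p \<Longrightarrow> w \<in> tangent_space A p \<Longrightarrow> \<phi> \<in> charts_at A p \<Longrightarrow> v \<phi> = w \<phi> \<Longrightarrow> v = w"
  by (metis coord_vec_component)

lemma coord_vec_change:
  "\<phi> \<in> charts_at A p \<Longrightarrow> \<psi> \<in> charts_at A p \<Longrightarrow> coord_vec A \<psi> p (transition_deriv p \<phi> \<psi> u) = coord_vec A \<phi> p u"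
  by (rule tangent_eqI[of _ p _ \<psi>]) (auto simp: coord_vec_tangent coord_vec_apply)

lemma linear_coord_vec: "\<phi> \<in> charts_at A p \<Longrightarrow> linear (coord_vec A \<phi> p)"
  by (intro linearI)
     (auto simp: coord_vec_def fun_eq_iff scaleR_fun_def linear_add[OF linear_transition] linear_cmul[OF linear_transition])

lemma tangent_space_eq_range:
  assumes "\<phi> \<in> charts_at A p"
  shows "tangent_space A p = range (coord_vec A \<phi> p)"
proof
  show "tangent_space A p \<subseteq> range (coord_vec A \<phi> p)"
    using coord_vec_component[OF _ assms, symmetric] by (intro subsetI) (rule range_eqI)
qed (use coord_vec_tangent[OF assms] in auto)

lemma inj_coord_vec: "\<phi> \<in> charts_at A p \<Longrightarrow> inj (coord_vec A \<phi> p)"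
  by (rule inj_on_inverseI[where g="\<lambda>v. v \<phi>"]) simp

lemma ex_chart: "p \<in> topspace X \<Longrightarrow> \<exists>\<phi>. \<phi> \<in> charts_at A p"
  using some_chart_at by blast

lemma subspace_tangent_space:
  assumes "p \<in> topspace X"
  shows "subspace (tangent_space A p)"
  using ex_chart[OF assms] linear_subspace_image[OF linear_coord_vec subspace_UNIV] tangent_space_eq_range by metis

lemma dim_tangent_space:
  assumes "p \<in> topspace X"
  shows "dim (tangent_space A p) = DIM('e)"
proof -
  obtain \<phi> where \<phi>: "\<phi> \<in> charts_at A p" using ex_chart[OF assms] by blast
  have i: "inj_on (coord_vec A \<phi> p) (span Basis)" using inj_coord_vec[OF \<phi>] by (auto intro: inj_on_subset)
  have "independent (coord_vec A \<phi> p ` Basis)"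
    by (rule linear_independent_injective_image[OF linear_coord_vec[OF \<phi>] independent_Basis i])
  moreover have "span (coord_vec A \<phi> p ` Basis) = tangent_space A p"
    by (simp add: linear_span_image[OF linear_coord_vec[OF \<phi>]] tangent_space_eq_range[OF \<phi>])
  moreover have "card (coord_vec A \<phi> p ` Basis) = DIM('e)"
    by (rule card_image[OF inj_on_subset[OF inj_coord_vec[OF \<phi>]]]) simp
  ultimately show ?thesis by (metis dim_span dim_eq_card)
qed

lemma form_eq_coord_form:
  assumes "v \<in> tangent_space A p" "w \<in> tangent_space A p" "\<phi> \<in> charts_at A p"
  shows "b p v w = coord_form A b \<phi> (snd \<phi> p) (v \<phi>) (w \<phi>)"
  using assms coord_vec_component charts_at_D[OF assms(3)] by (simp add: coord_form_def)

lemma coord_form_change: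
  assumes "\<phi> \<in> A" "\<psi> \<in> A" "x \<in> coords \<phi> (fst \<psi>)"
  shows "coord_form A b \<phi> x u v = coord_form A b \<psi> (snd \<psi> (chart_inv \<phi> x))
    (dd (\<lambda>x. snd \<psi> (chart_inv \<phi> x)) x u) (dd (\<lambda>x. snd \<psi> (chart_inv \<phi> x)) x v)"
proof -
  obtain p where p: "x = snd \<phi> p" "p \<in> fst \<phi>" "p \<in> fst \<psi>" using assms by auto
  then have c: "\<phi> \<in> charts_at A p" "\<psi> \<in> charts_at A p" using assms charts_at_I by auto
  show ?thesis
    using p assms unfolding coord_form_def by (simp add: transition_deriv_eq[symmetric] coord_vec_change[OF c])
qed

lemma coord_form_linear:
  assumes b: "bilinear_form_on (tangent_space A p) (b p)" and \<phi>: "\<phi> \<in> charts_at A p"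
  shows "linear (coord_form A b \<phi> (snd \<phi> p) u)" "linear (\<lambda>u. coord_form A b \<phi> (snd \<phi> p) u v)"
proof -
  have e: "coord_vec A \<phi> p (u + v) = 1 *\<^sub>R coord_vec A \<phi> p u + 1 *\<^sub>R coord_vec A \<phi> p v"
    "coord_vec A \<phi> p (r *\<^sub>R u) = r *\<^sub>R coord_vec A \<phi> p u + 0 *\<^sub>R coord_vec A \<phi> p u" for u v r
    using linear_add[OF linear_coord_vec[OF \<phi>]] linear_cmul[OF linear_coord_vec[OF \<phi>]] by simp_all
  have b1: "b p (r *\<^sub>R coord_vec A \<phi> p u + s *\<^sub>R coord_vec A \<phi> p v) (coord_vec A \<phi> p z) =
     r * b p (coord_vec A \<phi> p u) (coord_vec A \<phi> p z) + s * b p (coord_vec A \<phi> p v) (coord_vec A \<phi> p z)"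
   and b2: "b p (coord_vec A \<phi> p z) (r *\<^sub>R coord_vec A \<phi> p u + s *\<^sub>R coord_vec A \<phi> p v) =
     r * b p (coord_vec A \<phi> p z) (coord_vec A \<phi> p u) + s * b p (coord_vec A \<phi> p z) (coord_vec A \<phi> p v)" for r s u v z
    using b coord_vec_tangent[OF \<phi>] unfolding bilinear_form_on_def by blast+
  show "linear (coord_form A b \<phi> (snd \<phi> p) u)" "linear (\<lambda>u. coord_form A b \<phi> (snd \<phi> p) u v)"
    unfolding coord_form_def by (intro linearI; simp only: e b1 b2 charts_at_D[OF \<phi>] chart_inv_chart; simp)+
qed

lemma coord_form_bilinear:
  assumes b: "smooth_form X A b" and \<phi>: "\<phi> \<in> A" and x: "x \<in> snd \<phi> ` fst \<phi>"
  shows "linear (coord_form A b \<phi> x u)" "linear (\<lambda>u. coord_form A b \<phi> x u v)"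
proof -
  obtain p where p: "x = snd \<phi> p" "p \<in> fst \<phi>" using x by auto
  then have "bilinear_form_on (tangent_space A p) (b p)"
    using b chart_subset[OF \<phi>] unfolding smooth_form_def by blast
  from coord_form_linear[where b=b, OF this charts_at_I[OF \<phi> p(2)]]
  show "linear (coord_form A b \<phi> x u)" "linear (\<lambda>u. coord_form A b \<phi> x u v)" by (simp_all add: p(1))
qed

lemma coord_form_smooth: "smooth_form X A b \<Longrightarrow> \<phi> \<in> A \<Longrightarrow> smooth_on (snd \<phi> ` fst \<phi>) (\<lambda>x. coord_form A b \<phi> x u v)"
  by (simp add: smooth_form_def)

lemma local_metric_coord_form:
  assumes g: "smooth_form X A g" "symmetric_form X A g"
    and nd: "\<And>p. p \<in> topspace X \<Longrightarrow> nondegenerate_on (tangent_space A p) (g p)" and \<phi>: "\<phi> \<in> A"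
  shows "local_metric (snd \<phi> ` fst \<phi>) (coord_form A g \<phi>)"
proof (rule local_metric.intro)
  fix x assume x: "x \<in> snd \<phi> ` fst \<phi>"
  then obtain p where p: "x = snd \<phi> p" "p \<in> fst \<phi>" by auto
  have pX: "p \<in> topspace X" using p chart_subset[OF \<phi>] by blast
  have c: "\<phi> \<in> charts_at A p" by (rule charts_at_I[OF \<phi> p(2)])
  show "coord_form A g \<phi> x u v = coord_form A g \<phi> x v u" for u v
    using g(2) pX coord_vec_tangent[OF c] \<phi> p unfolding symmetric_form_def coord_form_def by simp
  show "linear (coord_form A g \<phi> x u)" for u by (rule coord_form_bilinear[OF g(1) \<phi> x])
  show "u = 0" if "\<And>v. coord_form A g \<phi> x u v = 0" for u
  proof -
    have "g p (coord_vec A \<phi> p u) v = 0" if "v \<in> tangent_space A p" for v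
      using \<open>\<And>v. coord_form A g \<phi> x u v = 0\<close>[of "v \<phi>"] p \<phi> by (simp add: coord_form_def coord_vec_component[OF that c])
    then have "coord_vec A \<phi> p u = 0"
      using nd[OF pX] coord_vec_tangent[OF c] unfolding nondegenerate_on_def by blast
    then show "u = 0" using coord_vec_same[OF c] by (metis zero_fun_apply)
  qed
qed (use open_chart_image[OF \<phi>] coord_form_smooth[OF g(1) \<phi>] in auto)

text \<open>A transition map is an isometry between the two coordinate expressions, so
  \<open>curvature_transform\<close> applies. The open set \<open>W\<close> is kept general because
  a conformal factor may be given only there.\<close>

lemma curvature_change:
  assumes g: "\<And>\<phi>. \<phi> \<in> A \<Longrightarrow> local_metric (coords \<phi> W) (coord_form A g \<phi>)"
    and W: "openin X W" "p \<in> W" and c: "\<phi> \<in> charts_at A p" "\<psi> \<in> charts_at A p"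
  shows "transition_deriv p \<phi> \<psi> (curvature (coord_form A g \<phi>) (snd \<phi> p) u v w) =
    curvature (coord_form A g \<psi>) (snd \<psi> p) (transition_deriv p \<phi> \<psi> u) (transition_deriv p \<phi> \<psi> v) (transition_deriv p \<phi> \<psi> w)"
proof -
  note d = charts_at_D[OF c(1)] charts_at_D[OF c(2)]
  have W': "openin X (fst \<psi> \<inter> W)" by (intro openin_Int openin_chart d W)
  have lm: "local_metric (coords \<phi> (fst \<psi> \<inter> W)) (coord_form A g \<phi>)"
    by (rule local_metric_subset[OF g[OF d(1)] open_coords[OF d(1) W']]) auto
  let ?T = "\<lambda>x. snd \<psi> (chart_inv \<phi> x)"
  have sT: "smooth_on (coords \<phi> (fst \<psi> \<inter> W)) ?T"
    by (rule smooth_on_subset[OF smooth_on_transition[OF d(1,3)]]) auto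
  have img: "?T ` coords \<phi> (fst \<psi> \<inter> W) \<subseteq> coords \<psi> W"
    using d by auto
  have x: "snd \<phi> p \<in> coords \<phi> (fst \<psi> \<inter> W)" using d W by auto
  have iso: "coord_form A g \<phi> y u v = coord_form A g \<psi> (?T y) (dd ?T y u) (dd ?T y v)"
    if "y \<in> coords \<phi> (fst \<psi> \<inter> W)" for y u v
    by (rule coord_form_change[OF d(1,3)]) (use that in blast)
  have "dd ?T (snd \<phi> p) (curvature (coord_form A g \<phi>) (snd \<phi> p) u v w) = curvature (coord_form A g \<psi>) (?T (snd \<phi> p))
     (dd ?T (snd \<phi> p) u) (dd ?T (snd \<phi> p) v) (dd ?T (snd \<phi> p) w)"
    by (rule curvature_transform[OF lm g[OF d(3)] sT img iso x])
  then show ?thesis using d by (simp add: transition_deriv_eq)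
qed

lemma smooth_vector_field_tangent: "smooth_vector_field A U V \<Longrightarrow> p \<in> U \<Longrightarrow> V p \<in> tangent_space A p"
  by (simp add: smooth_vector_field_def)

lemma smooth_vector_field_coords: "smooth_vector_field A U V \<Longrightarrow> \<phi> \<in> A \<Longrightarrow> smooth_on (coords \<phi> U) (\<lambda>x. V (chart_inv \<phi> x) \<phi>)"
  by (simp add: smooth_vector_field_def)

text \<open>Changing the chart adds a second derivative of the transition map to each of the two
  terms, and the two cancel by symmetry. Tangency is needed wherever an endomorphism or a form is
  evaluated on a bracket.\<close>

lemma lie_bracket_tangent:
  assumes U: "openin X U" and V: "smooth_vector_field A U V" and W: "smooth_vector_field A U W" and p: "p \<in> U"
  shows "lie_bracket A V W p \<in> tangent_space A p"
proof -
  have "lie_bracket A V W p \<psi> = transition_deriv p \<phi> \<psi> (lie_bracket A V W p \<phi>)"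
    if c: "\<phi> \<in> charts_at A p" "\<psi> \<in> charts_at A p" for \<phi> \<psi>
  proof -
    note d = charts_at_D[OF c(1)] charts_at_D[OF c(2)]
    let ?T = "\<lambda>x. snd \<psi> (chart_inv \<phi> x)" and ?x = "snd \<phi> p" and ?D = "coords \<phi> (fst \<psi> \<inter> U)"
    have oD: "open ?D" by (intro open_coords openin_Int openin_chart d U)
    have xD: "?x \<in> ?D" using d p by auto
    have sT: "smooth_on ?D ?T" by (rule smooth_on_subset[OF smooth_on_transition[OF d(1,3)]]) auto
    have dT: "(?T has_derivative dd ?T y) (at y)" if "y \<in> ?D" for y by (rule smooth_on_has_derivative[OF sT that])
    have Tx: "?T ?x = snd \<psi> p" using d by simp
    have main: "dd (\<lambda>y. F (chart_inv \<psi> y) \<psi>) (snd \<psi> p) (dd ?T ?x w) =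
       dd (\<lambda>y. dd ?T y (F p \<phi>)) ?x w + dd ?T ?x (dd (\<lambda>y. F (chart_inv \<phi> y) \<phi>) ?x w)"
      if F: "smooth_vector_field A U F" for F w
    proof -
      have "((\<lambda>y. F (chart_inv \<psi> y) \<psi>) has_derivative dd (\<lambda>y. F (chart_inv \<psi> y) \<psi>) (snd \<psi> p)) (at (?T ?x))"
        unfolding Tx by (rule smooth_on_has_derivative[OF smooth_vector_field_coords[OF F d(3)]]) (use d p in auto)
      from has_derivative_compose[OF dT[OF xD] this]
      have 1: "((\<lambda>y. F (chart_inv \<psi> (?T y)) \<psi>) has_derivative (\<lambda>w. dd (\<lambda>y. F (chart_inv \<psi> y) \<psi>) (snd \<psi> p) (dd ?T ?x w))) (at ?x)" .
      have dF: "((\<lambda>y. F (chart_inv \<phi> y) \<phi>) has_derivative dd (\<lambda>y. F (chart_inv \<phi> y) \<phi>) ?x) (at ?x)"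
        by (rule smooth_on_has_derivative[OF smooth_vector_field_coords[OF F d(1)]]) (use d p in auto)
      have "((\<lambda>y. dd ?T y (F (chart_inv \<phi> y) \<phi>)) has_derivative
         (\<lambda>w. dd (\<lambda>y. dd ?T y (F (chart_inv \<phi> ?x) \<phi>)) ?x w + dd ?T ?x (dd (\<lambda>y. F (chart_inv \<phi> y) \<phi>) ?x w))) (at ?x)"
        by (rule has_derivative_linear_family(1)[OF oD xD _ _ dF])
           (use has_derivative_linear[OF dT] smooth_on_imp_differentiable[OF smooth_on_derivative[OF sT] xD] in auto)
      moreover have "dd ?T y (F (chart_inv \<phi> y) \<phi>) = F (chart_inv \<psi> (?T y)) \<psi>" if "y \<in> ?D" for y
      proof -
        obtain q where q: "y = snd \<phi> q" "q \<in> fst \<phi>" "q \<in> fst \<psi>" "q \<in> U" using \<open>y \<in> ?D\<close> by blast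
        then show ?thesis
          using tangent_transition[OF smooth_vector_field_tangent[OF F q(4)] charts_at_I[OF d(1) q(2)] charts_at_I[OF d(3) q(3)]] d
          by (simp add: transition_deriv_eq)
      qed
      ultimately have "((\<lambda>y. F (chart_inv \<psi> (?T y)) \<psi>) has_derivative
         (\<lambda>w. dd (\<lambda>y. dd ?T y (F (chart_inv \<phi> ?x) \<phi>)) ?x w + dd ?T ?x (dd (\<lambda>y. F (chart_inv \<phi> y) \<phi>) ?x w))) (at ?x)"
        by (rule has_derivative_transform_within_open[OF _ oD xD])
      from has_derivative_unique[OF 1 this] show ?thesis using d by (simp add: fun_eq_iff)
    qed
    have e: "V p \<psi> = dd ?T ?x (V p \<phi>)" "W p \<psi> = dd ?T ?x (W p \<phi>)"
      using tangent_transition[OF smooth_vector_field_tangent[OF V p] c] tangent_transition[OF smooth_vector_field_tangent[OF W p] c]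
      by (simp_all add: transition_deriv_eq)
    have s: "dd (\<lambda>y. dd ?T y (W p \<phi>)) ?x (V p \<phi>) = dd (\<lambda>y. dd ?T y (V p \<phi>)) ?x (W p \<phi>)"
      by (rule second_derivative_symmetric[OF oD xD sT])
    show ?thesis
      using c unfolding lie_bracket_def transition_deriv_eq
      by (simp add: e main[OF V] main[OF W] s linear_diff[OF has_derivative_linear[OF dT[OF xD]]])
  qed
  moreover have "lie_bracket A V W p \<phi> = 0" if "\<phi> \<notin> charts_at A p" for \<phi>
    by (simp add: lie_bracket_def that)
  ultimately show ?thesis unfolding tangent_space_def by blast
qed

end

section \<open>Product manifolds\<close>

lemma second_countable_prod_topology:
  assumes "second_countable X" "second_countable Y"
  shows "second_countable (prod_topology X Y)"
proof -
  obtain B where B: "countable B" "\<And>V. V \<in> B \<Longrightarrow> openin X V" "\<And>U x. openin X U \<Longrightarrow> x \<in> U \<Longrightarrow> \<exists>V\<in>B. x \<in> V \<and> V \<subseteq> U"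
    using assms(1) unfolding second_countable_def by metis
  obtain C where C: "countable C" "\<And>V. V \<in> C \<Longrightarrow> openin Y V" "\<And>U x. openin Y U \<Longrightarrow> x \<in> U \<Longrightarrow> \<exists>V\<in>C. x \<in> V \<and> V \<subseteq> U"
    using assms(2) unfolding second_countable_def by metis
  let ?D = "(\<lambda>(U, V). U \<times> V) ` (B \<times> C)"
  show ?thesis
    unfolding second_countable_def
  proof (intro exI conjI allI impI ballI)
    show "countable ?D" using B(1) C(1) by simp
    show "openin (prod_topology X Y) V" if "V \<in> ?D" for V
      using that B(2) C(2) by (auto simp: openin_prod_Times_iff)
    fix U z assume U: "openin (prod_topology X Y) U \<and> z \<in> U"
    obtain x y where z: "z = (x, y)" by (cases z)
    obtain U1 U2 where 1: "openin X U1" "openin Y U2" "x \<in> U1" "y \<in> U2" "U1 \<times> U2 \<subseteq> U"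
      using U z unfolding openin_prod_topology_alt by blast
    obtain V1 where "V1 \<in> B" "x \<in> V1" "V1 \<subseteq> U1" using B(3)[OF 1(1,3)] by blast
    moreover obtain V2 where "V2 \<in> C" "y \<in> V2" "V2 \<subseteq> U2" using C(3)[OF 1(2,4)] by blast
    ultimately have "V1 \<times> V2 \<in> ?D" "z \<in> V1 \<times> V2" "V1 \<times> V2 \<subseteq> U" using 1(5) z by auto
    then show "\<exists>V\<in>?D. z \<in> V \<and> V \<subseteq> U" by blast
  qed
qed

definition prod_chart :: "('a, 'e) chart \<Rightarrow> ('b, 'f) chart \<Rightarrow> ('a \<times> 'b, 'e \<times> 'f) chart"
  where "prod_chart \<phi> \<psi> = (fst \<phi> \<times> fst \<psi>, map_prod (snd \<phi>) (snd \<psi>))"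

lemma prod_atlas_eq: "prod_atlas A B = {prod_chart \<phi> \<psi> | \<phi> \<psi>. \<phi> \<in> A \<and> \<psi> \<in> B}"
  by (simp add: prod_atlas_def prod_chart_def)

lemma fst_prod_chart [simp]: "fst (prod_chart \<phi> \<psi>) = fst \<phi> \<times> fst \<psi>"
  and snd_prod_chart [simp]: "snd (prod_chart \<phi> \<psi>) = map_prod (snd \<phi>) (snd \<psi>)"
  by (simp_all add: prod_chart_def)

locale atlas_pair = A: atlas X A + B: atlas Y B
  for X :: "'a topology" and A :: "('a, 'e::euclidean_space) chart set"
  and Y :: "'b topology" and B :: "('b, 'f::euclidean_space) chart set"
begin

abbreviation P where "P \<equiv> prod_atlas A B"

lemma chart_inv_prod_chart:
  assumes "\<phi> \<in> A" "\<psi> \<in> B" "p \<in> fst \<phi>" "q \<in> fst \<psi>"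
  shows "chart_inv (prod_chart \<phi> \<psi>) (snd \<phi> p, snd \<psi> q) = (p, q)"
proof -
  have "inj_on (map_prod (snd \<phi>) (snd \<psi>)) (fst \<phi> \<times> fst \<psi>)"
    by (intro map_prod_inj_on A.inj_on_chart B.inj_on_chart assms)
  from inv_into_f_f[OF this, of "(p, q)"] show ?thesis
    using assms by (simp add: chart_inv_def)
qed

lemma chart_inv_prod_chart':
  assumes "\<phi> \<in> A" "\<psi> \<in> B" "x \<in> snd \<phi> ` fst \<phi>" "y \<in> snd \<psi> ` fst \<psi>"
  shows "chart_inv (prod_chart \<phi> \<psi>) (x, y) = (chart_inv \<phi> x, chart_inv \<psi> y)"
proof -
  obtain p q where pq: "p \<in> fst \<phi>" "x = snd \<phi> p" "q \<in> fst \<psi>" "y = snd \<psi> q" using assms by auto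
  show ?thesis
    unfolding pq chart_inv_prod_chart[OF assms(1,2) pq(1,3)] using assms pq by simp
qed

lemma smooth_on_prod:
  assumes "open S" "open T" "smooth_on S f" "smooth_on T g"
  shows "smooth_on (S \<times> T) (\<lambda>z. (f (fst z), g (snd z)))"
proof -
  have o: "open (S \<times> T)" by (intro open_Times assms)
  show ?thesis
    by (intro smooth_on_Pair o smooth_on_compose[OF o assms(1) _ smooth_on_bounded_linear[OF o bounded_linear_fst] assms(3)]
        smooth_on_compose[OF o assms(2) _ smooth_on_bounded_linear[OF o bounded_linear_snd] assms(4)]) auto
qed

lemma smooth_atlas_prod: "smooth_atlas (prod_topology X Y) P"
proof -
  have "topspace (prod_topology X Y) = (\<Union>\<phi>\<in>P. fst \<phi>)"
    unfolding topspace_prod_topology A.topspace_charts B.topspace_charts prod_atlas_eq by fastforce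
  moreover have "openin (prod_topology X Y) (fst \<rho>) \<and> open (snd \<rho> ` fst \<rho>) \<and>
      homeomorphic_map (subtopology (prod_topology X Y) (fst \<rho>)) (top_of_set (snd \<rho> ` fst \<rho>)) (snd \<rho>)" if "\<rho> \<in> P" for \<rho>
  proof -
    obtain \<phi> \<psi> where \<rho>: "\<rho> = prod_chart \<phi> \<psi>" "\<phi> \<in> A" "\<psi> \<in> B" using \<open>\<rho> \<in> P\<close> unfolding prod_atlas_eq by blast
    have im: "map_prod (snd \<phi>) (snd \<psi>) ` (fst \<phi> \<times> fst \<psi>) = (snd \<phi> ` fst \<phi>) \<times> (snd \<psi> ` fst \<psi>)"
      by (rule map_prod_image)
    obtain f' g' where "homeomorphic_maps (subtopology X (fst \<phi>)) (top_of_set (snd \<phi> ` fst \<phi>)) (snd \<phi>) f'"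
      "homeomorphic_maps (subtopology Y (fst \<psi>)) (top_of_set (snd \<psi> ` fst \<psi>)) (snd \<psi>) g'"
      using A.homeomorphic_chart[OF \<rho>(2)] B.homeomorphic_chart[OF \<rho>(3)] unfolding homeomorphic_map_maps by blast
    then have "homeomorphic_maps (prod_topology (subtopology X (fst \<phi>)) (subtopology Y (fst \<psi>)))
       (prod_topology (top_of_set (snd \<phi> ` fst \<phi>)) (top_of_set (snd \<psi> ` fst \<psi>)))
       (\<lambda>(x,y). (snd \<phi> x, snd \<psi> y)) (\<lambda>(x,y). (f' x, g' y))"
      unfolding homeomorphic_maps_prod by blast
    then have "homeomorphic_map (subtopology (prod_topology X Y) (fst \<phi> \<times> fst \<psi>))
       (top_of_set ((snd \<phi> ` fst \<phi>) \<times> (snd \<psi> ` fst \<psi>))) (map_prod (snd \<phi>) (snd \<psi>))"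
      unfolding homeomorphic_map_maps subtopology_Times prod_topology_subtopology_eu map_prod_def by blast
    then show ?thesis
      unfolding \<rho>(1) fst_prod_chart snd_prod_chart im
      using A.openin_chart[OF \<rho>(2)] B.openin_chart[OF \<rho>(3)] A.open_chart_image[OF \<rho>(2)] B.open_chart_image[OF \<rho>(3)]
      by (auto simp: openin_prod_Times_iff intro: open_Times)
  qed
  moreover have "smooth_on (snd \<rho> ` (fst \<rho> \<inter> fst \<rho>')) (snd \<rho>' \<circ> chart_inv \<rho>)" if "\<rho> \<in> P" "\<rho>' \<in> P" for \<rho> \<rho>'
  proof -
    obtain \<phi> \<psi> where \<rho>: "\<rho> = prod_chart \<phi> \<psi>" "\<phi> \<in> A" "\<psi> \<in> B" using \<open>\<rho> \<in> P\<close> unfolding prod_atlas_eq by blast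
    obtain \<phi>' \<psi>' where \<rho>': "\<rho>' = prod_chart \<phi>' \<psi>'" "\<phi>' \<in> A" "\<psi>' \<in> B" using \<open>\<rho>' \<in> P\<close> unfolding prod_atlas_eq by blast
    have im: "snd \<rho> ` (fst \<rho> \<inter> fst \<rho>') = A.coords \<phi> (fst \<phi>') \<times> B.coords \<psi> (fst \<psi>')"
      unfolding \<rho>(1) \<rho>'(1) by (simp add: Times_Int_Times map_prod_image)
    have o: "open (A.coords \<phi> (fst \<phi>'))" "open (B.coords \<psi> (fst \<psi>'))"
      using A.open_coords[OF \<rho>(2) A.openin_chart[OF \<rho>'(2)]] B.open_coords[OF \<rho>(3) B.openin_chart[OF \<rho>'(3)]] by auto
    have "smooth_on (A.coords \<phi> (fst \<phi>') \<times> B.coords \<psi> (fst \<psi>'))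
      (\<lambda>z. (snd \<phi>' (chart_inv \<phi> (fst z)), snd \<psi>' (chart_inv \<psi> (snd z))))"
      by (rule smooth_on_prod[OF o A.smooth_on_transition[OF \<rho>(2) \<rho>'(2)] B.smooth_on_transition[OF \<rho>(3) \<rho>'(3)]])
    then show ?thesis
      unfolding im
    proof (subst smooth_on_cong[OF open_Times[OF o]])
      fix z assume "z \<in> A.coords \<phi> (fst \<phi>') \<times> B.coords \<psi> (fst \<psi>')"
      then show "(snd \<rho>' \<circ> chart_inv \<rho>) z = (snd \<phi>' (chart_inv \<phi> (fst z)), snd \<psi>' (chart_inv \<psi> (snd z)))"
        unfolding \<rho> \<rho>' using chart_inv_prod_chart'[OF \<rho>(2,3), of "fst z" "snd z"] by auto
    qed
  qed
  ultimately show ?thesis unfolding smooth_atlas_def by blast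
qed

sublocale P: atlas "prod_topology X Y" P
  by unfold_locales (rule smooth_atlas_prod)

lemma charts_at_prod: "charts_at P (p, q) = {prod_chart \<phi> \<psi> | \<phi> \<psi>. \<phi> \<in> charts_at A p \<and> \<psi> \<in> charts_at B q}"
  unfolding prod_atlas_eq charts_at_def by fastforce

lemma prod_chart_at: "\<phi> \<in> charts_at A p \<Longrightarrow> \<psi> \<in> charts_at B q \<Longrightarrow> prod_chart \<phi> \<psi> \<in> charts_at P (p, q)"
  unfolding charts_at_prod by blast

lemma transition_deriv_prod:
  assumes "\<phi> \<in> charts_at A p" "\<psi> \<in> charts_at B q" "\<phi>' \<in> charts_at A p" "\<psi>' \<in> charts_at B q"
  shows "transition_deriv (p, q) (prod_chart \<phi> \<psi>) (prod_chart \<phi>' \<psi>') u =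
    (transition_deriv p \<phi> \<phi>' (fst u), transition_deriv q \<psi> \<psi>' (snd u))"
proof -
  note d = A.charts_at_D[OF assms(1)] B.charts_at_D[OF assms(2)]
  have "((\<lambda>z. (snd \<phi>' (chart_inv \<phi> (fst z)), snd \<psi>' (chart_inv \<psi> (snd z)))) has_derivative
    (\<lambda>u. (transition_deriv p \<phi> \<phi>' (fst u), transition_deriv q \<psi> \<psi>' (snd u)))) (at (snd \<phi> p, snd \<psi> q))"
    by (intro has_derivative_Pair
         has_derivative_compose[OF has_derivative_fst[OF has_derivative_ident]]
         has_derivative_compose[OF has_derivative_snd[OF has_derivative_ident]])
       (simp_all add: A.has_derivative_transition B.has_derivative_transition assms)
  then have "((\<lambda>z. snd (prod_chart \<phi>' \<psi>') (chart_inv (prod_chart \<phi> \<psi>) z)) has_derivative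
    (\<lambda>u. (transition_deriv p \<phi> \<phi>' (fst u), transition_deriv q \<psi> \<psi>' (snd u)))) (at (snd \<phi> p, snd \<psi> q))"
    by (rule has_derivative_transform_within_open[OF _ open_Times[OF A.open_chart_image[OF d(1)] B.open_chart_image[OF d(3)]]])
       (use d chart_inv_prod_chart'[OF d(1,3)] in auto)
  from frechet_derivative_eqI[OF this] show ?thesis
    unfolding P.transition_deriv_eq by simp
qed

text \<open>\<open>tangent_map\<close> is computed in an unspecified chart of the product. That
  chart is a product chart, and the transition to the given one removes the choice.\<close>

lemma tangent_map_fst:
  assumes v: "v \<in> tangent_space P (p, q)" and c: "\<phi> \<in> charts_at A p" "\<psi> \<in> charts_at B q"
  shows "tangent_map P A fst (p, q) v = coord_vec A \<phi> p (fst (v (prod_chart \<phi> \<psi>)))"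
proof
  fix \<phi>'
  have pq: "(p, q) \<in> topspace (prod_topology X Y)"
    using A.chart_subset[OF A.charts_at_D(1)[OF c(1)]] A.charts_at_D[OF c(1)]
      B.chart_subset[OF B.charts_at_D(1)[OF c(2)]] B.charts_at_D[OF c(2)] by auto
  obtain \<phi>0 \<psi>0 where s: "some_chart P (p, q) = prod_chart \<phi>0 \<psi>0" "\<phi>0 \<in> charts_at A p" "\<psi>0 \<in> charts_at B q"
    using P.some_chart_at[OF pq] unfolding charts_at_prod by blast
  note d = A.charts_at_D[OF s(2)] B.charts_at_D[OF s(3)]
  have "frechet_derivative (snd \<phi>' \<circ> fst \<circ> chart_inv (prod_chart \<phi>0 \<psi>0)) (at (snd (prod_chart \<phi>0 \<psi>0) (p, q))) (v (prod_chart \<phi>0 \<psi>0)) =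
     transition_deriv p \<phi> \<phi>' (fst (v (prod_chart \<phi> \<psi>)))" if \<phi>': "\<phi>' \<in> charts_at A p"
  proof -
    have "((\<lambda>z. snd \<phi>' (chart_inv \<phi>0 (fst z))) has_derivative (\<lambda>u. transition_deriv p \<phi>0 \<phi>' (fst u))) (at (snd \<phi>0 p, snd \<psi>0 q))"
      by (intro has_derivative_compose[OF has_derivative_fst[OF has_derivative_ident]])
         (simp add: A.has_derivative_transition s \<phi>')
    then have "((snd \<phi>' \<circ> fst \<circ> chart_inv (prod_chart \<phi>0 \<psi>0)) has_derivative (\<lambda>u. transition_deriv p \<phi>0 \<phi>' (fst u))) (at (snd \<phi>0 p, snd \<psi>0 q))"
      by (rule has_derivative_transform_within_open[OF _ open_Times[OF A.open_chart_image[OF d(1)] B.open_chart_image[OF d(3)]]])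
         (use d chart_inv_prod_chart'[OF d(1,3)] in auto)
    from frechet_derivative_eqI[OF this]
    show ?thesis
      using P.tangent_transition[OF v prod_chart_at[OF c] prod_chart_at[OF s(2,3)]]
      by (simp add: transition_deriv_prod c s A.transition_deriv_compose \<phi>')
  qed
  then show "tangent_map P A fst (p, q) v \<phi>' = coord_vec A \<phi> p (fst (v (prod_chart \<phi> \<psi>))) \<phi>'"
    by (simp add: tangent_map_def s(1) coord_vec_def Let_def)
qed

lemma tangent_map_snd:
  assumes v: "v \<in> tangent_space P (p, q)" and c: "\<phi> \<in> charts_at A p" "\<psi> \<in> charts_at B q"
  shows "tangent_map P B snd (p, q) v = coord_vec B \<psi> q (snd (v (prod_chart \<phi> \<psi>)))"
proof
  fix \<psi>'
  have pq: "(p, q) \<in> topspace (prod_topology X Y)"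
    using A.chart_subset[OF A.charts_at_D(1)[OF c(1)]] A.charts_at_D[OF c(1)]
      B.chart_subset[OF B.charts_at_D(1)[OF c(2)]] B.charts_at_D[OF c(2)] by auto
  obtain \<phi>0 \<psi>0 where s: "some_chart P (p, q) = prod_chart \<phi>0 \<psi>0" "\<phi>0 \<in> charts_at A p" "\<psi>0 \<in> charts_at B q"
    using P.some_chart_at[OF pq] unfolding charts_at_prod by blast
  note d = A.charts_at_D[OF s(2)] B.charts_at_D[OF s(3)]
  have "frechet_derivative (snd \<psi>' \<circ> snd \<circ> chart_inv (prod_chart \<phi>0 \<psi>0)) (at (snd (prod_chart \<phi>0 \<psi>0) (p, q))) (v (prod_chart \<phi>0 \<psi>0)) =
     transition_deriv q \<psi> \<psi>' (snd (v (prod_chart \<phi> \<psi>)))" if \<psi>': "\<psi>' \<in> charts_at B q"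
  proof -
    have "((\<lambda>z. snd \<psi>' (chart_inv \<psi>0 (snd z))) has_derivative (\<lambda>u. transition_deriv q \<psi>0 \<psi>' (snd u))) (at (snd \<phi>0 p, snd \<psi>0 q))"
      by (intro has_derivative_compose[OF has_derivative_snd[OF has_derivative_ident]])
         (simp add: B.has_derivative_transition s \<psi>')
    then have "((snd \<psi>' \<circ> snd \<circ> chart_inv (prod_chart \<phi>0 \<psi>0)) has_derivative (\<lambda>u. transition_deriv q \<psi>0 \<psi>' (snd u))) (at (snd \<phi>0 p, snd \<psi>0 q))"
      by (rule has_derivative_transform_within_open[OF _ open_Times[OF A.open_chart_image[OF d(1)] B.open_chart_image[OF d(3)]]])
         (use d chart_inv_prod_chart'[OF d(1,3)] in auto)
    from frechet_derivative_eqI[OF this]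
    show ?thesis
      using P.tangent_transition[OF v prod_chart_at[OF c] prod_chart_at[OF s(2,3)]]
      by (simp add: transition_deriv_prod c s B.transition_deriv_compose \<psi>')
  qed
  then show "tangent_map P B snd (p, q) v \<psi>' = coord_vec B \<psi> q (snd (v (prod_chart \<phi> \<psi>))) \<psi>'"
    by (simp add: tangent_map_def s(1) coord_vec_def Let_def)
qed

lemma prod_form_components:
  assumes v: "v \<in> tangent_space P (p, q)" and w: "w \<in> tangent_space P (p, q)"
    and c: "\<phi> \<in> charts_at A p" "\<psi> \<in> charts_at B q"
  shows "prod_form A B \<epsilon> b1 b2 (p, q) v w =
    coord_form A b1 \<phi> (snd \<phi> p) (fst (v (prod_chart \<phi> \<psi>))) (fst (w (prod_chart \<phi> \<psi>))) +
    \<epsilon> * coord_form B b2 \<psi> (snd \<psi> q) (snd (v (prod_chart \<phi> \<psi>))) (snd (w (prod_chart \<phi> \<psi>)))"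
  using A.charts_at_D[OF c(1)] B.charts_at_D[OF c(2)]
  by (simp add: prod_form_def pullback_form_def tangent_map_fst[OF v c] tangent_map_fst[OF w c]
    tangent_map_snd[OF v c] tangent_map_snd[OF w c] coord_form_def)

lemma coord_form_prod:
  assumes "\<phi> \<in> A" "\<psi> \<in> B" "z \<in> (snd \<phi> ` fst \<phi>) \<times> (snd \<psi> ` fst \<psi>)"
  shows "coord_form P (prod_form A B \<epsilon> b1 b2) (prod_chart \<phi> \<psi>) z u v =
    coord_form A b1 \<phi> (fst z) (fst u) (fst v) + \<epsilon> * coord_form B b2 \<psi> (snd z) (snd u) (snd v)"
proof -
  obtain p q where pq: "p \<in> fst \<phi>" "fst z = snd \<phi> p" "q \<in> fst \<psi>" "snd z = snd \<psi> q" using assms by auto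
  then have z: "z = (snd \<phi> p, snd \<psi> q)" by (simp add: prod_eq_iff)
  have c: "\<phi> \<in> charts_at A p" "\<psi> \<in> charts_at B q" using pq assms A.charts_at_I B.charts_at_I by auto
  have i: "chart_inv (prod_chart \<phi> \<psi>) z = (p, q)" unfolding z by (rule chart_inv_prod_chart[OF assms(1,2) pq(1,3)])
  note pc = prod_chart_at[OF c]
  show ?thesis
    unfolding coord_form_def[of P] i
    unfolding prod_form_components[OF P.coord_vec_tangent[OF pc] P.coord_vec_tangent[OF pc] c] P.coord_vec_same[OF pc]
    by (simp add: z)
qed

text \<open>A tangent vector of the product is determined by its two projections, and any pair of
  tangent vectors arises from one; so the definite description in \<open>prod_endo\<close>
  denotes.\<close>

lemma prod_endo_component:
  assumes v: "v \<in> tangent_space P (p, q)" and c: "\<phi> \<in> charts_at A p" "\<psi> \<in> charts_at B q"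
    and j: "j p ` tangent_space A p \<subseteq> tangent_space A p" and k: "k q ` tangent_space B q \<subseteq> tangent_space B q"
  shows "prod_endo A B j k (p, q) v = coord_vec P (prod_chart \<phi> \<psi>) (p, q)
    (j p (coord_vec A \<phi> p (fst (v (prod_chart \<phi> \<psi>)))) \<phi>, k q (coord_vec B \<psi> q (snd (v (prod_chart \<phi> \<psi>)))) \<psi>)"
  unfolding prod_endo_def
proof (rule the_equality, intro conjI)
  note pc = prod_chart_at[OF c]
  let ?j = "j p (coord_vec A \<phi> p (fst (v (prod_chart \<phi> \<psi>))))" and ?k = "k q (coord_vec B \<psi> q (snd (v (prod_chart \<phi> \<psi>))))"
  have jT: "?j \<in> tangent_space A p" and kT: "?k \<in> tangent_space B q"
    using j k A.coord_vec_tangent[OF c(1)] B.coord_vec_tangent[OF c(2)] by auto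
  let ?w = "coord_vec P (prod_chart \<phi> \<psi>) (p, q) (?j \<phi>, ?k \<psi>)"
  show wT: "?w \<in> tangent_space P (p, q)" by (rule P.coord_vec_tangent[OF pc])
  show "tangent_map P A fst (p, q) ?w = j (fst (p, q)) (tangent_map P A fst (p, q) v)"
    by (simp add: tangent_map_fst[OF wT c] tangent_map_fst[OF v c] P.coord_vec_same[OF pc] A.coord_vec_component[OF jT c(1)])
  show "tangent_map P B snd (p, q) ?w = k (snd (p, q)) (tangent_map P B snd (p, q) v)"
    by (simp add: tangent_map_snd[OF wT c] tangent_map_snd[OF v c] P.coord_vec_same[OF pc] B.coord_vec_component[OF kT c(2)])
  fix w assume w: "w \<in> tangent_space P (p, q) \<and>
         tangent_map P A fst (p, q) w = j (fst (p, q)) (tangent_map P A fst (p, q) v) \<and>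
         tangent_map P B snd (p, q) w = k (snd (p, q)) (tangent_map P B snd (p, q) v)"
  then have "coord_vec A \<phi> p (fst (w (prod_chart \<phi> \<psi>))) = ?j" "coord_vec B \<psi> q (snd (w (prod_chart \<phi> \<psi>))) = ?k"
    using tangent_map_fst[OF _ c] tangent_map_snd[OF _ c] v by auto
  then have "w (prod_chart \<phi> \<psi>) = (?j \<phi>, ?k \<psi>)"
    using A.coord_vec_same[OF c(1)] B.coord_vec_same[OF c(2)] by (metis prod.collapse)
  then show "w = ?w" using P.coord_vec_component[OF _ pc] w by metis
qed

end

section \<open>Oriented Riemannian surfaces\<close>

lemma det_vector_2: "det (vector [v, w] :: real^2^2) = v$1 * w$2 - v$2 * w$1"
  by (simp add: det_2 vector_2)

lemma det_linear_image:
  fixes T :: "real^2 \<Rightarrow> real^2"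
  assumes "linear T"
  shows "det (vector [T v, T w] :: real^2^2) = det (matrix T) * det (vector [v, w] :: real^2^2)"
proof -
  note l = linear_add[OF assms] linear_cmul[OF assms]
  let ?b = "\<lambda>v w. det (vector [T v, T w] :: real^2^2)"
  have "?b v w = ?b (axis 1 1) (axis 2 1) * (v$1 * w$2 - v$2 * w$1)"
    by (rule real2_alternating[of ?b]) (auto intro!: linearI simp: det_vector_2 l algebra_simps)
  moreover have "?b (axis 1 1) (axis 2 1) = det (matrix T)"
    by (simp add: det_vector_2 det_2 matrix_def)
  ultimately show ?thesis by (simp add: det_vector_2)
qed

context local_surface
begin

text \<open>\<open>h x e1 u\<close> times \<open>e2\<close> minus \<open>h x e2 u\<close> times
  \<open>e1\<close> is orthogonal to \<open>u\<close>, and forms a positive determinant with it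
  unless \<open>u\<close> is zero. The square root of the Gram determinant corrects its
  length.\<close>

definition rot where "rot x u = (1 / sqrt (gram x)) *\<^sub>R (h x e1 u *\<^sub>R e2 - h x e2 u *\<^sub>R e1)"

context
  fixes x assumes x: "x \<in> S"
begin

lemma linear_rot: "linear (rot x)"
  unfolding rot_def by (intro linearI) (simp_all add: h_simps[OF x] algebra_simps)

lemma h_axis: "h x e1 u = h x e1 e1 * u$1 + h x e1 e2 * u$2" "h x e2 u = h x e1 e2 * u$1 + h x e2 e2 * u$2"
proof -
  have "h x a u = h x a (u$1 *\<^sub>R e1 + u$2 *\<^sub>R e2)" for a using real2_expansion[of u] by simp
  then show "h x e1 u = h x e1 e1 * u$1 + h x e1 e2 * u$2" "h x e2 u = h x e1 e2 * u$1 + h x e2 e2 * u$2"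
    by (simp_all add: h_simps[OF x] sym[OF x, of e2 e1])
qed

lemma rot_skew: "h x (rot x u) v = - h x u (rot x v)"
  unfolding rot_def
  by (simp add: h_simps[OF x] sym[OF x, of u e1] sym[OF x, of u e2] algebra_simps)

lemma rot_orthogonal: "h x u (rot x u) = 0"
  using rot_skew[of u u] sym[OF x, of u "rot x u"] by simp

lemma rot_rot: "rot x (rot x u) = - u"
proof -
  have g: "gram x > 0" by (rule gram_pos[OF x])
  have s: "(1 / sqrt (gram x)) * (1 / sqrt (gram x)) = 1 / gram x" using g by simp
  have 1: "h x e1 (h x e1 u *\<^sub>R e2 - h x e2 u *\<^sub>R e1) = - (gram x * u$2)"
    unfolding gram_def by (simp add: h_simps[OF x] h_axis[of u] power2_eq_square algebra_simps)
  have 2: "h x e2 (h x e1 u *\<^sub>R e2 - h x e2 u *\<^sub>R e1) = gram x * u$1"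
    unfolding gram_def by (simp add: h_simps[OF x] h_axis[of u] sym[OF x, of e2 e1] power2_eq_square algebra_simps)
  have "rot x (rot x u) = ((1 / sqrt (gram x)) * (1 / sqrt (gram x))) *\<^sub>R (h x e1 (h x e1 u *\<^sub>R e2 - h x e2 u *\<^sub>R e1) *\<^sub>R e2
      - h x e2 (h x e1 u *\<^sub>R e2 - h x e2 u *\<^sub>R e1) *\<^sub>R e1)"
    unfolding rot_def[of x "rot x u"] unfolding rot_def h_simps(6)[OF x]
    by (simp add: scaleR_diff_right)
  also have "\<dots> = - (u$1 *\<^sub>R e1 + u$2 *\<^sub>R e2)"
    unfolding s 1 2 using g by (simp add: scaleR_diff_right)
  finally show ?thesis using real2_expansion[of u] by simp
qed

lemma rot_isometric: "h x (rot x u) (rot x v) = h x u v"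
  using rot_skew[of u "rot x v"] by (simp add: rot_rot h_simps[OF x])

lemma det_rot: "det (vector [u, rot x u] :: real^2^2) = h x u u / sqrt (gram x)"
proof -
  have "h x u u = h x (u$1 *\<^sub>R e1 + u$2 *\<^sub>R e2) u" using real2_expansion[of u] by simp
  also have "\<dots> = u$1 * h x e1 u + u$2 * h x e2 u" by (simp add: h_simps[OF x])
  finally have *: "h x u u = u$1 * h x e1 u + u$2 * h x e2 u" .
  show ?thesis unfolding * by (simp add: det_vector_2 rot_def axis_def add_divide_distrib algebra_simps)
qed

text \<open>Removing from \<open>w\<close> its component along \<open>rot x u\<close> leaves a
  vector orthogonal to both \<open>u\<close> and \<open>rot x u\<close>, hence zero. The equality of
  lengths leaves a sign, which the orientation fixes.\<close>

lemma rot_unique: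
  assumes "h x u w = 0" "h x w w = h x u u" "u \<noteq> 0 \<Longrightarrow> det (vector [u, w] :: real^2^2) > 0"
  shows "w = rot x u"
proof (cases "u = 0")
  case True
  then have "w = 0" using assms(2) pos[OF x, of w] by (auto simp: h_simps[OF x])
  then show ?thesis using True linear_0[OF linear_rot] by simp
next
  case False
  have p: "h x u u > 0" by (rule pos[OF x False])
  have dpos: "det (vector [u, rot x u] :: real^2^2) > 0" unfolding det_rot using p gram_pos[OF x] by simp
  define c where "c = h x w (rot x u) / h x u u"
  define z where "z = w - c *\<^sub>R rot x u"
  have zu: "h x u z = 0" by (simp add: z_def h_simps[OF x] assms(1) rot_orthogonal)
  have "h x (rot x u) w = h x w (rot x u)" by (rule sym[OF x])
  then have zr: "h x (rot x u) z = 0" using p by (simp add: z_def h_simps[OF x] rot_isometric c_def)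
  have "u$1 * rot x u$2 - u$2 * rot x u$1 \<noteq> 0" using dpos by (simp add: det_vector_2)
  \<comment> \<open>In \<open>gram_eq\<close> the left-hand side vanishes by \<open>zu\<close> and
    \<open>zr\<close>, while the Gram determinant and the determinant of \<open>u\<close> and
    \<open>rot x u\<close> do not.\<close>
  then have "z$1 * v$2 - z$2 * v$1 = 0" for v :: "real^2"
    using gram_eq[OF x, of "rot x u" v u z] gram_pos[OF x] by (simp add: zu zr)
  from this[of e1] this[of e2] have "z = 0" by (simp add: axis_def vec_eq_iff forall_2)
  then have w: "w = c *\<^sub>R rot x u" by (simp add: z_def)
  have "c * c = 1" using assms(2) p unfolding w by (simp add: h_simps[OF x] rot_isometric)
  moreover have "det (vector [u, w] :: real^2^2) = c * det (vector [u, rot x u] :: real^2^2)"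
    unfolding w det_vector_2 by (simp add: algebra_simps)
  with assms(3)[OF False] dpos have "c > 0" by (simp add: zero_less_mult_iff)
  ultimately have "c = 1" by (metis mult_cancel_right1 abs_of_pos abs_mult_self_eq less_irrefl mult.right_neutral real_sqrt_abs2 real_sqrt_one)
  then show ?thesis using w by simp
qed

end

lemma smooth_rot: "smooth_on S (\<lambda>x. rot x u)"
proof -
  have sg: "smooth_on S gram"
    unfolding gram_def power2_eq_square by (intro smooth_on_diff smooth_on_mult open_S smooth)
  have "smooth_on S (\<lambda>x. inverse (sqrt (gram x)) *\<^sub>R (h x e1 u *\<^sub>R e2 - h x e2 u *\<^sub>R e1))"
    by (intro smooth_on_scaleR smooth_on_diff smooth_on_const smooth smooth_on_inverse smooth_on_sqrt open_S sg)
       (simp_all add: gram_pos)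
  then show ?thesis by (simp add: rot_def divide_inverse)
qed

end

locale riemannian_surface = atlas X A for X :: "'a topology" and A :: "('a, real^2) chart set" +
  fixes g :: "('a, real^2) form"
  assumes oriented: "oriented_atlas A" and metric: "riemannian_metric X A g"
begin

lemma smooth_form: "smooth_form X A g" and symmetric_form: "symmetric_form X A g"
  and metric_pos: "p \<in> topspace X \<Longrightarrow> v \<in> tangent_space A p \<Longrightarrow> v \<noteq> 0 \<Longrightarrow> g p v v > 0"
  using metric by (auto simp: riemannian_metric_def)

lemma local_surface_coord_form:
  assumes "\<phi> \<in> A"
  shows "local_surface (snd \<phi> ` fst \<phi>) (coord_form A g \<phi>)"
proof (intro local_surface.intro local_surface_axioms.intro local_metric_coord_form[OF smooth_form symmetric_form _ assms])
  show "nondegenerate_on (tangent_space A p) (g p)" if "p \<in> topspace X" for p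
    using metric_pos[OF that] unfolding nondegenerate_on_def by fastforce
  fix x and u :: "real^2" assume "x \<in> snd \<phi> ` fst \<phi>" "u \<noteq> 0"
  then obtain p where p: "x = snd \<phi> p" "p \<in> fst \<phi>" by auto
  have c: "\<phi> \<in> charts_at A p" by (rule charts_at_I[OF assms p(2)])
  have "coord_vec A \<phi> p u \<noteq> 0"
    using coord_vec_same[OF c, of u] \<open>u \<noteq> 0\<close> by (metis zero_fun_apply)
  then show "coord_form A g \<phi> x u u > 0"
    using metric_pos[OF _ coord_vec_tangent[OF c]] chart_subset[OF assms] p assms by (auto simp: coord_form_def)
qed

lemma chart_image: "\<phi> \<in> charts_at A p \<Longrightarrow> snd \<phi> p \<in> snd \<phi> ` fst \<phi>"
  by (auto simp: charts_at_def)

text \<open>Existence in the definite description is \<open>curvature_eq_gauss\<close> read in one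
  chart; uniqueness holds because the coordinate vectors have a nonzero Gram determinant.\<close>

lemma gauss_curvature_eq:
  assumes c: "\<phi> \<in> charts_at A p"
  shows "gauss_curvature A g p = gauss (coord_form A g \<phi>) (snd \<phi> p)"
proof -
  note d = charts_at_D[OF c]
  interpret L: local_surface "snd \<phi> ` fst \<phi>" "coord_form A g \<phi>" by (rule local_surface_coord_form[OF d(1)])
  let ?h = "coord_form A g \<phi> (snd \<phi> p)"
  note x = chart_image[OF c]
  have lm: "local_metric (coords \<psi> (topspace X)) (coord_form A g \<psi>)" if "\<psi> \<in> A" for \<psi>
  proof -
    interpret M: local_surface "snd \<psi> ` fst \<psi>" "coord_form A g \<psi>" by (rule local_surface_coord_form[OF that])
    show ?thesis using M.local_metric_axioms chart_subset[OF that] by (simp add: Int_absorb2)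
  qed
  \<comment> \<open>\<open>riemann_tensor\<close> is computed separately in every chart. Only after
    the components are known to form a tangent vector can \<open>g\<close> be evaluated on it in the
    chart \<phi> alone.\<close>
  have R: "riemann_tensor A g p u v w \<in> tangent_space A p"
    if T: "u \<in> tangent_space A p" "v \<in> tangent_space A p" "w \<in> tangent_space A p" for u v w
  proof -
    have "riemann_tensor A g p u v w \<psi> = transition_deriv p \<phi>' \<psi> (riemann_tensor A g p u v w \<phi>')"
      if c': "\<phi>' \<in> charts_at A p" "\<psi> \<in> charts_at A p" for \<phi>' \<psi>
      using curvature_change[OF lm openin_topspace _ c', of "u \<phi>'" "v \<phi>'" "w \<phi>'"] c' chart_subset[OF d(1)] d(2)
      by (auto simp: riemann_tensor_def coord_curvature_eq tangent_transition[OF T(1) c', symmetric]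
         tangent_transition[OF T(2) c', symmetric] tangent_transition[OF T(3) c', symmetric])
    moreover have "riemann_tensor A g p u v w \<phi>' = 0" if "\<phi>' \<notin> charts_at A p" for \<phi>'
      by (simp add: riemann_tensor_def that)
    ultimately show ?thesis unfolding tangent_space_def by blast
  qed
  have eq: "g p (riemann_tensor A g p u v v) u = ?h (curvature (coord_form A g \<phi>) (snd \<phi> p) (u \<phi>) (v \<phi>) (v \<phi>)) (u \<phi>)"
    "g p u u * g p v v - (g p u v)\<^sup>2 = ?h (u \<phi>) (u \<phi>) * ?h (v \<phi>) (v \<phi>) - (?h (u \<phi>) (v \<phi>))\<^sup>2"
    if T: "u \<in> tangent_space A p" "v \<in> tangent_space A p" for u v
    using form_eq_coord_form[OF R[OF T T(2)] T(1) c, of g] form_eq_coord_form[OF T c, of g]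
      form_eq_coord_form[OF T(1) T(1) c, of g] form_eq_coord_form[OF T(2) T(2) c, of g] c
    by (simp_all add: riemann_tensor_def coord_curvature_eq)
  have K: "?h (curvature (coord_form A g \<phi>) (snd \<phi> p) u v v) u =
     gauss (coord_form A g \<phi>) (snd \<phi> p) * (?h u u * ?h v v - (?h u v)\<^sup>2)" for u v
    unfolding L.curvature_eq_gauss[OF x] by (simp add: L.h_simps[OF x] power2_eq_square L.sym[OF x, of v u] algebra_simps)
  show ?thesis
    unfolding gauss_curvature_def
  proof (rule the_equality)
    show "\<forall>u\<in>tangent_space A p. \<forall>v\<in>tangent_space A p.
      g p (riemann_tensor A g p u v v) u = gauss (coord_form A g \<phi>) (snd \<phi> p) * (g p u u * g p v v - (g p u v)\<^sup>2)"
      by (simp add: eq K)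
    fix k assume k: "\<forall>u\<in>tangent_space A p. \<forall>v\<in>tangent_space A p.
      g p (riemann_tensor A g p u v v) u = k * (g p u u * g p v v - (g p u v)\<^sup>2)"
    let ?u = "coord_vec A \<phi> p L.e1" and ?v = "coord_vec A \<phi> p L.e2"
    note T = coord_vec_tangent[OF c, of L.e1] coord_vec_tangent[OF c, of L.e2]
    have "k * (g p ?u ?u * g p ?v ?v - (g p ?u ?v)\<^sup>2) = gauss (coord_form A g \<phi>) (snd \<phi> p) * (g p ?u ?u * g p ?v ?v - (g p ?u ?v)\<^sup>2)"
      using k T by (metis K eq)
    then show "k = gauss (coord_form A g \<phi>) (snd \<phi> p)"
      using L.gram_pos[OF x] by (simp add: eq[OF T] coord_vec_same[OF c] L.gram_def)
  qed
qed

abbreviation rot_at where "rot_at \<phi> \<equiv> local_surface.rot (coord_form A g \<phi>)"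

text \<open>Orientation is demanded in all charts at \<open>p\<close>, but transition maps of an
  oriented atlas preserve the sign of the determinant, so one chart decides. Uniqueness is
  \<open>rot_unique\<close>.\<close>

lemma rotation_eq:
  assumes v: "v \<in> tangent_space A p" and c: "\<phi> \<in> charts_at A p"
  shows "rotation A g p v = coord_vec A \<phi> p (rot_at \<phi> (snd \<phi> p) (v \<phi>))"
proof -
  note d = charts_at_D[OF c]
  interpret L: local_surface "snd \<phi> ` fst \<phi>" "coord_form A g \<phi>" by (rule local_surface_coord_form[OF d(1)])
  note x = chart_image[OF c]
  let ?w = "coord_vec A \<phi> p (L.rot (snd \<phi> p) (v \<phi>))"
  have wT: "?w \<in> tangent_space A p" by (rule coord_vec_tangent[OF c])
  have ne: "v \<phi> \<noteq> 0" if "v \<noteq> 0"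
    using coord_vec_component[OF v c] that linear_0[OF linear_coord_vec[OF c]] by metis
  show ?thesis
    unfolding rotation_def
  proof (rule the_equality, intro conjI impI)
    show "?w \<in> tangent_space A p" by (rule wT)
    show "g p v ?w = 0" "g p ?w ?w = g p v v"
      using form_eq_coord_form[OF v wT c, of g] form_eq_coord_form[OF wT wT c, of g] form_eq_coord_form[OF v v c, of g]
      by (simp_all add: coord_vec_same[OF c] L.rot_orthogonal[OF x] L.rot_isometric[OF x])
    assume "v \<noteq> 0"
    show "positively_oriented A p v ?w"
      unfolding positively_oriented_def
    proof
      fix \<psi> assume c': "\<psi> \<in> charts_at A p"
      have "det (vector [v \<psi>, ?w \<psi>] :: real^2^2) = det (matrix (transition_deriv p \<phi> \<psi>)) * det (vector [v \<phi>, ?w \<phi>] :: real^2^2)"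
        unfolding tangent_transition[OF v c c'] tangent_transition[OF wT c c']
        by (rule det_linear_image[OF linear_transition[OF c c']])
      also have "\<dots> > 0"
        using oriented c' charts_at_D[OF c'] d L.pos[OF x ne[OF \<open>v \<noteq> 0\<close>]] L.gram_pos[OF x]
        unfolding oriented_atlas_def coord_vec_same[OF c] L.det_rot[OF x] by (intro mult_pos_pos) auto
      finally show "det (vector [v \<psi>, ?w \<psi>] :: real^2^2) > 0" .
    qed
  next
    fix w assume w: "w \<in> tangent_space A p \<and> g p v w = 0 \<and> g p w w = g p v v \<and> (v \<noteq> 0 \<longrightarrow> positively_oriented A p v w)"
    have "w \<phi> = L.rot (snd \<phi> p) (v \<phi>)"
    proof (rule L.rot_unique[OF x])
      show "coord_form A g \<phi> (snd \<phi> p) (v \<phi>) (w \<phi>) = 0"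
        "coord_form A g \<phi> (snd \<phi> p) (w \<phi>) (w \<phi>) = coord_form A g \<phi> (snd \<phi> p) (v \<phi>) (v \<phi>)"
        using w form_eq_coord_form[OF v _ c, of _ g] form_eq_coord_form[OF _ _ c, of w w g] form_eq_coord_form[OF v v c, of g] by auto
      show "det (vector [v \<phi>, w \<phi>] :: real^2^2) > 0" if "v \<phi> \<noteq> 0"
      proof -
        have "v \<noteq> 0" using that by (metis zero_fun_apply)
        then show ?thesis using w c unfolding positively_oriented_def by blast
      qed
    qed
    then show "w = ?w" using coord_vec_component[OF _ c, of w] w by simp
  qed
qed

lemma rotation_tangent:
  assumes "p \<in> topspace X"
  shows "rotation A g p ` tangent_space A p \<subseteq> tangent_space A p"
proof -
  obtain \<phi> where c: "\<phi> \<in> charts_at A p" using ex_chart[OF assms] by blast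
  show ?thesis using rotation_eq[OF _ c] coord_vec_tangent[OF c] by auto
qed

lemma coord_form_area_form:
  assumes "\<phi> \<in> A" "x \<in> snd \<phi> ` fst \<phi>"
  shows "coord_form A (area_form A g) \<phi> x u v = coord_form A g \<phi> x (rot_at \<phi> x u) v"
proof -
  obtain p where p: "x = snd \<phi> p" "p \<in> fst \<phi>" using assms by auto
  have c: "\<phi> \<in> charts_at A p" by (rule charts_at_I[OF assms(1) p(2)])
  show ?thesis
    using assms p by (simp add: coord_form_def area_form_def rotation_eq[OF coord_vec_tangent[OF c] c] coord_vec_same[OF c])
qed

end

section \<open>Torsion of the rotation and closedness of the area form in a chart\<close>

context local_surface
begin

context
  fixes x assumes x: "x \<in> S"
begin

lemma linear_drot: "linear (dd (\<lambda>y. rot y u) x)" "linear (\<lambda>u. dd (\<lambda>y. rot y u) x t)"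
  using has_derivative_linear[OF smooth_on_has_derivative[OF smooth_rot x]]
    linear_derivative_family[OF open_S x linear_rot smooth_on_imp_differentiable[OF smooth_rot x]] by auto

text \<open>The derivative of the constant identity \<open>rot y (rot y u) = - u\<close>: the
  derivative of a complex structure anticommutes with it.\<close>

lemma drot_rot: "dd (\<lambda>y. rot y (rot x u)) x t = - rot x (dd (\<lambda>y. rot y u) x t)"
proof -
  have "((\<lambda>y. rot y (rot y u)) has_derivative (\<lambda>t. dd (\<lambda>y. rot y (rot x u)) x t + rot x (dd (\<lambda>y. rot y u) x t))) (at x)"
    by (rule has_derivative_linear_family(1)[OF open_S x linear_rot smooth_on_imp_differentiable[OF smooth_rot x]
        smooth_on_has_derivative[OF smooth_rot x]])
  then have "((\<lambda>y. - u) has_derivative (\<lambda>t. dd (\<lambda>y. rot y (rot x u)) x t + rot x (dd (\<lambda>y. rot y u) x t))) (at x)"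
    by (rule has_derivative_transform_within_open[OF _ open_S x]) (simp add: rot_rot)
  then have "(\<lambda>t. dd (\<lambda>y. rot y (rot x u)) x t + rot x (dd (\<lambda>y. rot y u) x t)) = (\<lambda>t. 0)"
    by (rule has_derivative_unique[OF _ has_derivative_const])
  then show ?thesis by (simp add: fun_eq_iff add_eq_0_iff)
qed

text \<open>In dimension two an alternating bilinear map vanishes as soon as it vanishes on one pair \<open>u, rot u\<close>.\<close>

lemma nijenhuis_rot:
  "dd (\<lambda>y. rot y w) x (rot x v) - dd (\<lambda>y. rot y v) x (rot x w)
    + rot x (dd (\<lambda>y. rot y v) x w) - rot x (dd (\<lambda>y. rot y w) x v) = 0"
proof -
  define nj where "nj v w = dd (\<lambda>y. rot y w) x (rot x v) - dd (\<lambda>y. rot y v) x (rot x w)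
    + rot x (dd (\<lambda>y. rot y v) x w) - rot x (dd (\<lambda>y. rot y w) x v)" for v w
  note l = linear_add[OF linear_rot[OF x]] linear_cmul[OF linear_rot[OF x]] linear_add[OF linear_drot(1)]
    linear_cmul[OF linear_drot(1)] linear_add[OF linear_drot(2)] linear_cmul[OF linear_drot(2)]
    linear_neg[OF linear_rot[OF x]] linear_neg[OF linear_drot(1)]
  have alt: "nj v w $ i = nj e1 e2 $ i * (v$1 * w$2 - v$2 * w$1)" for v w i
    by (rule real2_alternating[of "\<lambda>v w. nj v w $ i"]) (auto intro!: linearI simp: nj_def l algebra_simps)
  \<comment> \<open>By \<open>drot_rot\<close> and \<open>rot_rot\<close> the first term cancels the
    third and the second cancels the fourth.\<close>
  have "nj e1 (rot x e1) = 0" by (simp add: nj_def drot_rot rot_rot[OF x] l)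
  moreover have "e1 $ 1 * rot x e1 $ 2 - e1 $ 2 * rot x e1 $ 1 > 0"
    unfolding det_vector_2[symmetric] det_rot[OF x]
    by (intro divide_pos_pos pos[OF x]) (simp_all add: gram_pos[OF x])
  ultimately have "nj e1 e2 $ i = 0" for i
    using alt[of e1 "rot x e1" i] by (metis less_irrefl mult_eq_0_iff zero_index)
  then have "nj v w $ i = 0" for i by (subst alt) simp
  then have "nj v w = 0" by (simp add: vec_eq_iff)
  then show ?thesis by (simp add: nj_def)
qed

text \<open>The area form is a scalar function times the constant determinant. Its exterior
  derivative is the differential of that function wedged with the determinant, a 3-form in two
  variables; expanding the differential in the two coordinates makes this explicit.\<close>

lemma area_closed:
  "dd (\<lambda>y. h y (rot y v) w) x u - dd (\<lambda>y. h y (rot y u) w) x v + dd (\<lambda>y. h y (rot y u) v) x w = 0"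
proof -
  let ?c = "\<lambda>y. h y (rot y e1) e2"
  have area: "h y (rot y a) b = (a$1 * b$2 - a$2 * b$1) * ?c y" if y: "y \<in> S" for y a b
  proof -
    have "h y (rot y a) b = h y (rot y e1) e2 * (a$1 * b$2 - a$2 * b$1)"
    proof (rule real2_alternating)
      show "linear (\<lambda>a. h y (rot y a) b)" for b
        using linear_compose[OF linear_rot[OF y] lin'[OF y]] by (simp add: o_def)
      show "h y (rot y a) a = 0" for a
        using rot_orthogonal[OF y, of a] sym[OF y, of "rot y a" a] by simp
    qed (rule lin[OF y])
    then show ?thesis by simp
  qed
  have "smooth_on S ?c"
    by (rule smooth_on_bilinear_family[OF open_S lin' lin smooth smooth_rot smooth_on_const[OF open_S]])
  then have dc: "(?c has_derivative dd ?c x) (at x)" using x by (rule smooth_on_has_derivative)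
  have d: "dd (\<lambda>y. h y (rot y a) b) x = (\<lambda>t. (a$1 * b$2 - a$2 * b$1) * dd ?c x t)" for a b
    by (rule has_derivative_unique_dd[OF has_derivative_mult_right[OF dc] open_S x]) (rule area[symmetric])
  note l = has_derivative_linear[OF dc]
  have dt: "dd ?c x t = t$1 * dd ?c x e1 + t$2 * dd ?c x e2" for t
    by (rule trans[OF arg_cong[OF real2_expansion]]) (simp only: linear_add[OF l] linear_cmul[OF l] real_scaleR_def)
  show ?thesis
    unfolding d[of v w] d[of u w] d[of u v] dt[of u] dt[of v] dt[of w] by (simp add: algebra_simps)
qed

end

end

section \<open>Nijenhuis torsion and exterior derivative in a chart\<close>

context atlas
begin

abbreviation coord_endo where "coord_endo J \<phi> x u \<equiv> J (chart_inv \<phi> x) (coord_vec A \<phi> (chart_inv \<phi> x) u) \<phi>"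

lemma endo_component:
  assumes "v \<in> tangent_space A p" "\<phi> \<in> charts_at A p"
  shows "J p v \<phi> = coord_endo J \<phi> (snd \<phi> p) (v \<phi>)"
  using assms charts_at_D[OF assms(2)] by (simp add: coord_vec_component)

lemma linear_coord_endo:
  assumes J: "smooth_endo X A J" and \<phi>: "\<phi> \<in> A" and x: "x \<in> snd \<phi> ` fst \<phi>"
  shows "linear (coord_endo J \<phi> x)"
proof -
  obtain p where p: "x = snd \<phi> p" "p \<in> fst \<phi>" using x by auto
  have c: "\<phi> \<in> charts_at A p" by (rule charts_at_I[OF \<phi> p(2)])
  have L: "linear_endo_on (tangent_space A p) (J p)"
    using J chart_subset[OF \<phi>] p unfolding smooth_endo_def by blast
  have *: "J p (a *\<^sub>R coord_vec A \<phi> p u + b *\<^sub>R coord_vec A \<phi> p v) = a *\<^sub>R J p (coord_vec A \<phi> p u) + b *\<^sub>R J p (coord_vec A \<phi> p v)" for a b u v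
    using L coord_vec_tangent[OF c] unfolding linear_endo_on_def by blast
  show ?thesis
  proof (rule linearI)
    show "coord_endo J \<phi> x (u + v) = coord_endo J \<phi> x u + coord_endo J \<phi> x v" for u v
      using *[of 1 u 1 v] p \<phi> by (simp add: linear_add[OF linear_coord_vec[OF c]])
    show "coord_endo J \<phi> x (r *\<^sub>R u) = r *\<^sub>R coord_endo J \<phi> x u" for r u
    proof -
      have "J p (r *\<^sub>R coord_vec A \<phi> p u) = r *\<^sub>R J p (coord_vec A \<phi> p u)" using *[of r u 0 u] by simp
      moreover have "(r *\<^sub>R f) \<phi> = r *\<^sub>R f \<phi>" for f :: "('a, 'e) chart \<Rightarrow> 'e"
        by (simp add: scaleR_fun_def)
      ultimately show ?thesis using p \<phi> by (simp add: linear_cmul[OF linear_coord_vec[OF c]])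
    qed
  qed
qed

lemma smooth_coord_endo: "smooth_endo X A J \<Longrightarrow> \<phi> \<in> A \<Longrightarrow> smooth_on (snd \<phi> ` fst \<phi>) (\<lambda>x. coord_endo J \<phi> x u)"
  by (simp add: smooth_endo_def)

lemma endo_tangent: "smooth_endo X A J \<Longrightarrow> p \<in> topspace X \<Longrightarrow> v \<in> tangent_space A p \<Longrightarrow> J p v \<in> tangent_space A p"
  unfolding smooth_endo_def linear_endo_on_def by blast

lemma endo_field_coords:
  assumes J: "smooth_endo X A J" and V: "smooth_vector_field A U V" and \<phi>: "\<phi> \<in> A" and x: "x \<in> coords \<phi> U"
  shows "J (chart_inv \<phi> x) (V (chart_inv \<phi> x)) \<phi> = coord_endo J \<phi> x (V (chart_inv \<phi> x) \<phi>)"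
proof -
  obtain p where p: "x = snd \<phi> p" "p \<in> fst \<phi>" "p \<in> U" using x by auto
  show ?thesis
    using endo_component[OF smooth_vector_field_tangent[OF V p(3)] charts_at_I[OF \<phi> p(2)]] p \<phi> by simp
qed

lemma smooth_vector_field_endo:
  assumes J: "smooth_endo X A J" and U: "openin X U" and V: "smooth_vector_field A U V"
  shows "smooth_vector_field A U (\<lambda>q. J q (V q))"
  unfolding smooth_vector_field_def
proof (intro conjI ballI)
  show "J p (V p) \<in> tangent_space A p" if "p \<in> U" for p
    by (rule endo_tangent[OF J _ smooth_vector_field_tangent[OF V that]]) (use U that openin_subset in blast)
  fix \<phi> assume \<phi>: "\<phi> \<in> A"
  have o: "open (coords \<phi> U)" by (rule open_coords[OF \<phi> U])
  have "smooth_on (coords \<phi> U) (\<lambda>x. coord_endo J \<phi> x (V (chart_inv \<phi> x) \<phi>))"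
    by (rule smooth_on_linear_family[where L="coord_endo J \<phi>", OF o linear_coord_endo[OF J \<phi>]
        smooth_on_subset[OF smooth_coord_endo[OF J \<phi>]] smooth_vector_field_coords[OF V \<phi>]]) auto
  then show "smooth_on (coords \<phi> U) (\<lambda>x. J (chart_inv \<phi> x) (V (chart_inv \<phi> x)) \<phi>)"
    using smooth_on_cong[OF o, of "\<lambda>x. J (chart_inv \<phi> x) (V (chart_inv \<phi> x)) \<phi>" "\<lambda>x. coord_endo J \<phi> x (V (chart_inv \<phi> x) \<phi>)"]
      endo_field_coords[OF J V \<phi>] by simp
qed

text \<open>Tensoriality: the derivatives of the two fields cancel because the square of
  \<open>K x\<close> is minus the identity. Only the derivatives of the endomorphism on frozen
  vectors remain.\<close>

lemma nijenhuis_coords: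
  assumes J: "almost_complex X A J" and U: "openin X U" and V: "smooth_vector_field A U V" and W: "smooth_vector_field A U W"
    and p: "p \<in> U" and c: "\<phi> \<in> charts_at A p"
    and eqs: "x = snd \<phi> p" "v = V p \<phi>" "w = W p \<phi>" "K = coord_endo J \<phi>"
  shows "nijenhuis A J V W p \<phi> = dd (\<lambda>y. K y w) x (K x v) - dd (\<lambda>y. K y v) x (K x w)
    + K x (dd (\<lambda>y. K y v) x w) - K x (dd (\<lambda>y. K y w) x v)"
proof -
  note d = charts_at_D[OF c]
  have sJ: "smooth_endo X A J" using J by (simp add: almost_complex_def)
  have pX: "p \<in> topspace X" using U p openin_subset by blast
  have o: "open (coords \<phi> U)" by (rule open_coords[OF d(1) U])
  have xU: "x \<in> coords \<phi> U" and xS: "x \<in> snd \<phi> ` fst \<phi>" using d p eqs by auto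
  note sJV = smooth_vector_field_endo[OF sJ U V] and sJW = smooth_vector_field_endo[OF sJ U W]
  have lK: "linear (K y)" if "y \<in> coords \<phi> U" for y
    unfolding eqs by (rule linear_coord_endo[OF sJ d(1)]) (use that in auto)
  have KK: "K x (K x u) = - u" for u
  proof -
    have T: "coord_vec A \<phi> p u \<in> tangent_space A p" by (rule coord_vec_tangent[OF c])
    have "J p (J p (coord_vec A \<phi> p u)) = - coord_vec A \<phi> p u"
      using J pX T unfolding almost_complex_def by blast
    then have "J p (J p (coord_vec A \<phi> p u)) \<phi> = - u" using coord_vec_same[OF c] by simp
    then show ?thesis
      unfolding endo_component[OF endo_tangent[OF sJ pX T] c] unfolding endo_component[OF T c] eqs coord_vec_same[OF c] .
  qed
  have dF: "((\<lambda>y. F (chart_inv \<phi> y) \<phi>) has_derivative dd (\<lambda>y. F (chart_inv \<phi> y) \<phi>) x) (at x)" if "smooth_vector_field A U F" for F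
    by (rule smooth_on_has_derivative[OF smooth_vector_field_coords[OF that d(1)] xU])
  have dJF: "dd (\<lambda>y. J (chart_inv \<phi> y) (F (chart_inv \<phi> y)) \<phi>) x t = dd (\<lambda>y. K y (F p \<phi>)) x t + K x (dd (\<lambda>y. F (chart_inv \<phi> y) \<phi>) x t)"
    if F: "smooth_vector_field A U F" for F t
  proof -
    have "((\<lambda>y. K y (F (chart_inv \<phi> y) \<phi>)) has_derivative
      (\<lambda>t. dd (\<lambda>y. K y (F (chart_inv \<phi> x) \<phi>)) x t + K x (dd (\<lambda>y. F (chart_inv \<phi> y) \<phi>) x t))) (at x)"
      by (rule has_derivative_linear_family(1)[OF o xU lK _ dF[OF F]])
         (use smooth_on_imp_differentiable[OF smooth_coord_endo[OF sJ d(1)] xS] eqs in auto)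
    from has_derivative_unique_dd[OF this o xU, of "\<lambda>y. J (chart_inv \<phi> y) (F (chart_inv \<phi> y)) \<phi>"]
    show ?thesis using endo_field_coords[OF sJ F d(1)] eqs d by simp
  qed
  have lieJ: "J p (lie_bracket A F H p) \<phi> = K x (lie_bracket A F H p \<phi>)"
    if "smooth_vector_field A U F" "smooth_vector_field A U H" for F H
    using endo_component[OF lie_bracket_tangent[OF U that p] c] eqs by simp
  have lie: "lie_bracket A F H p \<phi> = dd (\<lambda>y. H (chart_inv \<phi> y) \<phi>) x (F p \<phi>) - dd (\<lambda>y. F (chart_inv \<phi> y) \<phi>) x (H p \<phi>)" for F H
    using c eqs by (simp add: lie_bracket_def)
  have JF: "J p (F p) \<phi> = K x (F p \<phi>)" if "smooth_vector_field A U F" for F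
    using endo_component[OF smooth_vector_field_tangent[OF that p] c] eqs by simp
  show ?thesis
    unfolding nijenhuis_def
    by (simp add: lieJ[OF sJV W] lieJ[OF V sJW])
       (simp add: lie dJF[OF V] dJF[OF W] JF[OF V] JF[OF W] linear_add[OF lK[OF xU]] linear_diff[OF lK[OF xU]] KK eqs(2,3)[symmetric])
qed

text \<open>The derivatives of the fields in the three directional derivatives are cancelled by the
  bracket terms, by skewness of the form. The chart is \<open>some_chart A p\<close> because
  \<open>directional_deriv\<close> is evaluated in that one.\<close>

lemma exterior_deriv_coords:
  assumes \<Omega>: "smooth_form X A \<Omega>" and skew: "\<And>q v. q \<in> topspace X \<Longrightarrow> v \<in> tangent_space A q \<Longrightarrow> \<Omega> q v v = 0"
    and S: "openin X S" and U: "smooth_vector_field A S U" and V: "smooth_vector_field A S V" and W: "smooth_vector_field A S W"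
    and p: "p \<in> S" and \<phi>: "\<phi> = some_chart A p"
    and eqs: "x = snd \<phi> p" "u = U p \<phi>" "v = V p \<phi>" "w = W p \<phi>" "K = coord_form A \<Omega> \<phi>"
  shows "exterior_deriv A \<Omega> U V W p = dd (\<lambda>y. K y v w) x u - dd (\<lambda>y. K y u w) x v + dd (\<lambda>y. K y u v) x w"
proof -
  have pX: "p \<in> topspace X" using S p openin_subset by blast
  have c: "\<phi> \<in> charts_at A p" unfolding \<phi> by (rule some_chart_at[OF pX])
  note d = charts_at_D[OF c]
  have o: "open (coords \<phi> S)" by (rule open_coords[OF d(1) S])
  have xS: "x \<in> coords \<phi> S" and xI: "x \<in> snd \<phi> ` fst \<phi>" using d p eqs by auto
  have lK: "linear (K y a)" "linear (\<lambda>a. K y a b)" if "y \<in> coords \<phi> S" for y a b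
    unfolding eqs by (rule coord_form_bilinear[OF \<Omega> d(1)]; use that in auto)+
  note Ks = linear_diff[OF lK(1)[OF xS]] linear_diff[OF lK(2)[OF xS]] linear_add[OF lK(1)[OF xS]] linear_add[OF lK(2)[OF xS]]
  have Kaa: "K x a a = 0" for a
    using skew[OF pX coord_vec_tangent[OF c]] d eqs by (simp add: coord_form_def)
  have Kskew: "K x a b = - K x b a" for a b
    using Kaa[of "a + b"] Kaa[of a] Kaa[of b] by (simp add: Ks)
  have dF: "((\<lambda>y. F (chart_inv \<phi> y) \<phi>) has_derivative dd (\<lambda>y. F (chart_inv \<phi> y) \<phi>) x) (at x)" if "smooth_vector_field A S F" for F
    by (rule smooth_on_has_derivative[OF smooth_vector_field_coords[OF that d(1)] xS])
  have dir: "directional_deriv A p T (\<lambda>q. \<Omega> q (F q) (H q)) = dd (\<lambda>y. K y (F p \<phi>) (H p \<phi>)) x (T \<phi>)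
     + K x (dd (\<lambda>y. F (chart_inv \<phi> y) \<phi>) x (T \<phi>)) (H p \<phi>) + K x (F p \<phi>) (dd (\<lambda>y. H (chart_inv \<phi> y) \<phi>) x (T \<phi>))"
    if F: "smooth_vector_field A S F" and H: "smooth_vector_field A S H" for F H T
  proof -
    have "((\<lambda>y. K y (F (chart_inv \<phi> y) \<phi>) (H (chart_inv \<phi> y) \<phi>)) has_derivative
      (\<lambda>t. dd (\<lambda>y. K y (F (chart_inv \<phi> x) \<phi>) (H (chart_inv \<phi> x) \<phi>)) x t
       + K x (dd (\<lambda>y. F (chart_inv \<phi> y) \<phi>) x t) (H (chart_inv \<phi> x) \<phi>) + K x (F (chart_inv \<phi> x) \<phi>) (dd (\<lambda>y. H (chart_inv \<phi> y) \<phi>) x t))) (at x)"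
      by (rule has_derivative_bilinear_family[OF o xS lK(2) lK(1) _ dF[OF F] dF[OF H]])
         (use smooth_on_imp_differentiable[OF coord_form_smooth[OF \<Omega> d(1)] xI] eqs in auto)
    moreover have "K y (F (chart_inv \<phi> y) \<phi>) (H (chart_inv \<phi> y) \<phi>) = \<Omega> (chart_inv \<phi> y) (F (chart_inv \<phi> y)) (H (chart_inv \<phi> y))"
      if y: "y \<in> coords \<phi> S" for y
    proof -
      obtain q where q: "y = snd \<phi> q" "q \<in> fst \<phi>" "q \<in> S" using y by auto
      show ?thesis
        using form_eq_coord_form[OF smooth_vector_field_tangent[OF F q(3)] smooth_vector_field_tangent[OF H q(3)] charts_at_I[OF d(1) q(2)], of \<Omega>] q d eqs
        by simp
    qed
    ultimately have "dd (\<lambda>y. \<Omega> (chart_inv \<phi> y) (F (chart_inv \<phi> y)) (H (chart_inv \<phi> y))) x =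
      (\<lambda>t. dd (\<lambda>y. K y (F (chart_inv \<phi> x) \<phi>) (H (chart_inv \<phi> x) \<phi>)) x t
       + K x (dd (\<lambda>y. F (chart_inv \<phi> y) \<phi>) x t) (H (chart_inv \<phi> x) \<phi>) + K x (F (chart_inv \<phi> x) \<phi>) (dd (\<lambda>y. H (chart_inv \<phi> y) \<phi>) x t))"
      by (rule has_derivative_unique_dd[OF _ o xS])
    then show ?thesis
      unfolding directional_deriv_def Let_def \<phi>[symmetric] comp_def eqs(1)[symmetric] using d eqs(1) by simp
  qed
  have lie: "\<Omega> p (lie_bracket A F H p) (T p) = K x (dd (\<lambda>y. H (chart_inv \<phi> y) \<phi>) x (F p \<phi>) - dd (\<lambda>y. F (chart_inv \<phi> y) \<phi>) x (H p \<phi>)) (T p \<phi>)"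
    if "smooth_vector_field A S F" "smooth_vector_field A S H" "smooth_vector_field A S T" for F H T
    using form_eq_coord_form[OF lie_bracket_tangent[OF S that(1,2) p] smooth_vector_field_tangent[OF that(3) p] c, of \<Omega>] c eqs
    by (simp add: lie_bracket_def)
  show ?thesis
    unfolding exterior_deriv_def dir[OF V W] dir[OF U W] dir[OF U V] lie[OF U V W] lie[OF U W V] lie[OF V W U] eqs(2-4)[symmetric] Ks
    using Kskew[of v] Kskew[of u] by simp
qed

end

section \<open>Signature and non-degeneracy\<close>

lemma scaleR_fun_apply: "(r *\<^sub>R f) x = r *\<^sub>R f x"
  by (simp add: scaleR_fun_def)

text \<open>Pairing a vanishing combination with one of its vectors isolates a single coefficient.
  As only \<open>b x x\<close> nonzero is used, indefinite forms are covered.\<close>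

lemma independent_orthogonal:
  fixes b :: "'v::real_vector \<Rightarrow> 'v \<Rightarrow> real"
  assumes "finite S" "\<And>x. x \<in> S \<Longrightarrow> linear (b x)" "\<And>x. x \<in> S \<Longrightarrow> b x x \<noteq> 0"
    and "\<And>x y. x \<in> S \<Longrightarrow> y \<in> S \<Longrightarrow> x \<noteq> y \<Longrightarrow> b x y = 0"
  shows "independent S"
proof
  assume "dependent S"
  then obtain u x where u: "x \<in> S" "u x \<noteq> 0" "(\<Sum>v\<in>S. u v *\<^sub>R v) = 0"
    using dependent_finite[OF assms(1)] by auto
  note l = assms(2)[OF u(1)]
  have "b x (\<Sum>v\<in>S. u v *\<^sub>R v) = (\<Sum>v\<in>S. u v * b x v)"
    by (simp add: linear_sum[OF l] linear_cmul[OF l])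
  also have "\<dots> = u x * b x x + (\<Sum>v\<in>S - {x}. u v * b x v)"
    by (rule sum.remove[OF assms(1) u(1)])
  also have "(\<Sum>v\<in>S - {x}. u v * b x v) = 0"
    by (rule sum.neutral) (use assms(4)[OF u(1)] in auto)
  finally show False using u assms(3)[OF u(1)] linear_0[OF l] by simp
qed

section \<open>From one chart to the tangent space: nondegeneracy, bilinearity, signature\<close>

context atlas
begin

lemma coord_form_nondegenerate:
  assumes c: "\<phi> \<in> charts_at A p" and "\<And>u. (\<And>v. coord_form A b \<phi> (snd \<phi> p) u v = 0) \<Longrightarrow> u = 0"
  shows "nondegenerate_on (tangent_space A p) (b p)"
  unfolding nondegenerate_on_def
proof (intro ballI impI)
  fix v assume v: "v \<in> tangent_space A p" "\<forall>w\<in>tangent_space A p. b p v w = 0"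
  have "coord_form A b \<phi> (snd \<phi> p) (v \<phi>) w = 0" for w
    using v(2) coord_vec_tangent[OF c, of w] form_eq_coord_form[OF v(1) coord_vec_tangent[OF c] c, of b w]
    by (simp add: coord_vec_same[OF c])
  then have "v \<phi> = 0" by (rule assms(2))
  then show "v = 0" using coord_vec_component[OF v(1) c] linear_0[OF linear_coord_vec[OF c]] by metis
qed

lemma coord_form_bilinear_form_on:
  assumes c: "\<phi> \<in> charts_at A p" and p: "p \<in> topspace X"
    and l: "\<And>u. linear (coord_form A b \<phi> (snd \<phi> p) u)" "\<And>v. linear (\<lambda>u. coord_form A b \<phi> (snd \<phi> p) u v)"
  shows "bilinear_form_on (tangent_space A p) (b p)"
  unfolding bilinear_form_on_def
proof (intro ballI allI)
  fix x y z r s assume T: "x \<in> tangent_space A p" "y \<in> tangent_space A p" "z \<in> tangent_space A p"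
  have xy: "r *\<^sub>R x + s *\<^sub>R y \<in> tangent_space A p"
    by (intro subspace_add subspace_scale subspace_tangent_space p T)
  show "b p (r *\<^sub>R x + s *\<^sub>R y) z = r * b p x z + s * b p y z \<and> b p z (r *\<^sub>R x + s *\<^sub>R y) = r * b p z x + s * b p z y"
    by (simp add: form_eq_coord_form[OF xy T(3) c] form_eq_coord_form[OF T(3) xy c] form_eq_coord_form[OF T(1,3) c]
      form_eq_coord_form[OF T(2,3) c] form_eq_coord_form[OF T(3,1) c] form_eq_coord_form[OF T(3,2) c] scaleR_fun_apply
      linear_add[OF l(1)] linear_add[OF l(2)] linear_cmul[OF l(1)] linear_cmul[OF l(2)])
qed

text \<open>An orthogonal set without null vectors is independent, and the count makes it a basis of
  the model space. The coordinate isomorphism carries it to the tangent space.\<close>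

lemma has_signature_coords:
  assumes c: "\<phi> \<in> charts_at A p" and l: "\<And>u. linear (coord_form A b \<phi> (snd \<phi> p) u)"
    and PN: "finite P" "finite N" "P \<inter> N = {}" "card P + card N = DIM('e)"
    and orth: "\<And>x y. x \<in> P \<union> N \<Longrightarrow> y \<in> P \<union> N \<Longrightarrow> x \<noteq> y \<Longrightarrow> coord_form A b \<phi> (snd \<phi> p) x y = 0"
    and pos: "\<And>x. x \<in> P \<Longrightarrow> coord_form A b \<phi> (snd \<phi> p) x x > 0" and neg: "\<And>x. x \<in> N \<Longrightarrow> coord_form A b \<phi> (snd \<phi> p) x x < 0"
  shows "has_signature (tangent_space A p) (b p) (card P) (card N)"
proof -
  let ?L = "coord_vec A \<phi> p"
  have inj: "inj ?L" by (rule inj_coord_vec[OF c])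
  have ind: "independent (P \<union> N)"
    by (rule independent_orthogonal[of _ "coord_form A b \<phi> (snd \<phi> p)", OF _ l _ orth]) (use PN pos neg in \<open>force+\<close>)
  have "card (P \<union> N) = DIM('e)" using PN by (simp add: card_Un_disjoint)
  then have span: "span (P \<union> N) = UNIV"
    using ind dim_eq_card_independent[OF ind] dim_eq_full by metis
  have b: "b p (?L u) (?L v) = coord_form A b \<phi> (snd \<phi> p) u v" for u v
    using form_eq_coord_form[OF coord_vec_tangent[OF c] coord_vec_tangent[OF c] c] by (simp add: coord_vec_same[OF c])
  have im: "?L ` P \<union> ?L ` N = ?L ` (P \<union> N)" by (simp add: image_Un)
  show ?thesis
    unfolding has_signature_def
  proof (rule exI[of _ "?L ` P"], rule exI[of _ "?L ` N"], intro conjI ballI impI, unfold im)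
    show "finite (?L ` P)" "finite (?L ` N)" using PN by auto
    show "card (?L ` P) = card P" "card (?L ` N) = card N"
      by (intro card_image inj_on_subset[OF inj]; simp)+
    show "?L ` P \<inter> ?L ` N = {}" using PN(3) inj by (auto simp: inj_eq)
    show "independent (?L ` (P \<union> N))"
      by (rule linear_independent_injective_image[OF linear_coord_vec[OF c] ind]) (rule inj_on_subset[OF inj], simp)
    show "span (?L ` (P \<union> N)) = tangent_space A p"
      by (simp add: linear_span_image[OF linear_coord_vec[OF c]] span tangent_space_eq_range[OF c])
    show "b p x y = 0" if "x \<in> ?L ` (P \<union> N)" "y \<in> ?L ` (P \<union> N)" and ne: "x \<noteq> y" for x y
    proof -
      from that obtain u v where "x = ?L u" "y = ?L v" "u \<in> P \<union> N" "v \<in> P \<union> N" by blast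
      then show ?thesis using orth[of u v] ne b by auto
    qed
    show "b p x x > 0" if "x \<in> ?L ` P" for x using that pos b by auto
    show "b p x x < 0" if "x \<in> ?L ` N" for x using that neg b by auto
  qed
qed

end

context atlas_pair
begin

abbreviation chart_box where "chart_box \<phi> \<psi> \<equiv> (snd \<phi> ` fst \<phi>) \<times> (snd \<psi> ` fst \<psi>)"

lemma prod_chart_image: "snd (prod_chart \<phi> \<psi>) ` fst (prod_chart \<phi> \<psi>) = chart_box \<phi> \<psi>"
  by (simp add: map_prod_image)

lemma prod_atlas_cases:
  assumes "\<rho> \<in> P" obtains \<phi> \<psi> where "\<rho> = prod_chart \<phi> \<psi>" "\<phi> \<in> A" "\<psi> \<in> B"
  using assms unfolding prod_atlas_eq by blast

lemma open_chart_box: "\<phi> \<in> A \<Longrightarrow> \<psi> \<in> B \<Longrightarrow> open (chart_box \<phi> \<psi>)"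
  by (intro open_Times A.open_chart_image B.open_chart_image)

lemma charts_at_pair:
  assumes "z \<in> topspace (prod_topology X Y)"
  obtains \<phi> \<psi> where "\<phi> \<in> charts_at A (fst z)" "\<psi> \<in> charts_at B (snd z)"
  using A.ex_chart[of "fst z"] B.ex_chart[of "snd z"] assms by auto

text \<open>No symmetry is assumed of the two forms, so that the product metric and the product of
  the area forms are treated at once.\<close>

lemma smooth_form_prod:
  assumes b1: "smooth_form X A b1" and b2: "smooth_form Y B b2"
  shows "smooth_form (prod_topology X Y) P (prod_form A B \<epsilon> b1 b2)"
  unfolding smooth_form_def
proof (intro conjI ballI allI)
  fix z assume z: "z \<in> topspace (prod_topology X Y)"
  obtain \<phi> \<psi> where c: "\<phi> \<in> charts_at A (fst z)" "\<psi> \<in> charts_at B (snd z)" using charts_at_pair[OF z] .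
  note d = A.charts_at_D[OF c(1)] B.charts_at_D[OF c(2)]
  have pc: "prod_chart \<phi> \<psi> \<in> charts_at P z" using prod_chart_at[OF c] by simp
  have zb: "(snd \<phi> (fst z), snd \<psi> (snd z)) \<in> chart_box \<phi> \<psi>" using d by auto
  have sz: "snd (prod_chart \<phi> \<psi>) z = (snd \<phi> (fst z), snd \<psi> (snd z))" by (simp add: map_prod_def split_beta)
  note l = A.coord_form_bilinear[OF b1 d(1), of "snd \<phi> (fst z)"] B.coord_form_bilinear[OF b2 d(3), of "snd \<psi> (snd z)"]
  have ls: "linear (coord_form A b1 \<phi> (snd \<phi> (fst z)) u)" "linear (\<lambda>u. coord_form A b1 \<phi> (snd \<phi> (fst z)) u v)"
    "linear (coord_form B b2 \<psi> (snd \<psi> (snd z)) u')" "linear (\<lambda>u. coord_form B b2 \<psi> (snd \<psi> (snd z)) u v')" for u v u' v'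
    using l d by auto
  have "linear (coord_form P (prod_form A B \<epsilon> b1 b2) (prod_chart \<phi> \<psi>) (snd (prod_chart \<phi> \<psi>) z) u)"
    "linear (\<lambda>u. coord_form P (prod_form A B \<epsilon> b1 b2) (prod_chart \<phi> \<psi>) (snd (prod_chart \<phi> \<psi>) z) u v)" for u v
    unfolding sz coord_form_prod[OF d(1,3) zb]
    by (rule linearI; simp add: linear_add[OF ls(1)] linear_add[OF ls(2)] linear_add[OF ls(3)] linear_add[OF ls(4)]
         linear_cmul[OF ls(1)] linear_cmul[OF ls(2)] linear_cmul[OF ls(3)] linear_cmul[OF ls(4)] algebra_simps)+
  then show "bilinear_form_on (tangent_space P z) (prod_form A B \<epsilon> b1 b2 z)"
    by (rule P.coord_form_bilinear_form_on[OF pc z])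
next
  fix \<rho> u v assume "\<rho> \<in> P"
  then obtain \<phi> \<psi> where \<rho>: "\<rho> = prod_chart \<phi> \<psi>" "\<phi> \<in> A" "\<psi> \<in> B" by (rule prod_atlas_cases)
  note o = open_chart_box[OF \<rho>(2,3)]
  have "smooth_on (chart_box \<phi> \<psi>) (\<lambda>z. coord_form A b1 \<phi> (fst z) (fst u) (fst v) + \<epsilon> * coord_form B b2 \<psi> (snd z) (snd u) (snd v))"
    by (intro smooth_on_add smooth_on_mult smooth_on_const o
       smooth_on_compose[OF o A.open_chart_image[OF \<rho>(2)] _ smooth_on_bounded_linear[OF o bounded_linear_fst] A.coord_form_smooth[OF b1 \<rho>(2)]]
       smooth_on_compose[OF o B.open_chart_image[OF \<rho>(3)] _ smooth_on_bounded_linear[OF o bounded_linear_snd] B.coord_form_smooth[OF b2 \<rho>(3)]]) auto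
  then have "smooth_on (chart_box \<phi> \<psi>) (\<lambda>x. coord_form P (prod_form A B \<epsilon> b1 b2) \<rho> x u v)"
    unfolding \<rho>(1)
    by (rule iffD2[OF smooth_on_cong[OF o], rotated]) (rule coord_form_prod[OF \<rho>(2,3)])
  then show "smooth_on (snd \<rho> ` fst \<rho>) (\<lambda>x. coord_form P (prod_form A B \<epsilon> b1 b2) \<rho> x u v)"
    unfolding \<rho>(1) prod_chart_image .
qed

end

context riemannian_surface
begin

lemma smooth_form_area: "smooth_form X A (area_form A g)"
  unfolding smooth_form_def
proof (intro conjI ballI allI)
  fix p assume p: "p \<in> topspace X"
  obtain \<phi> where c: "\<phi> \<in> charts_at A p" using ex_chart[OF p] by blast
  note d = charts_at_D[OF c] and x = chart_image[OF c]
  interpret L: local_surface "snd \<phi> ` fst \<phi>" "coord_form A g \<phi>" by (rule local_surface_coord_form[OF d(1)])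
  show "bilinear_form_on (tangent_space A p) (area_form A g p)"
    by (rule coord_form_bilinear_form_on[OF c p]; rule linearI)
       (simp_all add: coord_form_area_form[OF d(1) x] L.h_simps[OF x] linear_add[OF L.linear_rot[OF x]] linear_cmul[OF L.linear_rot[OF x]])
next
  fix \<phi> u v assume \<phi>: "\<phi> \<in> A"
  interpret L: local_surface "snd \<phi> ` fst \<phi>" "coord_form A g \<phi>" by (rule local_surface_coord_form[OF \<phi>])
  have "smooth_on (snd \<phi> ` fst \<phi>) (\<lambda>x. coord_form A g \<phi> x (L.rot x u) v)"
    by (rule smooth_on_bilinear_family[OF L.open_S L.lin' L.lin L.smooth L.smooth_rot smooth_on_const[OF L.open_S]])
  then show "smooth_on (snd \<phi> ` fst \<phi>) (\<lambda>x. coord_form A (area_form A g) \<phi> x u v)"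
    by (rule iffD2[OF smooth_on_cong[OF L.open_S], rotated]) (rule coord_form_area_form[OF \<phi>])
qed

end

section \<open>The product metric and its signature\<close>

locale surface_product = A: riemannian_surface X A g1 + B: riemannian_surface Y B g2
  for X :: "'a topology" and A g1 and Y :: "'b topology" and B g2 +
  fixes \<epsilon> :: real
  assumes \<epsilon>: "\<epsilon> \<in> {1, -1}"
begin

sublocale atlas_pair X A Y B by unfold_locales

abbreviation XY where "XY \<equiv> prod_topology X Y"
abbreviation G where "G \<equiv> prod_form A B \<epsilon> g1 g2"
abbreviation J where "J \<equiv> prod_endo A B (rotation A g1) (rotation B g2)"
abbreviation \<Omega> where "\<Omega> \<equiv> prod_form A B \<epsilon> (area_form A g1) (area_form B g2)"
abbreviation h1 where "h1 \<equiv> coord_form A g1"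
abbreviation h2 where "h2 \<equiv> coord_form B g2"

lemma \<epsilon>_nz: "\<epsilon> \<noteq> 0" using \<epsilon> by auto

lemma smooth_G: "smooth_form XY P G"
  by (rule smooth_form_prod[OF A.smooth_form B.smooth_form])

lemma smooth_\<Omega>: "smooth_form XY P \<Omega>"
  by (rule smooth_form_prod[OF A.smooth_form_area B.smooth_form_area])

lemma local_metric_G:
  assumes "\<phi> \<in> A" "\<psi> \<in> B"
  shows "local_metric (chart_box \<phi> \<psi>) (\<lambda>z u v. h1 \<phi> (fst z) (fst u) (fst v) + \<epsilon> * h2 \<psi> (snd z) (snd u) (snd v))"
    and "local_metric (chart_box \<phi> \<psi>) (coord_form P G (prod_chart \<phi> \<psi>))"
proof -
  interpret L1: local_surface "snd \<phi> ` fst \<phi>" "h1 \<phi>" by (rule A.local_surface_coord_form[OF assms(1)])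
  interpret L2: local_surface "snd \<psi> ` fst \<psi>" "h2 \<psi>" by (rule B.local_surface_coord_form[OF assms(2)])
  show *: "local_metric (chart_box \<phi> \<psi>) (\<lambda>z u v. h1 \<phi> (fst z) (fst u) (fst v) + \<epsilon> * h2 \<psi> (snd z) (snd u) (snd v))"
    by (rule local_metric_product[OF L1.local_metric_axioms L2.local_metric_axioms \<epsilon>_nz])
  show "local_metric (chart_box \<phi> \<psi>) (coord_form P G (prod_chart \<phi> \<psi>))"
    by (rule local_metric_cong(1)[OF *]) (simp add: coord_form_prod[OF assms])
qed

lemma snd_prod_chart_apply: "snd (prod_chart \<phi> \<psi>) z = (snd \<phi> (fst z), snd \<psi> (snd z))"
  by (simp add: map_prod_def split_beta)

lemma chart_at_cases:
  assumes "\<rho> \<in> charts_at P z"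
  obtains \<phi> \<psi> where "\<rho> = prod_chart \<phi> \<psi>" "\<phi> \<in> charts_at A (fst z)" "\<psi> \<in> charts_at B (snd z)"
    "\<phi> \<in> A" "\<psi> \<in> B" "snd \<rho> z \<in> chart_box \<phi> \<psi>"
proof -
  obtain \<phi> \<psi> where r: "\<rho> = prod_chart \<phi> \<psi>" "\<phi> \<in> charts_at A (fst z)" "\<psi> \<in> charts_at B (snd z)"
    using assms charts_at_prod[of "fst z" "snd z"] by auto
  note d = A.charts_at_D[OF r(2)] B.charts_at_D[OF r(3)]
  have "snd \<rho> z \<in> chart_box \<phi> \<psi>" unfolding r(1) snd_prod_chart_apply using d by auto
  then show ?thesis by (rule that[OF r d(1,3)])
qed

lemma symmetric_G: "symmetric_form XY P G"
  unfolding symmetric_form_def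
proof (intro ballI)
  fix z v w assume z: "z \<in> topspace XY" and T: "v \<in> tangent_space P z" "w \<in> tangent_space P z"
  obtain \<rho> where c: "\<rho> \<in> charts_at P z" using P.ex_chart[OF z] by blast
  obtain \<phi> \<psi> where r: "\<rho> = prod_chart \<phi> \<psi>" "\<phi> \<in> A" "\<psi> \<in> B" "snd \<rho> z \<in> chart_box \<phi> \<psi>" using chart_at_cases[OF c] .
  interpret M: local_metric "chart_box \<phi> \<psi>" "coord_form P G \<rho>" unfolding r(1) by (rule local_metric_G[OF r(2,3)])
  show "G z v w = G z w v"
    unfolding P.form_eq_coord_form[OF T c] P.form_eq_coord_form[OF T(2,1) c] by (rule M.sym[OF r(4)])
qed

lemma nondegenerate_G:
  assumes z: "z \<in> topspace XY"
  shows "nondegenerate_on (tangent_space P z) (G z)"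
proof -
  obtain \<rho> where c: "\<rho> \<in> charts_at P z" using P.ex_chart[OF z] by blast
  obtain \<phi> \<psi> where r: "\<rho> = prod_chart \<phi> \<psi>" "\<phi> \<in> A" "\<psi> \<in> B" "snd \<rho> z \<in> chart_box \<phi> \<psi>" using chart_at_cases[OF c] .
  interpret M: local_metric "chart_box \<phi> \<psi>" "coord_form P G \<rho>" unfolding r(1) by (rule local_metric_G[OF r(2,3)])
  show ?thesis by (rule P.coord_form_nondegenerate[OF c M.nondeg[OF r(4)]])
qed

text \<open>An orthogonal pair of each factor, padded with zero. The sign on the second pair is kept
  as a product with \<epsilon>, from which either signature can be read off.\<close>

lemma orthogonal_frame:
  assumes z: "z \<in> topspace XY"
  shows "\<exists>\<rho> e f. \<rho> \<in> charts_at P z \<and> finite e \<and> finite f \<and> e \<inter> f = {} \<and> card e = 2 \<and> card f = 2 \<and>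
    (\<forall>x\<in>e \<union> f. \<forall>y\<in>e \<union> f. x \<noteq> y \<longrightarrow> coord_form P G \<rho> (snd \<rho> z) x y = 0) \<and>
    (\<forall>x\<in>e. coord_form P G \<rho> (snd \<rho> z) x x > 0) \<and> (\<forall>x\<in>f. \<epsilon> * coord_form P G \<rho> (snd \<rho> z) x x > 0) \<and>
    (\<forall>u. linear (coord_form P G \<rho> (snd \<rho> z) u))"
proof -
  obtain \<rho> where c: "\<rho> \<in> charts_at P z" using P.ex_chart[OF z] by blast
  obtain \<phi> \<psi> where r: "\<rho> = prod_chart \<phi> \<psi>" "\<phi> \<in> A" "\<psi> \<in> B" "snd \<rho> z \<in> chart_box \<phi> \<psi>" using chart_at_cases[OF c] .
  interpret M: local_metric "chart_box \<phi> \<psi>" "coord_form P G \<rho>" unfolding r(1) by (rule local_metric_G[OF r(2,3)])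
  interpret L1: local_surface "snd \<phi> ` fst \<phi>" "h1 \<phi>" by (rule A.local_surface_coord_form[OF r(2)])
  interpret L2: local_surface "snd \<psi> ` fst \<psi>" "h2 \<psi>" by (rule B.local_surface_coord_form[OF r(3)])
  let ?x = "fst (snd \<rho> z)" and ?y = "snd (snd \<rho> z)"
  have x: "?x \<in> snd \<phi> ` fst \<phi>" and y: "?y \<in> snd \<psi> ` fst \<psi>" using r(4) by auto
  obtain a b where ab: "a \<noteq> 0" "b \<noteq> 0" "h1 \<phi> ?x a b = 0" using L1.orthogonal_pair[OF x] .
  obtain c' d where cd: "c' \<noteq> 0" "d \<noteq> 0" "h2 \<psi> ?y c' d = 0" using L2.orthogonal_pair[OF y] .
  have h: "coord_form P G \<rho> (snd \<rho> z) u v = h1 \<phi> ?x (fst u) (fst v) + \<epsilon> * h2 \<psi> ?y (snd u) (snd v)" for u v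
    unfolding r(1) by (rule coord_form_prod[OF r(2,3)]) (use r(1,4) in simp)
  note s = L1.h_simps(9,10)[OF x] L2.h_simps(9,10)[OF y]
  have ne: "a \<noteq> b" "c' \<noteq> d" using ab cd L1.pos[OF x ab(1)] L2.pos[OF y cd(1)] by auto
  have ba: "h1 \<phi> ?x b a = 0" "h2 \<psi> ?y d c' = 0" using ab(3) cd(3) L1.sym[OF x] L2.sym[OF y] by auto
  have ee: "\<epsilon> * \<epsilon> = 1" using \<epsilon> by auto
  show ?thesis
  proof (rule exI[of _ \<rho>], rule exI[of _ "{(a, 0), (b, 0)}"], rule exI[of _ "{(0, c'), (0, d)}"], intro conjI ballI allI impI)
    show "coord_form P G \<rho> (snd \<rho> z) x y = 0"
      if "x \<in> {(a, 0), (b, 0)} \<union> {(0, c'), (0, d)}" "y \<in> {(a, 0), (b, 0)} \<union> {(0, c'), (0, d)}" "x \<noteq> y" for x y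
      using that ab cd ba by (auto simp: h s)
    show "coord_form P G \<rho> (snd \<rho> z) x x > 0" if "x \<in> {(a, 0), (b, 0)}" for x
      using that L1.pos[OF x ab(1)] L1.pos[OF x ab(2)] by (auto simp: h s)
    show "\<epsilon> * coord_form P G \<rho> (snd \<rho> z) x x > 0" if "x \<in> {(0, c'), (0, d)}" for x
      using that L2.pos[OF y cd(1)] L2.pos[OF y cd(2)] ee by (auto simp: h s mult.assoc[symmetric])
  qed (use ab cd ne c M.lin[OF r(4)] in auto)
qed

lemma signature_G: "metric_signature XY P G (if \<epsilon> = 1 then 4 else 2) (if \<epsilon> = 1 then 0 else 2)"
  unfolding metric_signature_def
proof
  fix z assume z: "z \<in> topspace XY"
  from orthogonal_frame[OF z] obtain \<rho> e f where
    r: "\<rho> \<in> charts_at P z" "finite e" "finite f" "e \<inter> f = {}" "card e = 2" "card f = 2"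
    and orth: "\<forall>x\<in>e \<union> f. \<forall>y\<in>e \<union> f. x \<noteq> y \<longrightarrow> coord_form P G \<rho> (snd \<rho> z) x y = 0"
    and sgn: "\<forall>x\<in>e. coord_form P G \<rho> (snd \<rho> z) x x > 0" "\<forall>x\<in>f. \<epsilon> * coord_form P G \<rho> (snd \<rho> z) x x > 0"
    and lin: "\<forall>u. linear (coord_form P G \<rho> (snd \<rho> z) u)" by (elim exE conjE) (rule that)
  note lin' = lin[rule_format]
  show "has_signature (tangent_space P z) (G z) (if \<epsilon> = 1 then 4 else 2) (if \<epsilon> = 1 then 0 else 2)"
  proof (cases "\<epsilon> = 1")
    case True
    \<comment> \<open>For \<epsilon> equal to 1 the second pair is positive as well and joins the
      first; the set of negative vectors is empty.\<close>
    have "has_signature (tangent_space P z) (G z) (card (e \<union> f)) (card ({} :: ((real^2) \<times> (real^2)) set))"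
      by (rule P.has_signature_coords[OF r(1) lin']) (use r orth sgn True in \<open>auto simp: card_Un_disjoint\<close>)
    then show ?thesis using True r by (simp add: card_Un_disjoint)
  next
    case False
    then have e: "\<epsilon> = -1" using \<epsilon> by auto
    have "has_signature (tangent_space P z) (G z) (card e) (card f)"
      by (rule P.has_signature_coords[OF r(1) lin']) (use r orth sgn e in auto)
    then show ?thesis using False r by simp
  qed
qed

lemma pseudo_riemannian_G: "pseudo_riemannian_metric XY P G"
  unfolding pseudo_riemannian_metric_def using smooth_G symmetric_G nondegenerate_G signature_G by blast

lemma riemannian_G:
  assumes "\<epsilon> = 1"
  shows "riemannian_metric XY P G"
  unfolding riemannian_metric_def
proof (intro conjI ballI impI smooth_G symmetric_G)
  fix z v assume z: "z \<in> topspace XY" and v: "v \<in> tangent_space P z" "v \<noteq> 0"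
  obtain \<rho> where c: "\<rho> \<in> charts_at P z" using P.ex_chart[OF z] by blast
  obtain \<phi> \<psi> where r: "\<rho> = prod_chart \<phi> \<psi>" "\<phi> \<in> A" "\<psi> \<in> B" "snd \<rho> z \<in> chart_box \<phi> \<psi>" using chart_at_cases[OF c] .
  interpret L1: local_surface "snd \<phi> ` fst \<phi>" "h1 \<phi>" by (rule A.local_surface_coord_form[OF r(2)])
  interpret L2: local_surface "snd \<psi> ` fst \<psi>" "h2 \<psi>" by (rule B.local_surface_coord_form[OF r(3)])
  let ?x = "fst (snd \<rho> z)" and ?y = "snd (snd \<rho> z)"
  have x: "?x \<in> snd \<phi> ` fst \<phi>" and y: "?y \<in> snd \<psi> ` fst \<psi>" using r(4) by auto
  have h: "G z v v = h1 \<phi> ?x (fst (v \<rho>)) (fst (v \<rho>)) + h2 \<psi> ?y (snd (v \<rho>)) (snd (v \<rho>))"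
    unfolding P.form_eq_coord_form[OF v(1,1) c] using coord_form_prod[OF r(2,3), of "snd \<rho> z"] r(1,4) assms by simp
  have "v \<rho> \<noteq> 0" using v P.coord_vec_component[OF v(1) c] linear_0[OF P.linear_coord_vec[OF c]] by metis
  then have "fst (v \<rho>) \<noteq> 0 \<or> snd (v \<rho>) \<noteq> 0" by (auto simp: prod_eq_iff)
  moreover have "h1 \<phi> ?x a a \<ge> 0" "h2 \<psi> ?y a a \<ge> 0" for a
    using L1.pos[OF x, of a] L1.h_simps(9)[OF x] L2.pos[OF y, of a] L2.h_simps(9)[OF y] by (cases "a = 0"; force)+
  ultimately show "G z v v > 0"
    unfolding h using L1.pos[OF x, of "fst (v \<rho>)"] L2.pos[OF y, of "snd (v \<rho>)"] by (meson add_nonneg_pos add_pos_nonneg)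
qed

end

section \<open>The product of two surfaces\<close>

context surface_product
begin

abbreviation rot1 where "rot1 \<phi> \<equiv> local_surface.rot (h1 \<phi>)"
abbreviation rot2 where "rot2 \<psi> \<equiv> local_surface.rot (h2 \<psi>)"

definition rot_pair where
  "rot_pair \<phi> \<psi> z u = (rot1 \<phi> (fst z) (fst u), rot2 \<psi> (snd z) (snd u))"

lemma J_eq:
  assumes z: "z \<in> topspace XY" and v: "v \<in> tangent_space P z"
    and \<rho>: "\<rho> = prod_chart \<phi> \<psi>" and c: "\<phi> \<in> charts_at A (fst z)" "\<psi> \<in> charts_at B (snd z)"
  shows "J z v = coord_vec P \<rho> z (rot_pair \<phi> \<psi> (snd \<rho> z) (v \<rho>))"
proof -
  have p: "fst z \<in> topspace X" and q: "snd z \<in> topspace Y" using z by auto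
  have v': "v \<in> tangent_space P (fst z, snd z)" using v by simp
  have "J (fst z, snd z) v = coord_vec P (prod_chart \<phi> \<psi>) (fst z, snd z)
    (rotation A g1 (fst z) (coord_vec A \<phi> (fst z) (fst (v (prod_chart \<phi> \<psi>)))) \<phi>,
     rotation B g2 (snd z) (coord_vec B \<psi> (snd z) (snd (v (prod_chart \<phi> \<psi>)))) \<psi>)"
    by (rule prod_endo_component[where j="rotation A g1" and k="rotation B g2",
        OF v' c A.rotation_tangent[OF p] B.rotation_tangent[OF q]])
  then show ?thesis
    unfolding \<rho> rot_pair_def snd_prod_chart_apply
    by (simp add: A.rotation_eq[OF A.coord_vec_tangent[OF c(1)] c(1)] B.rotation_eq[OF B.coord_vec_tangent[OF c(2)] c(2)]
       A.coord_vec_same[OF c(1)] B.coord_vec_same[OF c(2)])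
qed

lemma J_component:
  assumes z: "z \<in> topspace XY" and v: "v \<in> tangent_space P z"
    and \<rho>: "\<rho> = prod_chart \<phi> \<psi>" and c: "\<phi> \<in> charts_at A (fst z)" "\<psi> \<in> charts_at B (snd z)"
  shows "J z v \<in> tangent_space P z" "J z v \<rho> = rot_pair \<phi> \<psi> (snd \<rho> z) (v \<rho>)"
proof -
  have pc: "\<rho> \<in> charts_at P z" unfolding \<rho> using prod_chart_at[OF c] by simp
  show "J z v \<in> tangent_space P z" "J z v \<rho> = rot_pair \<phi> \<psi> (snd \<rho> z) (v \<rho>)"
    unfolding J_eq[OF assms] by (simp_all add: P.coord_vec_tangent[OF pc] P.coord_vec_same[OF pc])
qed

context
  fixes \<phi> \<psi> assumes \<phi>: "\<phi> \<in> A" and \<psi>: "\<psi> \<in> B"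
begin

interpretation L1: local_surface "snd \<phi> ` fst \<phi>" "h1 \<phi>" by (rule A.local_surface_coord_form[OF \<phi>])
interpretation L2: local_surface "snd \<psi> ` fst \<psi>" "h2 \<psi>" by (rule B.local_surface_coord_form[OF \<psi>])

lemma linear_rot_pair:
  assumes "z \<in> chart_box \<phi> \<psi>"
  shows "linear (rot_pair \<phi> \<psi> z)"
proof -
  have x: "fst z \<in> snd \<phi> ` fst \<phi>" "snd z \<in> snd \<psi> ` fst \<psi>" using assms by auto
  show ?thesis
    unfolding rot_pair_def
    by (rule linearI) (simp_all add: linear_add[OF L1.linear_rot[OF x(1)]] linear_add[OF L2.linear_rot[OF x(2)]]
      linear_cmul[OF L1.linear_rot[OF x(1)]] linear_cmul[OF L2.linear_rot[OF x(2)]])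
qed

lemma rot_pair_rot_pair:
  assumes "z \<in> chart_box \<phi> \<psi>"
  shows "rot_pair \<phi> \<psi> z (rot_pair \<phi> \<psi> z u) = - u"
proof -
  have x: "fst z \<in> snd \<phi> ` fst \<phi>" "snd z \<in> snd \<psi> ` fst \<psi>" using assms by auto
  show ?thesis
    unfolding rot_pair_def by (simp add: L1.rot_rot[OF x(1)] L2.rot_rot[OF x(2)] prod_eq_iff)
qed

lemma smooth_rot_pair: "smooth_on (chart_box \<phi> \<psi>) (\<lambda>z. rot_pair \<phi> \<psi> z u)"
  unfolding rot_pair_def by (rule smooth_on_prod[OF L1.open_S L2.open_S L1.smooth_rot L2.smooth_rot])

lemma nijenhuis_rot_pair:
  assumes "z \<in> chart_box \<phi> \<psi>"
  shows "dd (\<lambda>y. rot_pair \<phi> \<psi> y w) z (rot_pair \<phi> \<psi> z v) - dd (\<lambda>y. rot_pair \<phi> \<psi> y v) z (rot_pair \<phi> \<psi> z w)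
    + rot_pair \<phi> \<psi> z (dd (\<lambda>y. rot_pair \<phi> \<psi> y v) z w) - rot_pair \<phi> \<psi> z (dd (\<lambda>y. rot_pair \<phi> \<psi> y w) z v) = 0"
proof -
  have x: "fst z \<in> snd \<phi> ` fst \<phi>" "snd z \<in> snd \<psi> ` fst \<psi>" using assms by auto
  have d: "dd (\<lambda>y. rot_pair \<phi> \<psi> y u) z = (\<lambda>t. (dd (\<lambda>y. rot1 \<phi> y (fst u)) (fst z) (fst t), dd (\<lambda>y. rot2 \<psi> y (snd u)) (snd z) (snd t)))" for u
    unfolding rot_pair_def
    by (intro frechet_derivative_eqI has_derivative_Pair
         has_derivative_compose[OF has_derivative_fst[OF has_derivative_ident] smooth_on_has_derivative[OF L1.smooth_rot x(1)]]
         has_derivative_compose[OF has_derivative_snd[OF has_derivative_ident] smooth_on_has_derivative[OF L2.smooth_rot x(2)]])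
  show ?thesis
    unfolding d unfolding rot_pair_def fst_conv snd_conv minus_prod_def plus_prod_def
      L1.nijenhuis_rot[OF x(1)] L2.nijenhuis_rot[OF x(2)] by (rule zero_prod_def[symmetric])
qed

lemma coord_form_\<Omega>:
  assumes "z \<in> chart_box \<phi> \<psi>"
  shows "coord_form P \<Omega> (prod_chart \<phi> \<psi>) z u v =
    h1 \<phi> (fst z) (rot1 \<phi> (fst z) (fst u)) (fst v) + \<epsilon> * h2 \<psi> (snd z) (rot2 \<psi> (snd z) (snd u)) (snd v)"
proof -
  have x: "fst z \<in> snd \<phi> ` fst \<phi>" "snd z \<in> snd \<psi> ` fst \<psi>" using assms by auto
  show ?thesis
    unfolding coord_form_prod[OF \<phi> \<psi> assms] A.coord_form_area_form[OF \<phi> x(1)] B.coord_form_area_form[OF \<psi> x(2)] ..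
qed

lemma coord_form_\<Omega>_G:
  assumes "z \<in> chart_box \<phi> \<psi>"
  shows "coord_form P \<Omega> (prod_chart \<phi> \<psi>) z u v = coord_form P G (prod_chart \<phi> \<psi>) z (rot_pair \<phi> \<psi> z u) v"
  unfolding coord_form_\<Omega>[OF assms] unfolding coord_form_prod[OF \<phi> \<psi> assms] rot_pair_def by simp

lemma coord_form_\<Omega>_rot_pair:
  assumes "z \<in> chart_box \<phi> \<psi>"
  shows "coord_form P \<Omega> (prod_chart \<phi> \<psi>) z (rot_pair \<phi> \<psi> z u) (rot_pair \<phi> \<psi> z v) = coord_form P \<Omega> (prod_chart \<phi> \<psi>) z u v"
proof -
  have x: "fst z \<in> snd \<phi> ` fst \<phi>" "snd z \<in> snd \<psi> ` fst \<psi>" using assms by auto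
  show ?thesis
    by (simp add: coord_form_\<Omega>[OF assms] rot_pair_def L1.rot_isometric[OF x(1)] L2.rot_isometric[OF x(2)])
qed

lemma coord_form_\<Omega>_self:
  assumes "z \<in> chart_box \<phi> \<psi>"
  shows "coord_form P \<Omega> (prod_chart \<phi> \<psi>) z u u = 0"
proof -
  have x: "fst z \<in> snd \<phi> ` fst \<phi>" "snd z \<in> snd \<psi> ` fst \<psi>" using assms by auto
  show ?thesis
    using L1.rot_orthogonal[OF x(1), of "fst u"] L2.rot_orthogonal[OF x(2), of "snd u"]
      L1.sym[OF x(1), of "fst u"] L2.sym[OF x(2), of "snd u"]
    by (simp add: coord_form_\<Omega>[OF assms])
qed

lemma \<Omega>_closed_coords:
  assumes z: "z \<in> chart_box \<phi> \<psi>"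
  defines "K \<equiv> coord_form P \<Omega> (prod_chart \<phi> \<psi>)"
  shows "dd (\<lambda>y. K y v w) z u - dd (\<lambda>y. K y u w) z v + dd (\<lambda>y. K y u v) z w = 0"
proof -
  have x: "fst z \<in> snd \<phi> ` fst \<phi>" "snd z \<in> snd \<psi> ` fst \<psi>" using z by auto
  have s1: "smooth_on (snd \<phi> ` fst \<phi>) (\<lambda>x. h1 \<phi> x (rot1 \<phi> x a) b)" for a b
    by (rule smooth_on_bilinear_family[OF L1.open_S L1.lin' L1.lin L1.smooth L1.smooth_rot smooth_on_const[OF L1.open_S]])
  have s2: "smooth_on (snd \<psi> ` fst \<psi>) (\<lambda>x. h2 \<psi> x (rot2 \<psi> x a) b)" for a b
    by (rule smooth_on_bilinear_family[OF L2.open_S L2.lin' L2.lin L2.smooth L2.smooth_rot smooth_on_const[OF L2.open_S]])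
  have d: "dd (\<lambda>y. K y a b) z = (\<lambda>t. dd (\<lambda>y. h1 \<phi> y (rot1 \<phi> y (fst a)) (fst b)) (fst z) (fst t)
      + \<epsilon> * dd (\<lambda>y. h2 \<psi> y (rot2 \<psi> y (snd a)) (snd b)) (snd z) (snd t))" for a b
  proof (rule has_derivative_unique_dd[OF _ open_chart_box[OF \<phi> \<psi>] z])
    show "((\<lambda>z. h1 \<phi> (fst z) (rot1 \<phi> (fst z) (fst a)) (fst b) + \<epsilon> * h2 \<psi> (snd z) (rot2 \<psi> (snd z) (snd a)) (snd b)) has_derivative
      (\<lambda>t. dd (\<lambda>y. h1 \<phi> y (rot1 \<phi> y (fst a)) (fst b)) (fst z) (fst t)
      + \<epsilon> * dd (\<lambda>y. h2 \<psi> y (rot2 \<psi> y (snd a)) (snd b)) (snd z) (snd t))) (at z)"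
      by (intro has_derivative_add has_derivative_mult_right
         has_derivative_compose[OF has_derivative_fst[OF has_derivative_ident] smooth_on_has_derivative[OF s1 x(1)]]
         has_derivative_compose[OF has_derivative_snd[OF has_derivative_ident] smooth_on_has_derivative[OF s2 x(2)]])
  qed (simp add: K_def coord_form_\<Omega>)
  have e: "(p + \<epsilon> * p') - (q + \<epsilon> * q') + (r + \<epsilon> * r') = (p - q + r) + \<epsilon> * (p' - q' + r')" for p p' q q' r r' :: real
    by (simp add: algebra_simps)
  show ?thesis
    unfolding d e L1.area_closed[OF x(1)] L2.area_closed[OF x(2)] by simp
qed

end

lemma coord_endo_J:
  assumes \<rho>: "\<rho> = prod_chart \<phi> \<psi>" "\<phi> \<in> A" "\<psi> \<in> B" and x: "x \<in> chart_box \<phi> \<psi>"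
  shows "P.coord_endo J \<rho> x u = rot_pair \<phi> \<psi> x u"
proof -
  obtain p q where pq: "p \<in> fst \<phi>" "q \<in> fst \<psi>" "x = (snd \<phi> p, snd \<psi> q)" using x by auto
  have c: "\<phi> \<in> charts_at A p" "\<psi> \<in> charts_at B q" using A.charts_at_I[OF \<rho>(2) pq(1)] B.charts_at_I[OF \<rho>(3) pq(2)] .
  have i: "chart_inv \<rho> x = (p, q)" unfolding \<rho>(1) pq(3) by (rule chart_inv_prod_chart[OF \<rho>(2,3) pq(1,2)])
  have pc: "\<rho> \<in> charts_at P (p, q)" unfolding \<rho>(1) by (rule prod_chart_at[OF c])
  have "(p, q) \<in> topspace XY" using A.chart_subset[OF \<rho>(2)] B.chart_subset[OF \<rho>(3)] pq by auto
  note * = J_component(2)[OF this P.coord_vec_tangent[OF pc] \<rho>(1), of u]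
  have "J (p, q) (coord_vec P \<rho> (p, q) u) \<rho> = rot_pair \<phi> \<psi> (snd \<rho> (p, q)) u"
    using * c by (simp only: P.coord_vec_same[OF pc] fst_conv snd_conv)
  then show ?thesis unfolding i by (simp add: \<rho>(1) pq(3))
qed

lemma smooth_J: "smooth_endo XY P J"
  unfolding smooth_endo_def
proof (intro conjI ballI allI)
  fix z assume z: "z \<in> topspace XY"
  obtain \<rho> where pc: "\<rho> \<in> charts_at P z" using P.ex_chart[OF z] by blast
  obtain \<phi> \<psi> where r: "\<rho> = prod_chart \<phi> \<psi>" "\<phi> \<in> charts_at A (fst z)" "\<psi> \<in> charts_at B (snd z)" "\<phi> \<in> A" "\<psi> \<in> B" "snd \<rho> z \<in> chart_box \<phi> \<psi>"
    using chart_at_cases[OF pc] .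
  note l = linear_rot_pair[OF r(4,5,6)]
  show "linear_endo_on (tangent_space P z) (J z)"
    unfolding linear_endo_on_def
  proof (intro conjI ballI allI)
    show "J z ` tangent_space P z \<subseteq> tangent_space P z" using J_component(1)[OF z _ r(1-3)] by blast
    fix v w a b assume T: "v \<in> tangent_space P z" "w \<in> tangent_space P z"
    have T': "a *\<^sub>R v + b *\<^sub>R w \<in> tangent_space P z"
      by (intro subspace_add subspace_scale P.subspace_tangent_space z T)
    show "J z (a *\<^sub>R v + b *\<^sub>R w) = a *\<^sub>R J z v + b *\<^sub>R J z w"
      unfolding J_eq[OF z T' r(1-3)] J_eq[OF z T(1) r(1-3)] J_eq[OF z T(2) r(1-3)]
      by (simp add: scaleR_fun_apply linear_add[OF l] linear_cmul[OF l] linear_add[OF P.linear_coord_vec[OF pc]]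
        linear_cmul[OF P.linear_coord_vec[OF pc]])
  qed
next
  fix \<rho> u assume "\<rho> \<in> P"
  then obtain \<phi> \<psi> where \<rho>: "\<rho> = prod_chart \<phi> \<psi>" "\<phi> \<in> A" "\<psi> \<in> B" by (rule prod_atlas_cases)
  have "smooth_on (chart_box \<phi> \<psi>) (\<lambda>x. P.coord_endo J \<rho> x u)"
    by (rule iffD2[OF smooth_on_cong[OF open_chart_box[OF \<rho>(2,3)]] smooth_rot_pair[OF \<rho>(2,3)]]) (rule coord_endo_J[OF \<rho>])
  then show "smooth_on (snd \<rho> ` fst \<rho>) (\<lambda>x. P.coord_endo J \<rho> x u)"
    unfolding \<rho>(1) prod_chart_image .
qed

lemma J_J:
  assumes z: "z \<in> topspace XY" and v: "v \<in> tangent_space P z"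
  shows "J z (J z v) = - v"
proof -
  obtain \<rho> where pc: "\<rho> \<in> charts_at P z" using P.ex_chart[OF z] by blast
  obtain \<phi> \<psi> where r: "\<rho> = prod_chart \<phi> \<psi>" "\<phi> \<in> charts_at A (fst z)" "\<psi> \<in> charts_at B (snd z)" "\<phi> \<in> A" "\<psi> \<in> B" "snd \<rho> z \<in> chart_box \<phi> \<psi>"
    using chart_at_cases[OF pc] .
  show ?thesis
    unfolding J_eq[OF z J_component(1)[OF z v r(1-3)] r(1-3)] J_component(2)[OF z v r(1-3)] rot_pair_rot_pair[OF r(4-6)]
    by (simp add: linear_neg[OF P.linear_coord_vec[OF pc]] P.coord_vec_component[OF v pc])
qed

lemma almost_complex_J: "almost_complex XY P J"
  unfolding almost_complex_def using smooth_J J_J by blast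

lemma integrable_J: "integrable_almost_complex XY P J"
  unfolding integrable_almost_complex_def
proof (intro conjI almost_complex_J allI impI ballI ext)
  fix U V W z \<rho>
  assume *: "openin XY U \<and> smooth_vector_field P U V \<and> smooth_vector_field P U W" and z: "z \<in> U"
  then have U: "openin XY U" and V: "smooth_vector_field P U V" and W: "smooth_vector_field P U W" by auto
  have zX: "z \<in> topspace XY" using U z openin_subset by blast
  show "nijenhuis P J V W z \<rho> = 0 \<rho>"
  proof (cases "\<rho> \<in> charts_at P z")
    case True
    obtain \<phi> \<psi> where r: "\<rho> = prod_chart \<phi> \<psi>" "\<phi> \<in> A" "\<psi> \<in> B" "snd \<rho> z \<in> chart_box \<phi> \<psi>" using chart_at_cases[OF True] .
    note n = P.nijenhuis_coords[OF almost_complex_J U V W z True refl refl refl refl]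
    have d: "dd (\<lambda>y. P.coord_endo J \<rho> y u) (snd \<rho> z) = dd (\<lambda>y. rot_pair \<phi> \<psi> y u) (snd \<rho> z)" for u
      by (rule frechet_derivative_cong_open[OF open_chart_box[OF r(2,3)] r(4)]) (rule coord_endo_J[OF r(1-3)])
    show ?thesis
      unfolding n d coord_endo_J[OF r] nijenhuis_rot_pair[OF r(2-4)] by simp
  next
    case False
    \<comment> \<open>In a chart away from \<open>z\<close> every component is 0 by convention. For
      the terms in which \<open>J\<close> is applied to a bracket this follows from
      tangency.\<close>
    have T: "lie_bracket P (\<lambda>q. J q (V q)) W z \<in> tangent_space P z" "lie_bracket P V (\<lambda>q. J q (W q)) z \<in> tangent_space P z"
      by (intro P.lie_bracket_tangent[OF U] P.smooth_vector_field_endo[OF smooth_J U] V W z)+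
    have "J z v \<rho> = 0" if "v \<in> tangent_space P z" for v
      by (rule P.tangent_outside[OF P.endo_tangent[OF smooth_J zX that] False])
    then show ?thesis using T False by (simp add: nijenhuis_def lie_bracket_def)
  qed
qed

lemma symplectic_\<Omega>: "symplectic_form XY P \<Omega>"
  unfolding symplectic_form_def
proof (intro conjI ballI allI impI smooth_\<Omega>)
  show self: "\<Omega> z v v = 0" if z: "z \<in> topspace XY" and v: "v \<in> tangent_space P z" for z v
  proof -
    obtain \<rho> where pc: "\<rho> \<in> charts_at P z" using P.ex_chart[OF z] by blast
    obtain \<phi> \<psi> where r: "\<rho> = prod_chart \<phi> \<psi>" "\<phi> \<in> A" "\<psi> \<in> B" "snd \<rho> z \<in> chart_box \<phi> \<psi>" using chart_at_cases[OF pc] .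
    show ?thesis
      unfolding P.form_eq_coord_form[OF v v pc] using coord_form_\<Omega>_self[OF r(2,3)] r(1,4) by simp
  qed
  show "nondegenerate_on (tangent_space P z) (\<Omega> z)" if z: "z \<in> topspace XY" for z
  proof -
    obtain \<rho> where pc: "\<rho> \<in> charts_at P z" using P.ex_chart[OF z] by blast
    obtain \<phi> \<psi> where r: "\<rho> = prod_chart \<phi> \<psi>" "\<phi> \<in> A" "\<psi> \<in> B" "snd \<rho> z \<in> chart_box \<phi> \<psi>" using chart_at_cases[OF pc] .
    interpret M: local_metric "chart_box \<phi> \<psi>" "coord_form P G \<rho>" unfolding r(1) by (rule local_metric_G[OF r(2,3)])
    show ?thesis
    proof (rule P.coord_form_nondegenerate[OF pc])
      fix u assume "\<And>v. coord_form P \<Omega> \<rho> (snd \<rho> z) u v = 0"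
      \<comment> \<open>Pairing \<open>u\<close> by \<Omega> is pairing its rotation by the metric,
        so nondegeneracy passes from \<open>G\<close> to \<Omega> through the invertible
        rotation.\<close>
      then have "rot_pair \<phi> \<psi> (snd \<rho> z) u = 0"
        using coord_form_\<Omega>_G[OF r(2-4)] r(1) by (intro M.nondeg[OF r(4)]) simp
      then show "u = 0"
        using rot_pair_rot_pair[OF r(2-4), of u] linear_0[OF linear_rot_pair[OF r(2-4)]] by simp
    qed
  qed
  fix S U V W z
  assume "openin XY S \<and> smooth_vector_field P S U \<and> smooth_vector_field P S V \<and> smooth_vector_field P S W" and z: "z \<in> S"
  then have S: "openin XY S" and F: "smooth_vector_field P S U" "smooth_vector_field P S V" "smooth_vector_field P S W" by auto
  have zX: "z \<in> topspace XY" using S z openin_subset by blast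
  obtain \<phi> \<psi> where r: "some_chart P z = prod_chart \<phi> \<psi>" "\<phi> \<in> A" "\<psi> \<in> B" "snd (some_chart P z) z \<in> chart_box \<phi> \<psi>"
    using chart_at_cases[OF P.some_chart_at[OF zX]] .
  let ?r = "some_chart P z"
  let ?K = "coord_form P \<Omega> ?r"
  have "exterior_deriv P \<Omega> U V W z = dd (\<lambda>y. ?K y (V z ?r) (W z ?r)) (snd ?r z) (U z ?r)
     - dd (\<lambda>y. ?K y (U z ?r) (W z ?r)) (snd ?r z) (V z ?r) + dd (\<lambda>y. ?K y (U z ?r) (V z ?r)) (snd ?r z) (W z ?r)"
    by (rule P.exterior_deriv_coords[OF smooth_\<Omega> self S F z refl refl refl refl refl refl])
  also have "\<dots> = 0"
    unfolding r(1) by (rule \<Omega>_closed_coords[OF r(2,3) r(4)[unfolded r(1)]])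
  finally show "exterior_deriv P \<Omega> U V W z = 0" .
qed

lemma compatible:
  assumes z: "z \<in> topspace XY" and v: "v \<in> tangent_space P z" and w: "w \<in> tangent_space P z"
  shows "\<Omega> z (J z v) (J z w) = \<Omega> z v w" "\<Omega> z v w = G z (J z v) w"
proof -
  obtain \<rho> where pc: "\<rho> \<in> charts_at P z" using P.ex_chart[OF z] by blast
  obtain \<phi> \<psi> where r: "\<rho> = prod_chart \<phi> \<psi>" "\<phi> \<in> charts_at A (fst z)" "\<psi> \<in> charts_at B (snd z)" "\<phi> \<in> A" "\<psi> \<in> B" "snd \<rho> z \<in> chart_box \<phi> \<psi>"
    using chart_at_cases[OF pc] .
  note T = J_component(1)[OF z v r(1-3)] J_component(1)[OF z w r(1-3)]
  show "\<Omega> z (J z v) (J z w) = \<Omega> z v w" "\<Omega> z v w = G z (J z v) w"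
    unfolding P.form_eq_coord_form[OF T pc] P.form_eq_coord_form[OF v w pc] P.form_eq_coord_form[OF T(1) w pc]
      J_component(2)[OF z v r(1-3)] J_component(2)[OF z w r(1-3)]
    using coord_form_\<Omega>_rot_pair[OF r(4-6)] coord_form_\<Omega>_G[OF r(4-6)] r(1) by simp_all
qed

section \<open>Conformal flatness on the product manifold\<close>

lemma coord_form_conformal:
  "coord_form P (\<lambda>q u v. l q * b q u v) \<rho> = (\<lambda>x u v. l (chart_inv \<rho> x) * coord_form P b \<rho> x u v)"
  by (simp add: coord_form_def fun_eq_iff)

lemma conformally_flat_imp_curvature:
  assumes cf: "locally_conformally_flat XY P G" and p: "p \<in> topspace X" and q: "q \<in> topspace Y"
  shows "gauss_curvature A g1 p = - \<epsilon> * gauss_curvature B g2 q"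
proof -
  let ?z = "(p, q)"
  have z: "?z \<in> topspace XY" using p q by simp
  from cf[unfolded locally_conformally_flat_def, rule_format, OF z]
  obtain W l where W: "openin XY W" "?z \<in> W" "smooth_function P W l" and "\<forall>q\<in>W. l q > 0"
    and flat_W: "flat_on P W (\<lambda>q u v. l q * G q u v)"
    by (elim exE conjE) (rule that)
  note W_pos = \<open>\<forall>q\<in>W. l q > 0\<close>[rule_format]
  obtain \<rho> where pc: "\<rho> \<in> charts_at P ?z" using P.ex_chart[OF z] by blast
  obtain \<phi> \<psi> where r: "\<rho> = prod_chart \<phi> \<psi>" "\<phi> \<in> charts_at A (fst ?z)" "\<psi> \<in> charts_at B (snd ?z)" "\<phi> \<in> A" "\<psi> \<in> B" "snd \<rho> ?z \<in> chart_box \<phi> \<psi>"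
    using chart_at_cases[OF pc] .
  note d = P.charts_at_D[OF pc]
  let ?W = "P.coords \<rho> W"
  have oW: "open ?W" by (rule P.open_coords[OF d(1) W(1)])
  have WS: "?W \<subseteq> chart_box \<phi> \<psi>" unfolding prod_chart_image[symmetric] r(1) by auto
  have zW: "snd \<rho> ?z \<in> ?W" using d W(2) by auto
  \<comment> \<open>Puts the given factor \<open>l\<close> into the form of an inverse square, to
    which the conformal curvature formula applies.\<close>
  define f where "f x = inverse (sqrt (l (chart_inv \<rho> x)))" for x
  have lpos: "l (chart_inv \<rho> x) > 0" if "x \<in> ?W" for x using that W_pos d(1) by auto
  have sl: "smooth_on ?W (\<lambda>x. l (chart_inv \<rho> x))" using W(3) d(1) by (auto simp: smooth_function_def comp_def)
  have sf: "smooth_on ?W f"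
    unfolding f_def by (intro smooth_on_inverse smooth_on_sqrt oW sl) (auto simp: lpos)
  have fpos: "f x > 0" if "x \<in> ?W" for x using lpos[OF that] by (simp add: f_def)
  let ?h = "\<lambda>z u v. h1 \<phi> (fst z) (fst u) (fst v) + \<epsilon> * h2 \<psi> (snd z) (snd u) (snd v)"
  interpret M: local_metric ?W ?h
    by (rule local_metric_subset[OF local_metric_G(1)[OF r(4,5)] oW WS])
  have "curvature (coord_form P (\<lambda>q u v. l q * G q u v) \<rho>) (snd \<rho> ?z) =
    curvature (\<lambda>y u v. (inverse (f y))\<^sup>2 * ?h y u v) (snd \<rho> ?z)"
  proof (rule local_metric_cong(3)[OF M.conformal_metric[OF sf fpos] _ zW])
    fix x u v assume x: "x \<in> ?W"
    then have "x \<in> chart_box \<phi> \<psi>" using WS by blast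
    from coord_form_prod[OF r(4,5) this]
    show "(inverse (f x))\<^sup>2 * ?h x u v = coord_form P (\<lambda>q u v. l q * G q u v) \<rho> x u v"
      unfolding coord_form_conformal r(1)[symmetric] f_def using lpos[OF x] by simp
  qed
  moreover have "curvature (coord_form P (\<lambda>q u v. l q * G q u v) \<rho>) (snd \<rho> ?z) u v w = 0" for u v w
  proof -
    have "riemann_tensor P (\<lambda>q u v. l q * G q u v) ?z (coord_vec P \<rho> ?z u) (coord_vec P \<rho> ?z v) (coord_vec P \<rho> ?z w) = 0"
      by (rule flat_W[unfolded flat_on_def, rule_format, OF W(2)]) (rule P.coord_vec_tangent[OF pc])+
    from fun_cong[OF this, of \<rho>] show ?thesis
      using pc by (simp add: riemann_tensor_def coord_curvature_eq P.coord_vec_same[OF pc])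
  qed
  ultimately have flat: "curvature (\<lambda>y u v. (inverse (f y))\<^sup>2 * ?h y u v) (snd \<rho> ?z) u v w = 0" for u v w by simp
  have "gauss (h1 \<phi>) (fst (snd \<rho> ?z)) = - \<epsilon> * gauss (h2 \<psi>) (snd (snd \<rho> ?z))"
    by (rule conformally_flat_product_curvature[OF A.local_surface_coord_form[OF r(4)] B.local_surface_coord_form[OF r(5)]
        oW WS zW \<epsilon> sf fpos flat])
  then show ?thesis
    using A.gauss_curvature_eq[OF r(2)] B.gauss_curvature_eq[OF r(3)] by (simp add: r(1))
qed

text \<open>The factor is constructed in one product chart at the point, while flatness and
  smoothness are required in all charts. Smoothness is carried over by composition with transition
  maps, flatness by \<open>curvature_change\<close>.\<close>

lemma curvature_imp_conformally_flat:
  assumes k1: "\<And>p. p \<in> topspace X \<Longrightarrow> gauss_curvature A g1 p = k1"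
    and k2: "\<And>q. q \<in> topspace Y \<Longrightarrow> gauss_curvature B g2 q = k2" and k: "k1 = - \<epsilon> * k2"
  shows "locally_conformally_flat XY P G"
  unfolding locally_conformally_flat_def
proof
  fix z assume z: "z \<in> topspace XY"
  obtain \<rho> where pc: "\<rho> \<in> charts_at P z" using P.ex_chart[OF z] by blast
  obtain \<phi> \<psi> where r: "\<rho> = prod_chart \<phi> \<psi>" "\<phi> \<in> charts_at A (fst z)" "\<psi> \<in> charts_at B (snd z)" "\<phi> \<in> A" "\<psi> \<in> B" "snd \<rho> z \<in> chart_box \<phi> \<psi>"
    using chart_at_cases[OF pc] .
  note d = P.charts_at_D[OF pc]
  let ?h = "\<lambda>z u v. h1 \<phi> (fst z) (fst u) (fst v) + \<epsilon> * h2 \<psi> (snd z) (snd u) (snd v)"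
  have g1: "gauss (h1 \<phi>) x = k1" if x: "x \<in> snd \<phi> ` fst \<phi>" for x
  proof -
    obtain p where p: "x = snd \<phi> p" "p \<in> fst \<phi>" using x by auto
    then show ?thesis
      using A.gauss_curvature_eq[OF A.charts_at_I[OF r(4) p(2)]] k1[of p] A.chart_subset[OF r(4)] by auto
  qed
  have g2: "gauss (h2 \<psi>) x = k2" if x: "x \<in> snd \<psi> ` fst \<psi>" for x
  proof -
    obtain p where p: "x = snd \<psi> p" "p \<in> fst \<psi>" using x by auto
    then show ?thesis
      using B.gauss_curvature_eq[OF B.charts_at_I[OF r(5) p(2)]] k2[of p] B.chart_subset[OF r(5)] by auto
  qed
  have zb: "fst (snd \<rho> z) \<in> snd \<phi> ` fst \<phi>" "snd (snd \<rho> z) \<in> snd \<psi> ` fst \<psi>" using r(6) by auto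
  obtain U V f where UV: "open U" "open V" "fst (snd \<rho> z) \<in> U" "snd (snd \<rho> z) \<in> V" "U \<subseteq> snd \<phi> ` fst \<phi>" "V \<subseteq> snd \<psi> ` fst \<psi>"
    and sf: "smooth_on (U \<times> V) f" and fpos: "\<And>y. y \<in> U \<times> V \<Longrightarrow> f y > 0"
    and flat: "\<And>y u v w. y \<in> U \<times> V \<Longrightarrow> curvature (\<lambda>y u v. (inverse (f y))\<^sup>2 * ?h y u v) y u v w = 0"
    by (rule constant_curvature_product_conformally_flat[OF A.local_surface_coord_form[OF r(4)] B.local_surface_coord_form[OF r(5)]
        zb g1 g2 \<epsilon> k]) blast+
  have oUV: "open (U \<times> V)" by (rule open_Times[OF UV(1,2)])
  \<comment> \<open>The neighbourhood and the factor are pulled back from the coordinate box;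
    outside the chart domain the values of \<open>l\<close> are irrelevant.\<close>
  define W where "W = {y \<in> fst \<rho>. snd \<rho> y \<in> U \<times> V}"
  define l where "l y = (inverse (f (snd \<rho> y)))\<^sup>2" for y
  have "continuous_map (subtopology XY (fst \<rho>)) euclidean (snd \<rho>)"
    using homeomorphic_imp_continuous_map[OF P.homeomorphic_chart[OF d(1)]] by (simp add: continuous_map_in_subtopology)
  then have "openin (subtopology XY (fst \<rho>)) {y \<in> topspace (subtopology XY (fst \<rho>)). snd \<rho> y \<in> U \<times> V}"
    by (rule openin_continuous_map_preimage) (simp add: oUV)
  moreover have ts: "topspace (subtopology XY (fst \<rho>)) = fst \<rho>" using P.chart_subset[OF d(1)] by (simp add: inf.absorb2)
  ultimately have "openin (subtopology XY (fst \<rho>)) W" unfolding W_def ts by simp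
  then have oW: "openin XY W" by (rule openin_trans_full[OF _ P.openin_chart[OF d(1)]])
  have zW: "z \<in> W" using d(2) UV(3,4) by (simp add: W_def mem_Times_iff)
  have si: "smooth_on (U \<times> V) (\<lambda>y. (inverse (f y))\<^sup>2)"
    unfolding power2_eq_square by (intro smooth_on_mult smooth_on_inverse oUV sf) (auto intro: fpos)
  have sl: "smooth_on (P.coords \<sigma> W) (\<lambda>x. l (chart_inv \<sigma> x))" if \<sigma>: "\<sigma> \<in> P" for \<sigma>
  proof -
    have 1: "smooth_on (P.coords \<sigma> W) (\<lambda>x. snd \<rho> (chart_inv \<sigma> x))"
      by (rule smooth_on_subset[OF P.smooth_on_transition[OF \<sigma> d(1)]]) (auto simp: W_def)
    have 2: "(\<lambda>x. snd \<rho> (chart_inv \<sigma> x)) ` P.coords \<sigma> W \<subseteq> U \<times> V"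
      using \<sigma> by (auto simp: W_def)
    show ?thesis
      unfolding l_def using smooth_on_compose[OF P.open_coords[OF \<sigma> oW] oUV 2 1 si] .
  qed
  have lpos: "l y > 0" if "y \<in> W" for y
    using fpos[of "snd \<rho> y"] that by (simp add: l_def W_def)
  let ?lG = "\<lambda>q u v. l q * G q u v"
  \<comment> \<open>The rescaled metric has to be a local metric in every chart that meets
    \<open>W\<close>, since curvatures are compared between \<rho> and an arbitrary chart.\<close>
  have lm: "local_metric (P.coords \<sigma> W) (coord_form P ?lG \<sigma>)" if \<sigma>: "\<sigma> \<in> P" for \<sigma>
  proof -
    obtain \<phi>' \<psi>' where s: "\<sigma> = prod_chart \<phi>' \<psi>'" "\<phi>' \<in> A" "\<psi>' \<in> B" using \<sigma> by (rule prod_atlas_cases)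
    have sub: "P.coords \<sigma> W \<subseteq> chart_box \<phi>' \<psi>'" unfolding prod_chart_image[symmetric] s(1) by auto
    interpret M: local_metric "P.coords \<sigma> W" "coord_form P G \<sigma>"
      by (rule local_metric_subset[OF _ P.open_coords[OF \<sigma> oW] sub]) (unfold s(1), rule local_metric_G(2)[OF s(2,3)])
    show ?thesis
      unfolding coord_form_conformal by (rule M.scaled_metric[OF sl[OF \<sigma>]]) (use \<sigma> lpos in auto)
  qed
  have UVb: "U \<times> V \<subseteq> chart_box \<phi> \<psi>" using UV(5,6) by auto
  interpret M: local_metric "U \<times> V" ?h
    by (rule local_metric_subset[OF local_metric_G(1)[OF r(4,5)] oUV UVb])
  have zero: "curvature (coord_form P ?lG \<rho>) x u v w = 0" if x: "x \<in> U \<times> V" for x u v w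
  proof -
    have "curvature (coord_form P ?lG \<rho>) x = curvature (\<lambda>y u v. (inverse (f y))\<^sup>2 * ?h y u v) x"
    proof (rule local_metric_cong(3)[OF M.conformal_metric[OF sf fpos] _ x])
      fix y u v assume "y \<in> U \<times> V"
      then have y: "y \<in> chart_box \<phi> \<psi>" using UVb by blast
      then have "snd \<rho> (chart_inv \<rho> y) = y"
        using d(1) unfolding prod_chart_image[symmetric] r(1)[symmetric] by auto
      then show "(inverse (f y))\<^sup>2 * ?h y u v = coord_form P ?lG \<rho> y u v"
        using coord_form_prod[OF r(4,5) y] unfolding coord_form_conformal r(1)[symmetric] l_def by simp
    qed
    then show ?thesis using flat[OF x] by simp
  qed
  have "flat_on P W ?lG"
    unfolding flat_on_def
  proof (intro ballI ext)
    fix y u v w \<sigma>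
    assume y: "y \<in> W" and T: "u \<in> tangent_space P y" "v \<in> tangent_space P y" "w \<in> tangent_space P y"
    show "riemann_tensor P ?lG y u v w \<sigma> = 0 \<sigma>"
    proof (cases "\<sigma> \<in> charts_at P y")
      case True
      have c: "\<rho> \<in> charts_at P y" using y d(1) by (auto simp: W_def intro: P.charts_at_I)
      have yUV: "snd \<rho> y \<in> U \<times> V" using y unfolding W_def by blast
      have "transition_deriv y \<rho> \<sigma> (curvature (coord_form P ?lG \<rho>) (snd \<rho> y) (u \<rho>) (v \<rho>) (w \<rho>)) =
         curvature (coord_form P ?lG \<sigma>) (snd \<sigma> y) (transition_deriv y \<rho> \<sigma> (u \<rho>)) (transition_deriv y \<rho> \<sigma> (v \<rho>)) (transition_deriv y \<rho> \<sigma> (w \<rho>))"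
        by (rule P.curvature_change[OF lm oW y c True])
      then show ?thesis
        unfolding zero[OF yUV] P.tangent_transition[OF T(1) c True, symmetric] P.tangent_transition[OF T(2) c True, symmetric]
          P.tangent_transition[OF T(3) c True, symmetric] linear_0[OF P.linear_transition[OF c True]]
        using True by (simp add: riemann_tensor_def coord_curvature_eq)
    qed (simp add: riemann_tensor_def)
  qed
  moreover have "smooth_function P W l" using sl by (simp add: smooth_function_def comp_def)
  ultimately show "\<exists>W l. openin XY W \<and> z \<in> W \<and> smooth_function P W l \<and> (\<forall>q\<in>W. l q > 0) \<and> flat_on P W (\<lambda>q u v. l q * G q u v)"
    using oW zW lpos by blast
qed

end

theorem theorem1:
  fixes X1 :: "'a topology" and A1 :: "('a, real^2) chart set" and g1 :: "('a, real^2) form"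
    and X2 :: "'b topology" and A2 :: "('b, real^2) chart set" and g2 :: "('b, real^2) form"
    and \<epsilon> :: real
  assumes "smooth_manifold X1 A1" "oriented_atlas A1" "riemannian_metric X1 A1 g1"
    and "connected_space X1" "complete_riemannian X1 A1 g1"
    and "smooth_manifold X2 A2" "oriented_atlas A2" "riemannian_metric X2 A2 g2"
    and "connected_space X2" "complete_riemannian X2 A2 g2"
    and "\<epsilon> \<in> {1, -1}"
  shows "pseudo_kahler (prod_topology X1 X2) (prod_atlas A1 A2)
      (prod_form A1 A2 \<epsilon> g1 g2)
      (prod_endo A1 A2 (rotation A1 g1) (rotation A2 g2))
      (prod_form A1 A2 \<epsilon> (area_form A1 g1) (area_form A2 g2))
    \<and> (\<forall>p\<in>topspace (prod_topology X1 X2). dim (tangent_space (prod_atlas A1 A2) p) = 4)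
    \<and> riemannian_metric (prod_topology X1 X2) (prod_atlas A1 A2) (prod_form A1 A2 1 g1 g2)
    \<and> metric_signature (prod_topology X1 X2) (prod_atlas A1 A2) (prod_form A1 A2 (-1) g1 g2) 2 2
    \<and> (locally_conformally_flat (prod_topology X1 X2) (prod_atlas A1 A2) (prod_form A1 A2 \<epsilon> g1 g2)
       \<longleftrightarrow> gauss_curvature A1 g1 constant_on topspace X1
         \<and> gauss_curvature A2 g2 constant_on topspace X2
         \<and> (\<forall>p\<in>topspace X1. \<forall>q\<in>topspace X2.
              gauss_curvature A1 g1 p = - \<epsilon> * gauss_curvature A2 g2 q))"
proof -
  have m1: "Hausdorff_space X1" "second_countable X1" "topspace X1 \<noteq> {}" "smooth_atlas X1 A1"
    and m2: "Hausdorff_space X2" "second_countable X2" "topspace X2 \<noteq> {}" "smooth_atlas X2 A2"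
    using assms by (auto simp: smooth_manifold_def)
  have sp: "surface_product X1 A1 g1 X2 A2 g2 \<delta>" if "\<delta> \<in> {1, -1}" for \<delta>
    using assms m1 m2 that by unfold_locales auto
  \<comment> \<open>The statement speaks of \<epsilon> and also of both fixed signs, so the product
    is instantiated three times.\<close>
  interpret S: surface_product X1 A1 g1 X2 A2 g2 \<epsilon> by (rule sp[OF assms(11)])
  interpret S1: surface_product X1 A1 g1 X2 A2 g2 1 by (rule sp) simp
  interpret S2: surface_product X1 A1 g1 X2 A2 g2 "-1" by (rule sp) simp
  have manifold: "smooth_manifold (prod_topology X1 X2) (prod_atlas A1 A2)"
    unfolding smooth_manifold_def
    using m1 m2 S.smooth_atlas_prod by (auto simp: Hausdorff_space_prod_topology second_countable_prod_topology)
  have kahler: "pseudo_kahler (prod_topology X1 X2) (prod_atlas A1 A2) S.G S.J S.\<Omega>"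
    unfolding pseudo_kahler_def
    using manifold S.pseudo_riemannian_G S.integrable_J S.symplectic_\<Omega> S.compatible by blast
  have iff: "locally_conformally_flat (prod_topology X1 X2) (prod_atlas A1 A2) S.G \<longleftrightarrow>
    gauss_curvature A1 g1 constant_on topspace X1 \<and> gauss_curvature A2 g2 constant_on topspace X2 \<and>
    (\<forall>p\<in>topspace X1. \<forall>q\<in>topspace X2. gauss_curvature A1 g1 p = - \<epsilon> * gauss_curvature A2 g2 q)"
    (is "?L \<longleftrightarrow> ?R")
  proof
    assume ?L
    note e = S.conformally_flat_imp_curvature[OF this]
    obtain p0 q0 where pq: "p0 \<in> topspace X1" "q0 \<in> topspace X2" using m1(3) m2(3) by blast
    \<comment> \<open>Separation of variables: with \<open>p0\<close> fixed, the curvature identity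
      at \<open>q\<close> and at \<open>q0\<close> has the same left-hand side, and \<epsilon> is
      nonzero.\<close>
    have "gauss_curvature A2 g2 q = gauss_curvature A2 g2 q0" if "q \<in> topspace X2" for q
      using e[OF pq] e[OF pq(1) that] S.\<epsilon>_nz by simp
    then show ?R using e pq unfolding constant_on_def by metis
  next
    assume R: ?R
    obtain k1 k2 where k: "\<And>p. p \<in> topspace X1 \<Longrightarrow> gauss_curvature A1 g1 p = k1" "\<And>q. q \<in> topspace X2 \<Longrightarrow> gauss_curvature A2 g2 q = k2"
      using R unfolding constant_on_def by blast
    then have "k1 = - \<epsilon> * k2" using R m1(3) m2(3) by (metis all_not_in_conv)
    then show ?L using S.curvature_imp_conformally_flat[OF k] by blast
  qed
  have dim: "\<forall>p\<in>topspace (prod_topology X1 X2). dim (tangent_space (prod_atlas A1 A2) p) = 4"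
    using S.P.dim_tangent_space by simp
  have sig: "metric_signature (prod_topology X1 X2) (prod_atlas A1 A2) (prod_form A1 A2 (-1) g1 g2) 2 2"
    using S2.signature_G by simp
  show ?thesis
    using kahler dim S1.riemannian_G[OF refl] sig iff by blast
qed

end
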